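(* Let $i_1=-2.3381\ldots$ be the largest (first negative) zero of the Airy function $\mathrm{Ai}$, and set $$a_0=-\frac{i_1}{2^{1/3}}=1.8557\ldots,\quad C_0=4^{1/3}\sqrt{\pi/e}\,|\mathrm{Ai}'(i_1)|=1.1966\ldots,\quad a_1=|i_1|=2.3381\ldots,\quad C_1=\sqrt{2\pi/e}\,|\mathrm{Ai}'(i_1)|=1.0660\ldots.$$ Then the limits below exist and, as $k\to\infty$ and $m\to\infty$ respectively, $$\tau_k^*:=\lim_{n\to\infty}\tau_{n,k}=C_0\Big(\frac2e\Big)^k e^{-a_0k^{1/3}}k^{-1/6}\big(1+O(k^{-1/3})\big),$$ $$\tau_m^{**}:=\lim_{n\to\infty}n^{m/2}\tau_{n,n-m}=C_1\Big(\frac{em}{2}\Big)^{m/2}e^{-a_1m^{1/3}}m^{-1/6}\big(1+O(m^{-1/3})\big).$$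
   Context: $T_n$ denotes the Chebyshev polynomial of the first kind of degree $n$, $T_n(\cos\theta)=\cos n\theta$. For integers $n\ge k+2$, $k\ge 1$, let $\omega_{n,k}$ be the rightmost (largest) zero of $T_n^{(k+1)}$ and define $\tau_{n,k}:=|T_n^{(k)}(\omega_{n,k})|/T_n^{(k)}(1)$. *)

theory Defs
  imports "HOL-Analysis.Analysis" "HOL-Computational_Algebra.Polynomial" "HOL-Library.Landau_Symbols"
begin

fun cheb :: "nat \<Rightarrow> real poly" where
  "cheb 0 = 1"
| "cheb (Suc 0) = [:0, 1:]"
| "cheb (Suc (Suc n)) = [:0, 2:] * cheb (Suc n) - cheb n"

definition chebD :: "nat \<Rightarrow> nat \<Rightarrow> real \<Rightarrow> real" where
  "chebD n k x = poly ((pderiv ^^ k) (cheb n)) x"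

definition omega :: "nat \<Rightarrow> nat \<Rightarrow> real" where
  "omega n k = (GREATEST x. chebD n (Suc k) x = 0)"

definition tau :: "nat \<Rightarrow> nat \<Rightarrow> real" where
  "tau n k = \<bar>chebD n k (omega n k)\<bar> / chebD n k 1"

text \<open>The Airy function Ai via its Maclaurin series (DLMF 9.4.1):
  Ai(x) = Ai(0) f(x) + Ai'(0) g(x), with
  f(x) = sum 3^k (1/3)_k x^(3k)/(3k)!, g(x) = sum 3^k (2/3)_k x^(3k+1)/(3k+1)!,
  Ai(0) = 1/(3^(2/3) Gamma(2/3)), Ai'(0) = -1/(3^(1/3) Gamma(1/3)).\<close>
definition airy_f :: "real \<Rightarrow> real" where
  "airy_f x = (\<Sum>k. 3 ^ k * pochhammer (1/3) k * x ^ (3*k) / fact (3*k))"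

definition airy_g :: "real \<Rightarrow> real" where
  "airy_g x = (\<Sum>k. 3 ^ k * pochhammer (2/3) k * x ^ (3*k+1) / fact (3*k+1))"

definition Ai :: "real \<Rightarrow> real" where
  "Ai x = airy_f x / (3 powr (2/3) * Gamma (2/3))
          - airy_g x / (3 powr (1/3) * Gamma (1/3))"

definition airy_i1 :: real where
  "airy_i1 = (GREATEST x. Ai x = 0)"

end

theory Submission
  imports Defs "HOL-Complex_Analysis.Complex_Analysis" "HOL-Probability.Probability" "HOL-Real_Asymp.Real_Asymp"
begin

text \<open>
  Near \<open>1\<close>, on the scale \<open>1/n\<^sup>2\<close>, the normalised derivative \<open>T\<^sub>n\<^bsup>(k)\<^esup>\<close> converges to a spherical Bessel function;
  near \<open>0\<close>, on the scale \<open>1 / sqrt n\<close>, \<open>T\<^sub>n\<^bsup>(n-m)\<^esup>\<close> converges to a Hermite polynomial. Hence both limits are values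
  of such a function at the extreme zero of its neighbour in the family. Each family has a contour integral with a
  double saddle point in the transition region. Taken along a ray of angle \<open>\<pi>/4\<close> (Bessel) or \<open>\<pi>/3\<close> (Hermite)
  through the saddle point it becomes, with \<open>\<epsilon>\<close> of order \<open>k\<^bsup>-1/3\<^esup>\<close>, \<open>Ai z + (\<sigma>\<epsilon>/4) Ai'''' z + O(\<epsilon>\<^sup>2)\<close> where \<open>\<sigma> = \<plusminus>1\<close>.
  By the Airy equation \<open>Ai'''' z = z\<^sup>2 Ai z + 2 Ai' z\<close>, so the extreme zero is at \<open>z = i\<^sub>1 - \<sigma>\<epsilon>/2 + O(\<epsilon>\<^sup>2)\<close>. This second-order
  precision is what is needed, because \<open>z\<close> enters the answer through \<open>exp (z/\<epsilon>)\<close>; it is also the origin of the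
  factor \<open>e\<^bsup>-1/2\<^esup>\<close> in \<open>C\<^sub>0\<close>.
\<close>


section \<open>Integrals over rays\<close>

text \<open>The value at an extreme zero is governed by \<open>Ai'\<close> rather than
  \<open>Ai\<close>: there the integral without an extra factor \<open>p\<close> vanishes, and the
  neighbour in the family is, up to an explicit factor, \<epsilon> times the integral with one such
  factor. This is why \<open>Ai'\<close> at \<open>airy_i1\<close> appears in both constants, and
  why first-order accuracy suffices for it. The obstacle is uniformity: the errors must be
  O(\<epsilon>^2) for all z in a fixed compact range at once, although the contour runs far beyond
  the saddle point. All kernels are therefore compared with the Airy exponential pointwise, under
  the single weight \<open>exp (3 * t - t\<^sup>2 / 4)\<close> and with absolute constants. In the
  Hermite case the shift of the root contributes e^(1/2), which completes e^((m-1)/2) to e^(m/2);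
  the factor e^(-1/2) in the constant comes from rewriting (m-1)^(m/2) in terms of m^(m/2).\<close>

lemma exp_minus_Ici:
  "set_integrable lborel {0..} (\<lambda>t::real. exp (-t))" "(LINT t:{0..}|lborel. exp (-t::real)) = 1"
proof -
  have I: "((\<lambda>t::real. exp (-t)) has_integral 1) {0..}"
    using has_integral_exp_minus_to_infinity[of 1 0] by simp
  have N: "has_bochner_integral lborel (\<lambda>t::real. indicator {0..} t *\<^sub>R exp (-t)) 1"
  proof (rule has_bochner_integral_nn_integral)
    have "((\<lambda>t::real. if t \<in> {0..} then exp (-t) else 0) has_integral 1) UNIV"
      using I by (subst has_integral_restrict_UNIV)
    moreover have "(\<lambda>t::real. if t \<in> {0..} then exp (-t) else 0) = (\<lambda>t. indicator {0..} t *\<^sub>R exp (-t))"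
      by (auto simp: fun_eq_iff)
    ultimately have "((\<lambda>t::real. indicator {0..} t *\<^sub>R exp (-t)) has_integral 1) UNIV" by simp
    then show "(\<integral>\<^sup>+ x. ennreal (indicator {0..} x *\<^sub>R exp (- x)) \<partial>lborel) = ennreal 1"
      by (intro nn_integral_has_integral_lborel) auto
  qed auto
  from N show "set_integrable lborel {0..} (\<lambda>t::real. exp (-t))"
    by (auto simp: set_integrable_def has_bochner_integral_iff)
  from N show "(LINT t:{0..}|lborel. exp (-t::real)) = 1"
    by (auto simp: set_lebesgue_integral_def has_bochner_integral_iff)
qed

text \<open>Ray integrals are controlled through this majorant: as \<open>exp (-t)\<close> has
  integral 1 over the half-line, the pointwise constant \<open>C\<close> is at the same time a bound
  for the integral.\<close>

lemma set_integrable_Ici_exp_bound: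
  fixes f :: "real \<Rightarrow> 'a::{banach, second_countable_topology}"
  assumes "set_borel_measurable lborel {0..} f" "\<And>t. t \<ge> 0 \<Longrightarrow> norm (f t) \<le> C * exp (-t)"
  shows "set_integrable lborel {0..} f" "norm (LINT t:{0..}|lborel. f t) \<le> C"
proof -
  have I: "set_integrable lborel {0..} (\<lambda>t::real. C * exp (-t))"
    using exp_minus_Ici(1) by simp
  show *: "set_integrable lborel {0..} f"
    by (rule set_integrable_bound[OF I assms(1)]) (use assms(2) in \<open>auto intro: order_trans[OF _ abs_ge_self]\<close>)
  have "norm (LINT t:{0..}|lborel. f t) \<le> (LINT t:{0..}|lborel. C * exp (-t))"
    unfolding set_lebesgue_integral_def
    by (rule Bochner_Integration.integral_norm_bound_integral)
       (use * I assms(2) in \<open>auto simp: set_integrable_def indicator_def\<close>)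
  also have "\<dots> = C" using exp_minus_Ici(2) by simp
  finally show "norm (LINT t:{0..}|lborel. f t) \<le> C" .
qed

lemma set_borel_measurable_Ici_continuous:
  fixes f :: "real \<Rightarrow> 'a::real_normed_vector"
  assumes "continuous_on {0..} f"
  shows "set_borel_measurable lborel {0..} f"
  unfolding set_borel_measurable_def
  using borel_measurable_continuous_on_indicator[OF _ assms] by simp

lemma tendsto_integral_Ici_FTC:
  fixes F :: "real \<Rightarrow> 'a::euclidean_space"
  assumes "set_integrable lborel {0..} f"
    and "\<And>t. t \<ge> 0 \<Longrightarrow> (F has_vector_derivative f t) (at t within {0..})" and "continuous_on {0..} f"
  shows "((\<lambda>R. F R - F 0) \<longlongrightarrow> (LINT t:{0..}|lborel. f t)) at_top"
proof -
  have "((\<lambda>y. \<integral>x. indicator {..y} x *\<^sub>R (indicator {0..} x *\<^sub>R f x) \<partial>lborel) \<longlongrightarrow> (LINT t:{0..}|lborel. f t)) at_top"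
    unfolding set_lebesgue_integral_def
    by (rule tendsto_integral_at_top) (use assms(1) in \<open>auto simp: set_integrable_def\<close>)
  moreover have "eventually (\<lambda>y. (\<integral>x. indicator {..y} x *\<^sub>R (indicator {0..} x *\<^sub>R f x) \<partial>lborel) = F y - F 0) at_top"
    using eventually_ge_at_top[of 0]
  proof eventually_elim
    case (elim y)
    have eq: "indicator {..y} x *\<^sub>R (indicator {0..} x *\<^sub>R f x) = indicator {0..y} x *\<^sub>R f x" for x
      by (auto simp: indicator_def)
    show ?case unfolding eq
    proof (rule integral_FTC_Icc[OF elim])
      show "(F has_vector_derivative f x) (at x within {0..y})" if "0 \<le> x" "x \<le> y" for x
        by (rule has_vector_derivative_within_subset[OF assms(2)]) (use that in auto)
      show "continuous_on {0..y} f"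
        by (rule continuous_on_subset[OF assms(3)]) auto
    qed
  qed
  ultimately show ?thesis
    by (rule Lim_transform_eventually)
qed

lemma set_integral_Ici_scale:
  fixes f :: "real \<Rightarrow> 'a::{banach, second_countable_topology}"
  assumes "r > 0"
  shows "(LINT t:{0..}|lborel. f t) = r *\<^sub>R (LINT t:{0..}|lborel. f (r * t))"
proof -
  have eq: "indicator {0..} (r * x) = (indicator {0..} x :: real)" for x
    using assms by (auto simp: indicator_def zero_le_mult_iff)
  have "(\<integral>t. indicator {0..} t *\<^sub>R f t \<partial>lborel) = \<bar>r\<bar> *\<^sub>R (\<integral>t. indicator {0..} (0 + r * t) *\<^sub>R f (0 + r * t) \<partial>lborel)"
    by (rule lborel_integral_real_affine) (use assms in auto)
  then show ?thesis
    using assms unfolding set_lebesgue_integral_def add_0_left eq by (simp only: abs_of_pos)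
qed

lemma power_le_fact_exp: "(x::real) \<ge> 0 \<Longrightarrow> x ^ n \<le> fact n * exp x"
proof -
  assume x: "x \<ge> 0"
  have S: "(\<lambda>i. x ^ i / fact i) sums exp x"
    using exp_converges[of x] by (simp add: divide_inverse mult.commute)
  have "x ^ n / fact n = (\<Sum>i\<in>{n}. x ^ i / fact i)" by simp
  also have "\<dots> \<le> (\<Sum>i. x ^ i / fact i)"
    by (rule sum_le_suminf) (use x S in \<open>auto intro: sums_summable\<close>)
  also have "\<dots> = exp x" using S by (rule sums_unique[symmetric])
  finally show ?thesis by (simp add: pos_divide_le_eq mult.commute)
qed

text \<open>The power costs one factor \<open>exp t\<close>, the target \<open>exp (-t)\<close>
  another, and completing the square in \<open>(b + 2) * t - t\<^sup>2 / 4\<close> leaves the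
  constant \<open>(b + 2)\<^sup>2\<close>.\<close>

lemma gaussian_weight_le:
  assumes "(t::real) \<ge> 0"
  shows "t ^ a * exp (b * t - t\<^sup>2 / 4) \<le> fact a * exp ((b + 2)\<^sup>2) * exp (-t)"
proof -
  have "t ^ a * exp (b * t - t\<^sup>2 / 4) \<le> (fact a * exp t) * exp (b * t - t\<^sup>2 / 4)"
    by (intro mult_right_mono power_le_fact_exp assms) auto
  also have "\<dots> = fact a * exp (t + b * t - t\<^sup>2 / 4)"
    by (simp add: exp_add exp_diff)
  also have "t + b * t - t\<^sup>2 / 4 \<le> (b + 2)\<^sup>2 - t"
    using zero_le_power2[of "t / 2 - (b + 2)"] by (simp add: power2_eq_square algebra_simps)
  then have "fact a * exp (t + b * t - t\<^sup>2 / 4) \<le> fact a * exp ((b + 2)\<^sup>2 - t)"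
    by simp
  also have "\<dots> = fact a * exp ((b + 2)\<^sup>2) * exp (-t)"
    by (simp add: exp_diff exp_minus divide_inverse)
  finally show ?thesis .
qed

text \<open>An entire \<open>f\<close> has a primitive \<open>F\<close>, so each side is the limit
  of \<open>F (d * R) - F 0\<close>. The two limits agree because the chord joining the ray points
  at parameter \<open>R\<close> has length proportional to \<open>R\<close>, and \<open>f\<close> is
  at most \<open>B R\<close> on it.\<close>

lemma ray_rotation:
  fixes f :: "complex \<Rightarrow> complex"
  assumes f: "f holomorphic_on UNIV"
    and i1: "set_integrable lborel {0..} (\<lambda>t. f (d1 * of_real t))"
    and i2: "set_integrable lborel {0..} (\<lambda>t. f (d2 * of_real t))"
    and b: "\<And>R p. R \<ge> 0 \<Longrightarrow> p \<in> closed_segment d1 d2 \<Longrightarrow> norm (f (of_real R * p)) \<le> B R"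
    and B: "((\<lambda>R. R * B R) \<longlongrightarrow> 0) at_top"
  shows "d1 * (LINT t:{0..}|lborel. f (d1 * of_real t)) = d2 * (LINT t:{0..}|lborel. f (d2 * of_real t))"
proof -
  obtain F where F: "\<And>w. (F has_field_derivative f w) (at w)"
    using holomorphic_convex_primitive'[of UNIV f] f by (auto simp: holomorphic_on_open)
  have cf: "continuous_on UNIV f" using f holomorphic_on_imp_continuous_on by blast
  have lim: "((\<lambda>R. F (d * of_real R) - F 0) \<longlongrightarrow> d * (LINT t:{0..}|lborel. f (d * of_real t))) at_top"
    if "set_integrable lborel {0..} (\<lambda>t. f (d * of_real t))" for d
  proof -
    have "((\<lambda>R. F (d * of_real R) - F (d * of_real 0)) \<longlongrightarrow> (LINT t:{0..}|lborel. d * f (d * of_real t))) at_top"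
    proof (rule tendsto_integral_Ici_FTC)
      show "set_integrable lborel {0..} (\<lambda>t. d * f (d * of_real t))" using that by simp
      fix t :: real
      have "((\<lambda>t. d * of_real t) has_vector_derivative d) (at t)"
        by (auto intro!: derivative_eq_intros)
      from field_vector_diff_chain_at[OF this F]
      have "((\<lambda>t. F (d * of_real t)) has_vector_derivative (d * f (d * of_real t))) (at t)"
        by (simp add: o_def)
      then show "((\<lambda>t. F (d * of_real t)) has_vector_derivative (d * f (d * of_real t))) (at t within {0..})"
        by (rule has_vector_derivative_at_within)
    next
      show "continuous_on {0..} (\<lambda>t. d * f (d * of_real t))"
        by (intro continuous_intros continuous_on_compose2[OF cf]) auto
    qed
    then show ?thesis by simp
  qed
  have "((\<lambda>R. (F (d1 * of_real R) - F 0) - (F (d2 * of_real R) - F 0)) \<longlongrightarrow> 0) at_top"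
  proof (rule Lim_null_comparison)
    show "((\<lambda>R. norm (d1 - d2) * (R * B R)) \<longlongrightarrow> 0) at_top"
      using tendsto_mult_left[OF B, of "norm (d1 - d2)"] by simp
    show "eventually (\<lambda>R. norm ((F (d1 * of_real R) - F 0) - (F (d2 * of_real R) - F 0)) \<le> norm (d1 - d2) * (R * B R)) at_top"
      using eventually_ge_at_top[of 0]
    proof eventually_elim
      case (elim R)
      have "norm (F (d1 * of_real R) - F (d2 * of_real R)) \<le> B R * norm (d1 * of_real R - d2 * of_real R)"
      proof (rule field_differentiable_bound[where S="closed_segment (d1 * of_real R) (d2 * of_real R)"])
        fix w assume "w \<in> closed_segment (d1 * of_real R) (d2 * of_real R)"
        then obtain u where u: "0 \<le> u" "u \<le> 1" "w = (1 - u) *\<^sub>R (d1 * of_real R) + u *\<^sub>R (d2 * of_real R)"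
          by (auto simp: in_segment)
        then have "w = of_real R * ((1 - u) *\<^sub>R d1 + u *\<^sub>R d2)" 
          by (simp add: algebra_simps scaleR_conv_of_real)
        moreover have "(1 - u) *\<^sub>R d1 + u *\<^sub>R d2 \<in> closed_segment d1 d2" using u by (auto simp: in_segment)
        ultimately show "norm (f w) \<le> B R" using b[OF elim] by metis
        show "(F has_field_derivative f w) (at w within closed_segment (d1 * of_real R) (d2 * of_real R))"
          using F by (rule has_field_derivative_at_within)
      qed auto
      also have "d1 * of_real R - d2 * of_real R = (d1 - d2) * of_real R" by (simp add: algebra_simps)
      finally show ?case using elim by (simp add: norm_mult mult_ac)
    qed
  qed
  moreover have "((\<lambda>R. (F (d1 * of_real R) - F 0) - (F (d2 * of_real R) - F 0)) \<longlongrightarrow>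
     d1 * (LINT t:{0..}|lborel. f (d1 * of_real t)) - d2 * (LINT t:{0..}|lborel. f (d2 * of_real t))) at_top"
    by (intro tendsto_diff lim i1 i2)
  ultimately have "d1 * (LINT t:{0..}|lborel. f (d1 * of_real t)) - d2 * (LINT t:{0..}|lborel. f (d2 * of_real t)) = 0"
    using tendsto_unique trivial_limit_at_top_linorder by blast
  then show ?thesis by simp
qed

section \<open>The Airy function as a ray integral\<close>

text \<open>Direction of the ray of angle \<open>\<pi>/3\<close>, on which \<open>exp (p\<^sup>3/3)\<close> decays like \<open>exp (- t\<^sup>3/3)\<close>.\<close>
definition d60 :: complex where "d60 = Complex (1/2) (sqrt 3 / 2)"

lemma d60_pow: "d60 ^ 2 = Complex (-1/2) (sqrt 3 / 2)" "d60 ^ 3 = -1" "norm d60 = 1"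
proof -
  show 2: "d60 ^ 2 = Complex (-1/2) (sqrt 3 / 2)"
    by (simp add: d60_def power2_eq_square complex_eq_iff)
  have "d60 ^ 3 = d60 * d60 ^ 2" by (simp add: eval_nat_numeral)
  then show "d60 ^ 3 = -1" unfolding 2 by (simp add: d60_def complex_eq_iff)
  show "norm d60 = 1" by (simp add: d60_def cmod_def power2_eq_square)
qed

section \<open>Moments of the cubic exponential\<close>

definition airy_moment :: "nat \<Rightarrow> real" where
  "airy_moment n = (LINT t:{0..}|lborel. t ^ n * exp (- (t ^ 3) / 3))"

text \<open>Trades cubic for Gaussian decay. The Hermite kernel is only Gaussian-small far out, so a
  weight common to all kernels cannot be stronger than that.\<close>

lemma cubic_weight:
  assumes "(t::real) \<ge> 0" shows "- (t ^ 3) / 3 \<le> t / 2 - t\<^sup>2 / 4"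
proof -
  \<comment> \<open>The difference of the two sides is \<open>t / 3\<close> times
    \<open>t\<^sup>2 - 3 / 4 * t + 3 / 2\<close>; this is the completed square.\<close>
  have "0 \<le> t * ((t - 3/8)\<^sup>2 + (3/2 - 9/64))" using assms by simp
  then show ?thesis by (simp add: power2_eq_square power3_eq_cube algebra_simps)
qed

lemma airy_weight:
  assumes "(t::real) \<ge> 0"
  shows "t ^ j * exp (b * t) * exp (- (t ^ 3) / 3) \<le> fact j * exp ((b + 5/2)\<^sup>2) * exp (-t)"
proof -
  have "t ^ j * exp (b * t) * exp (- (t ^ 3) / 3) \<le> t ^ j * exp (b * t) * exp (t / 2 - t\<^sup>2 / 4)"
    using cubic_weight[OF assms] assms by (intro mult_left_mono) auto
  also have "\<dots> = t ^ j * exp ((b + 1/2) * t - t\<^sup>2 / 4)"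
    by (simp add: exp_add exp_diff algebra_simps)
  also have "\<dots> \<le> fact j * exp ((b + 1/2 + 2)\<^sup>2) * exp (-t)"
    by (rule gaussian_weight_le[OF assms])
  finally show ?thesis by (simp add: add.assoc)
qed

lemma airy_moment_integrable: "set_integrable lborel {0..} (\<lambda>t::real. t ^ n * exp (- (t ^ 3) / 3))"
proof (rule set_integrable_Ici_exp_bound)
  show "set_borel_measurable lborel {0..} (\<lambda>t::real. t ^ n * exp (- (t ^ 3) / 3))"
    by (intro set_borel_measurable_Ici_continuous continuous_intros)
       auto
  fix t :: real assume "t \<ge> 0"
  then show "norm (t ^ n * exp (- (t ^ 3) / 3)) \<le> fact n * exp ((0 + 5/2)\<^sup>2) * exp (-t)"
    using airy_weight[of t n 0] by simp
qed

lemma airy_moment_FTC: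
  assumes F: "\<And>t::real. (F has_real_derivative f t) (at t)" and f: "set_integrable lborel {0..} f"
    and c: "continuous_on {0..} f" and l: "(F \<longlongrightarrow> 0) at_top"
  shows "(LINT t:{0..}|lborel. f t) = - F 0"
proof -
  have "((\<lambda>R. F R - F 0) \<longlongrightarrow> (LINT t:{0..}|lborel. f t)) at_top"
    by (rule tendsto_integral_Ici_FTC[OF f _ c])
       (use F in \<open>auto simp: has_real_derivative_iff_has_vector_derivative[symmetric] intro: has_field_derivative_at_within\<close>)
  moreover have "((\<lambda>R. F R - F 0) \<longlongrightarrow> 0 - F 0) at_top"
    by (intro tendsto_intros l)
  ultimately show ?thesis
    using tendsto_unique[OF trivial_limit_at_top_linorder] by force
qed

text \<open>Integration of the derivative of \<open>t ^ (n + 1) * exp (- (t ^ 3) / 3)\<close>, which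
  vanishes at both ends of the half-line.\<close>

lemma airy_moment_rec: "airy_moment (n + 3) = real (n + 1) * airy_moment n"
proof -
  define f where "f = (\<lambda>t::real. real (n + 1) * (t ^ n * exp (- (t ^ 3) / 3)) - t ^ (n + 3) * exp (- (t ^ 3) / 3))"
  have i: "set_integrable lborel {0..} f" unfolding f_def
    by (intro set_integral_diff(1) set_integrable_mult_right airy_moment_integrable)
  have "((\<lambda>t::real. t ^ (n + 1) * exp (- (t ^ 3) / 3)) \<longlongrightarrow> 0) at_top" by real_asymp
  then have "(LINT t:{0..}|lborel. f t) = - (0 ^ (n + 1) * exp (- (0 ^ 3) / 3))"
  proof (intro airy_moment_FTC i)
    fix t :: real
    have e: "((\<lambda>t. exp (- (t ^ 3) / 3)) has_real_derivative - t\<^sup>2 * exp (- (t ^ 3) / 3)) (at t)"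
      by (auto intro!: derivative_eq_intros)
    show "((\<lambda>t. t ^ (n + 1) * exp (- (t ^ 3) / 3)) has_real_derivative f t) (at t)"
      using DERIV_mult[OF DERIV_pow[of "n + 1"] e]
      by (rule DERIV_cong) (simp add: f_def power_add power2_eq_square power3_eq_cube algebra_simps)
  qed (auto simp: f_def intro!: continuous_intros)
  moreover have "(LINT t:{0..}|lborel. f t) = real (n + 1) * airy_moment n - airy_moment (n + 3)"
    unfolding f_def airy_moment_def
    by (subst set_integral_diff(2))
       (use airy_moment_integrable[of n] airy_moment_integrable[of "n + 3"] in simp_all)
  ultimately show ?thesis by simp
qed

text \<open>Substitution \<open>s = t ^ 3 / 3\<close> in Euler's integral, with \<open>g\<close> the
  transformed integrand up to the factor \<open>c\<close>. It is carried out on the open half-line,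
  where the power of \<open>s\<close> is continuous although it may blow up at 0.\<close>

lemma Gamma_cubic_integral:
  fixes p :: real
  assumes p: "p > 0" and i: "set_integrable lborel {0..} g" and c: "c > 0"
    and g: "\<And>t::real. t > 0 \<Longrightarrow> (t ^ 3 / 3) powr (p - 1) / exp (t ^ 3 / 3) * t\<^sup>2 = c * g t"
  shows "(LINT t:{0..}|lborel. g t) = Gamma p / c"
proof -
  define f where "f = (\<lambda>s::real. s powr (p - 1) / exp s)"
  have AE: "AE t in lborel. (t::real) \<noteq> 0" by (rule AE_lborel_singleton)
  have i': "set_integrable lborel {0<..} (\<lambda>t. f (t ^ 3 / 3) * t\<^sup>2)"
  proof -
    have "set_integrable lborel {0<..} (\<lambda>t. c * g t)"
      by (intro set_integrable_mult_right set_integrable_subset[OF i]) auto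
    then show ?thesis
      by (rule set_integrable_cong[THEN iffD1, rotated -1]) (simp_all add: f_def g[symmetric])
  qed
  have ein: "einterval 0 \<infinity> = {0<..}" by (auto simp: einterval_def)
  have 1: "DERIV (\<lambda>x. x ^ 3 / 3) x :> x\<^sup>2" for x :: real
    by (auto intro!: derivative_eq_intros)
  have 2: "isCont f (x ^ 3 / 3)" if "0 < ereal x" for x
    unfolding f_def using that by (intro continuous_intros) auto
  have 3: "((ereal \<circ> (\<lambda>x. x ^ 3 / 3) \<circ> real_of_ereal) \<longlongrightarrow> 0) (at_right 0)"
    unfolding zero_ereal_def
    by (simp only: ereal_tendsto_simps) real_asymp
  have 4: "((ereal \<circ> (\<lambda>x. x ^ 3 / 3) \<circ> real_of_ereal) \<longlongrightarrow> \<infinity>) (at_left \<infinity>)"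
    by (simp only: ereal_tendsto_simps) real_asymp
  have 5: "set_integrable lborel (einterval 0 \<infinity>) (\<lambda>x. f (x ^ 3 / 3) * x\<^sup>2)"
    using i' by (simp add: ein)
  note sub = interval_integral_substitution_nonneg[of 0 \<infinity> "\<lambda>x. x ^ 3 / 3" "\<lambda>x. x\<^sup>2" f 0 \<infinity>,
      OF _ 1 2 _ _ _ 3 4 5]
  have D: "set_integrable lborel (einterval 0 \<infinity>) f \<and> (LBINT x=0..\<infinity>. f x) = (LBINT x=0..\<infinity>. f (x ^ 3 / 3) * x\<^sup>2)"
    by (intro conjI sub) (auto simp: f_def)
  have "(LBINT x=0..\<infinity>. f x) = (LINT t:{0<..}|lborel. f t)"
    by (simp add: interval_lebesgue_integral_def ein)
  also have "\<dots> = Gamma p"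
  proof -
    have "(LINT t:{0<..}|lborel. f t) = integral {0<..} f"
      using D by (intro set_borel_integral_eq_integral(2)) (simp add: ein)
    also have "\<dots> = integral {0..} f"
      by (rule integral_spike_set; rule negligible_subset[of "{0}"]) auto
    also have "\<dots> = Gamma p"
      using Gamma_integral_real[OF p] unfolding f_def by (rule integral_unique)
    finally show ?thesis .
  qed
  finally have "Gamma p = (LINT t:{0<..}|lborel. f (t ^ 3 / 3) * t\<^sup>2)"
    using D by (simp add: interval_lebesgue_integral_def ein)
  also have "\<dots> = (LINT t:{0<..}|lborel. c * g t)"
    by (rule set_lebesgue_integral_cong) (simp_all add: f_def g[symmetric])
  also have "\<dots> = c * (LINT t:{0..}|lborel. g t)"
  proof -
    have "(LINT t:{0<..}|lborel. g t) = (LINT t:{0..}|lborel. g t)"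
      unfolding set_lebesgue_integral_def
    proof (rule integral_cong_AE)
      have "set_integrable lborel {0<..} g" by (rule set_integrable_subset[OF i]) auto
      then show "(\<lambda>x. indicator {0<..} x *\<^sub>R g x) \<in> borel_measurable lborel"
        "(\<lambda>x. indicator {0..} x *\<^sub>R g x) \<in> borel_measurable lborel"
        using i unfolding set_integrable_def by (auto dest: borel_measurable_integrable)
      show "AE x in lborel. indicator {0<..} x *\<^sub>R g x = indicator {0..} x *\<^sub>R g x"
        using AE by eventually_elim (auto simp: indicator_def)
    qed
    then show ?thesis by simp
  qed
  finally show ?thesis using c by simp
qed

lemma cubic_powr:
  assumes "(t::real) > 0"
  shows "(t ^ 3 / 3) powr q = t powr (3 * q) * 3 powr (-q)"
proof -
  have "(t ^ 3 / 3) powr q = (t powr 3) powr q / 3 powr q"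
    using assms by (simp add: powr_divide)
  then show ?thesis by (simp only: powr_powr powr_minus divide_inverse)
qed

lemma airy_moment_0: "airy_moment 0 = Gamma (1/3) / 3 powr (2/3)"
  unfolding airy_moment_def
proof (rule Gamma_cubic_integral)
  show "set_integrable lborel {0..} (\<lambda>t::real. t ^ 0 * exp (- (t ^ 3) / 3))" by (rule airy_moment_integrable)
  fix t :: real assume t: "t > 0"
  have "(t ^ 3 / 3) powr (1/3 - 1) = t powr (-2) * 3 powr (2/3)"
    using cubic_powr[OF t, of "1/3 - 1"] by simp
  also have "t powr (-2) = 1 / t\<^sup>2" using t by (simp add: powr_minus_divide)
  finally show "(t ^ 3 / 3) powr (1/3 - 1) / exp (t ^ 3 / 3) * t\<^sup>2 = 3 powr (2/3) * (t ^ 0 * exp (- (t ^ 3) / 3))"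
    using t by (simp add: exp_minus inverse_eq_divide)
qed auto

lemma airy_moment_1: "airy_moment 1 = Gamma (2/3) / 3 powr (1/3)"
  unfolding airy_moment_def
proof (rule Gamma_cubic_integral)
  show "set_integrable lborel {0..} (\<lambda>t::real. t ^ 1 * exp (- (t ^ 3) / 3))" by (rule airy_moment_integrable)
  fix t :: real assume t: "t > 0"
  have "(t ^ 3 / 3) powr (2/3 - 1) = t powr (-1) * 3 powr (1/3)"
    using cubic_powr[OF t, of "2/3 - 1"] by simp
  also have "t powr (-1) = 1 / t" using t by (simp add: powr_minus_divide)
  finally show "(t ^ 3 / 3) powr (2/3 - 1) / exp (t ^ 3 / 3) * t\<^sup>2 = 3 powr (1/3) * (t ^ 1 * exp (- (t ^ 3) / 3))"
    using t by (simp add: exp_minus inverse_eq_divide power2_eq_square)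
qed auto

text \<open>The Maclaurin coefficient obtained by expanding \<open>exp (- z p)\<close> under the
  integral along \<open>p = d60 * t\<close>: the direction contributes \<open>d60 ^ (n + 1)\<close>,
  the modulus a moment.\<close>

definition airy_coeff :: "nat \<Rightarrow> real" where
  "airy_coeff n = (-1) ^ n * Im (d60 ^ (n + 1)) * airy_moment n / (pi * fact n)"

text \<open>The \<open>j\<close>-th termwise derivative of that series. Starting from the series
  makes differentiation immediate, so that nothing has to be differentiated under the integral
  sign.\<close>

definition airyD :: "nat \<Rightarrow> real \<Rightarrow> real" where
  "airyD j z = (\<Sum>n. airy_coeff (n + j) * fact (n + j) / fact n * z ^ n)"

definition airy_exp :: "complex \<Rightarrow> real \<Rightarrow> complex" where
  "airy_exp d t = exp ((d * of_real t) ^ 3 / 3)"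

text \<open>With \<open>F = airy_exp d\<close> this is the \<open>j\<close>-th derivative at \<open>z\<close> of the contour integral
  \<open>Ai z = (1/\<pi>) Im \<integral> exp (p\<^sup>3/3 - z p) dp\<close> along the ray \<open>p = d t\<close>.\<close>
definition airy_ray :: "complex \<Rightarrow> (real \<Rightarrow> complex) \<Rightarrow> nat \<Rightarrow> real \<Rightarrow> real" where
  "airy_ray d F j z =
     Im (LINT t:{0..}|lborel. d * (- (d * of_real t)) ^ j * exp (- (of_real z * (d * of_real t))) * F t) / pi"

lemma airy_exp_d60: "airy_exp d60 t = of_real (exp (- (t ^ 3) / 3))"
  by (simp add: airy_exp_def power_mult_distrib d60_pow exp_of_real[symmetric] del: exp_of_real)

text \<open>Termwise integration is justified by dominated convergence: the partial sums of the
  exponential series are bounded by \<open>exp (\<bar>z\<bar> * t)\<close>, which the cubic weight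
  absorbs.\<close>

lemma airy_ray_d60_sums:
  "(\<lambda>n. airy_coeff (n + j) * fact (n + j) / fact n * z ^ n) sums airy_ray d60 (airy_exp d60) j z"
proof -
  define C where "C n = d60 * (- d60) ^ (n + j) * of_real (z ^ n / fact n)" for n
  define e where "e n t = t ^ (n + j) * exp (- (t ^ 3) / 3)" for n and t :: real
  define s where "s N t = (\<Sum>n<N. C n * of_real (e n t))" for N t
  define S where "S t = d60 * (- (d60 * of_real t)) ^ j * exp (- (of_real z * (d60 * of_real t))) * airy_exp d60 t" for t
  define w where "w t = t ^ j * exp (\<bar>z\<bar> * t) * exp (- (t ^ 3) / 3)" for t :: real
  have ie: "set_integrable lborel {0..} (\<lambda>t. C n * of_real (e n t))" for n
  proof -
    have "complex_integrable lborel (\<lambda>t. of_real (indicator {0..} t *\<^sub>R e n t))"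
      using airy_moment_integrable[of "n + j"] unfolding set_integrable_def e_def by (rule integrable_of_real)
    then have "set_integrable lborel {0..} (\<lambda>t. complex_of_real (e n t))"
      unfolding set_integrable_def by (simp add: scaleR_conv_of_real)
    then show ?thesis by (rule set_integrable_mult_right)
  qed
  have iS: "(\<lambda>N. LINT t:{0..}|lborel. s N t) \<longlonglongrightarrow> (LINT t:{0..}|lborel. S t)"
    unfolding set_lebesgue_integral_def
  proof (rule integral_dominated_convergence[where w="\<lambda>t. indicator {0..} t *\<^sub>R w t"])
    show "(\<lambda>t. indicator {0..} t *\<^sub>R S t) \<in> borel_measurable lborel"
      unfolding S_def airy_exp_def 
      by (rule set_borel_measurable_Ici_continuous[unfolded set_borel_measurable_def]) (intro continuous_intros, auto)
    show "(\<lambda>t. indicator {0..} t *\<^sub>R s i t) \<in> borel_measurable lborel" for i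
      unfolding s_def e_def
      by (rule set_borel_measurable_Ici_continuous[unfolded set_borel_measurable_def]) (intro continuous_intros, auto)
    have "set_integrable lborel {0..} w"
    proof (rule set_integrable_Ici_exp_bound)
      show "set_borel_measurable lborel {0..} w" unfolding w_def
        by (rule set_borel_measurable_Ici_continuous) (intro continuous_intros, auto)
      fix t :: real assume "t \<ge> 0"
      then show "norm (w t) \<le> fact j * exp ((\<bar>z\<bar> + 5/2)\<^sup>2) * exp (-t)"
        using airy_weight[of t j "\<bar>z\<bar>"] by (simp add: w_def)
    qed
    then show "integrable lborel (\<lambda>t. indicator {0..} t *\<^sub>R w t)" by (simp add: set_integrable_def)
    have "(\<lambda>N. s N t) \<longlonglongrightarrow> S t" for t
    proof -
      let ?x = "- (of_real z * (d60 * of_real t))"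
      have "(\<lambda>n. (?x ^ n /\<^sub>R fact n) * (d60 * (- (d60 * of_real t)) ^ j * airy_exp d60 t)) sums 
         (exp ?x * (d60 * (- (d60 * of_real t)) ^ j * airy_exp d60 t))"
        by (intro sums_mult2 exp_converges)
      moreover have "(?x ^ n /\<^sub>R fact n) * (d60 * (- (d60 * of_real t)) ^ j * airy_exp d60 t) = C n * of_real (e n t)" for n
      proof -
        have "?x = (- d60) * of_real (z * t)" "- (d60 * of_real t) = (- d60) * of_real t" by simp_all
        then show ?thesis
          unfolding C_def e_def airy_exp_d60
          by (simp only: power_mult_distrib) (simp add: scaleR_conv_of_real power_mult_distrib power_add field_simps)
      qed
      ultimately show ?thesis unfolding sums_def s_def S_def by (simp add: mult_ac)
    qed
    then show "AE t in lborel. (\<lambda>i. indicator {0..} t *\<^sub>R s i t) \<longlonglongrightarrow> indicator {0..} t *\<^sub>R S t"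
      by (intro AE_I2 tendsto_intros)
    have "norm (s i t) \<le> w t" if t: "t \<ge> 0" for i t
    proof -
      have "norm (s i t) \<le> (\<Sum>n<i. norm (C n * of_real (e n t)))" unfolding s_def by (rule norm_sum)
      also have "\<dots> = (\<Sum>n<i. (\<bar>z\<bar> * t) ^ n / fact n) * (t ^ j * exp (- (t ^ 3) / 3))"
        unfolding sum_distrib_right using t
        by (intro sum.cong refl) (simp add: C_def e_def norm_mult norm_power norm_divide d60_pow power_add power_mult_distrib abs_mult power_abs)
      also have "(\<Sum>n<i. (\<bar>z\<bar> * t) ^ n / fact n) \<le> exp (\<bar>z\<bar> * t)"
      proof -
        have S: "(\<lambda>n. (\<bar>z\<bar> * t) ^ n / fact n) sums exp (\<bar>z\<bar> * t)"
          using exp_converges[of "\<bar>z\<bar> * t"] by (simp add: divide_inverse mult.commute)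
        show ?thesis unfolding sums_unique[OF S]
          by (rule sum_le_suminf) (use t S in \<open>auto intro: sums_summable\<close>)
      qed
      finally show ?thesis using t by (simp add: w_def mult_right_mono mult_ac)
    qed
    then show "AE t in lborel. norm (indicator {0..} t *\<^sub>R s i t) \<le> indicator {0..} t *\<^sub>R w t" for i
      by (intro AE_I2) (simp add: indicator_def)
  qed
  have "(LINT t:{0..}|lborel. s N t) = (\<Sum>n<N. C n * of_real (airy_moment (n + j)))" for N
  proof -
    have "(LINT t:{0..}|lborel. s N t) = (\<Sum>n<N. LINT t:{0..}|lborel. C n * of_real (e n t))"
      unfolding s_def set_lebesgue_integral_def scaleR_sum_right
      by (rule Bochner_Integration.integral_sum) (use ie in \<open>simp add: set_integrable_def\<close>)
    also have "\<dots> = (\<Sum>n<N. C n * of_real (airy_moment (n + j)))"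
      unfolding e_def airy_moment_def set_integral_mult_right set_integral_complex_of_real by (rule refl)
    finally show ?thesis .
  qed
  with iS have "(\<lambda>N. Im (\<Sum>n<N. C n * of_real (airy_moment (n + j))) / pi) \<longlonglongrightarrow> Im (LINT t:{0..}|lborel. S t) / pi"
    by (intro tendsto_intros) auto
  moreover have "Im (\<Sum>n<N. C n * of_real (airy_moment (n + j))) / pi = (\<Sum>n<N. airy_coeff (n + j) * fact (n + j) / fact n * z ^ n)" for N
  proof -
    have "Im (C n * of_real (airy_moment (n + j))) / pi = airy_coeff (n + j) * fact (n + j) / fact n * z ^ n" for n
    proof -
      define I where "I = Im (d60 ^ (n + j + 1))"
      have C: "C n = of_real ((-1) ^ (n + j) * z ^ n / fact n) * d60 ^ (n + j + 1)"
        unfolding C_def by (subst power_minus) (simp add: mult_ac)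
      have Im: "Im (of_real r * w * of_real m) = r * Im w * m" for r m w by simp
      show ?thesis unfolding airy_coeff_def C Im I_def[symmetric] by (simp add: mult.commute[of pi] mult.assoc mult.left_commute[of _ "z ^ n"] mult.commute[of _ "z ^ n"])
    qed
    then show ?thesis by (simp add: sum_divide_distrib)
  qed
  ultimately show ?thesis unfolding sums_def airy_ray_def S_def by simp
qed

lemma airyD_sums: "(\<lambda>n. airy_coeff (n + j) * fact (n + j) / fact n * z ^ n) sums airyD j z"
  unfolding airyD_def using airy_ray_d60_sums sums_summable summable_sums by blast

lemma airy_ray_d60: "airy_ray d60 (airy_exp d60) j z = airyD j z"
  using airy_ray_d60_sums airyD_sums by (rule sums_unique2)

lemma has_field_derivative_airyD: "(airyD j has_real_derivative airyD (Suc j) z) (at z)"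
proof -
  define c where "c n = airy_coeff (n + j) * fact (n + j) / fact n" for n
  have "((\<lambda>x. \<Sum>n. c n * x ^ n) has_field_derivative (\<Sum>n. diffs c n * z ^ n)) (at z)"
    by (rule termdiffs_strong_converges_everywhere) (use airyD_sums sums_summable in \<open>force simp: c_def\<close>)
  moreover have "diffs c n = airy_coeff (n + Suc j) * fact (n + Suc j) / fact n" for n
    by (simp add: diffs_def c_def del: of_nat_Suc)
  ultimately show ?thesis unfolding airyD_def[abs_def] c_def by simp
qed

text \<open>The equation \<open>y'' = z y\<close> on the level of coefficients. The moment
  recurrence supplies the factor \<open>n + 1\<close>, and the sign \<open>(-1) ^ 3\<close> cancels
  against \<open>d60 ^ 3 = -1\<close>.\<close>

lemma airy_coeff_rec: "airy_coeff (n + 3) * real ((n + 2) * (n + 3)) = airy_coeff n"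
proof -
  have "d60 ^ (n + 3 + 1) = - (d60 ^ (n + 1))"
    unfolding power_add d60_pow(2) by simp
  then have I: "Im (d60 ^ (n + 3 + 1)) = - Im (d60 ^ (n + 1))" by simp
  have F: "fact (n + 3) = (real (n + 2) * real (n + 3)) * (real (n + 1) * fact n)"
    by (simp add: eval_nat_numeral algebra_simps)
  have S: "((-1::real) ^ (n + 3)) = - ((-1) ^ n)" by (simp add: power_add)
  have aux: "(- s) * (- i) * (c * m) / (pi * ((a * b) * (c * f))) * (a * b) = s * i * m / (pi * f)"
    if "a \<noteq> 0" "b \<noteq> 0" "c \<noteq> 0" for s i m f a b c :: real
    using that by simp
  show ?thesis
    unfolding airy_coeff_def airy_moment_rec of_nat_mult I F S by (rule aux) simp_all
qed

lemma airy_coeff_2: "airy_coeff 2 = 0"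
proof -
  have "d60 ^ (2 + 1) = -1" using d60_pow(2) by (simp add: eval_nat_numeral)
  then show ?thesis unfolding airy_coeff_def by simp
qed

text \<open>Reflection formula at 1/3. The moments carry Gamma values in the numerator, the
  definition of \<open>Ai\<close> in the denominator; this identity exchanges them.\<close>

lemma sqrt3_Gamma: "sqrt 3 * Gamma (1/3) * Gamma (2/3) = 2 * (pi::real)"
proof -
  have "complex_of_real (Gamma (1/3) * Gamma (2/3)) = of_real (pi / sin (pi * (1/3)))"
    using Gamma_reflection_complex[of "of_real (1/3)"]
    unfolding of_real_mult of_real_divide sin_of_real[symmetric] Gamma_complex_of_real[symmetric] by simp
  then have "Gamma (1/3) * Gamma (2/3) = pi / sin (pi * (1/3))"
    unfolding of_real_eq_iff .
  then show ?thesis by (simp add: sin_60 divide_simps mult_ac)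
qed

lemma airy_coeff_0: "airy_coeff 0 = 1 / (3 powr (2/3) * Gamma (2/3))"
proof -
  have "airy_coeff 0 = sqrt 3 * Gamma (1/3) / (2 * pi) / 3 powr (2/3)"
    by (simp add: airy_coeff_def d60_def airy_moment_0)
  also have "sqrt 3 * Gamma (1/3) / (2 * pi) = 1 / Gamma (2/3)"
    using sqrt3_Gamma less_imp_neq[OF Gamma_real_pos[of "2/3"]] by (simp add: divide_simps)
  finally show ?thesis by simp
qed

lemma airy_coeff_1: "airy_coeff 1 = - (1 / (3 powr (1/3) * Gamma (1/3)))"
proof -
  have "airy_coeff 1 = - (sqrt 3 * Gamma (2/3) / (2 * pi) / 3 powr (1/3))"
    using d60_pow(1) airy_moment_1 by (simp add: airy_coeff_def power2_eq_square)
  also have "sqrt 3 * Gamma (2/3) / (2 * pi) = 1 / Gamma (1/3)"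
    using sqrt3_Gamma less_imp_neq[OF Gamma_real_pos[of "1/3"]] by (simp add: divide_simps mult_ac)
  finally show ?thesis by simp
qed

lemma airyD_2: "airyD 2 z = z * airyD 0 z"
proof -
  define f where "f n = airy_coeff (n + 2) * fact (n + 2) / fact n * z ^ n" for n
  have "f sums airyD 2 z" unfolding f_def using airyD_sums[of 2 z] by simp
  then have "(\<lambda>n. f (Suc n)) sums (airyD 2 z - f 0)"
    by (simp add: sums_Suc_iff)
  moreover have "f 0 = 0" using airy_coeff_2 by (simp add: f_def numeral_2_eq_2)
  moreover have "f (Suc n) = z * (airy_coeff n * z ^ n)" for n
  proof -
    have e: "Suc n + 2 = n + 3" by simp
    have "fact (n + 3) = (real ((n + 2) * (n + 3))) * (fact (Suc n))"
      by (simp add: eval_nat_numeral algebra_simps)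
    then have "f (Suc n) = airy_coeff (n + 3) * real ((n + 2) * (n + 3)) * (z * z ^ n)"
      unfolding f_def e by (simp del: fact_Suc of_nat_mult of_nat_add)
    then show ?thesis unfolding airy_coeff_rec by simp
  qed
  ultimately have "(\<lambda>n. z * (airy_coeff n * z ^ n)) sums airyD 2 z" by simp
  moreover have "(\<lambda>n. z * (airy_coeff n * z ^ n)) sums (z * airyD 0 z)"
    using airyD_sums[of 0 z] by (intro sums_mult) simp
  ultimately show ?thesis by (rule sums_unique2)
qed

lemma airyD_4: "airyD 4 z = z\<^sup>2 * airyD 0 z + 2 * airyD 1 z"
proof -
  have [simp]: "airyD (Suc (Suc 0)) = airyD 2" "airyD (Suc 2) = airyD 3" "airyD (Suc 3) = airyD 4"
  proof -
    have e: "Suc (Suc 0) = 2" "Suc 2 = 3" "Suc 3 = 4" by simp_all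
    show "airyD (Suc (Suc 0)) = airyD 2" "airyD (Suc 2) = airyD 3" "airyD (Suc 3) = airyD 4"
      unfolding e by (rule refl)+
  qed
  have D1: "(airyD 1 has_real_derivative airyD 2 z) (at z)" for z
    using has_field_derivative_airyD[of 1 z] by simp
  have D2: "airyD 2 = (\<lambda>z. z * airyD 0 z)" by (rule ext) (rule airyD_2)
  have "((\<lambda>z. z * airyD 0 z) has_real_derivative airyD 0 z + z * airyD 1 z) (at z)" for z
    by (auto intro!: derivative_eq_intros has_field_derivative_airyD[of 0])
  moreover have "((\<lambda>z. z * airyD 0 z) has_real_derivative airyD 3 z) (at z)" for z
    using has_field_derivative_airyD[of 2 z] by (simp add: D2)
  ultimately have D3: "airyD 3 = (\<lambda>z. airyD 0 z + z * airyD 1 z)"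
    using DERIV_unique by blast
  have "((\<lambda>z. airyD 0 z + z * airyD 1 z) has_real_derivative 2 * airyD 1 z + z * airyD 2 z) (at z)"
    by (auto intro!: derivative_eq_intros has_field_derivative_airyD[of 0] D1[unfolded One_nat_def])
  moreover have "((\<lambda>z. airyD 0 z + z * airyD 1 z) has_real_derivative airyD 4 z) (at z)"
    using has_field_derivative_airyD[of 3 z] by (simp add: D3)
  ultimately show ?thesis
    using DERIV_unique by (fastforce simp: airyD_2 power2_eq_square)
qed

text \<open>The recurrence moves in steps of three, so the coefficients split by residue class; the
  rising factorials appear because \<open>3 * (1/3 + k) = 3 * k + 1\<close> and
  \<open>3 * (2/3 + k) = 3 * k + 2\<close>.\<close>

lemma airy_coeff_triple:
  "airy_coeff (3 * k) = airy_coeff 0 * (3 ^ k * pochhammer (1/3) k / fact (3 * k))"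
  "airy_coeff (3 * k + 1) = airy_coeff 1 * (3 ^ k * pochhammer (2/3) k / fact (3 * k + 1))"
  "airy_coeff (3 * k + 2) = 0"
proof -
  have rec: "airy_coeff (n + 3) = airy_coeff n / real ((n + 2) * (n + 3))" for n
    using airy_coeff_rec[of n] by (simp add: field_simps del: of_nat_mult of_nat_add)
  have fact3: "fact (n + 3) = real (n + 1) * real (n + 2) * real (n + 3) * fact n" for n
    by (simp add: eval_nat_numeral algebra_simps)
  have step: "c * (3 ^ k * p / fact n) / real ((n + 2) * (n + 3)) =
      c * (3 ^ Suc k * (p * (q + of_nat k)) / (real (n + 1) * real (n + 2) * real (n + 3) * fact n))"
    if "3 * (q + real k) = real (n + 1)" for n k q c p
  proof -
    have "3 ^ Suc k * (p * (q + of_nat k)) = (3 ^ k * p) * real (n + 1)"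
      unfolding that[symmetric] by simp
    then have e: "3 ^ Suc k * (p * (q + of_nat k)) = (3 ^ k * p) * real (n + 1)" .
    have g: "c * (x / f) / (a * b) = c * (x * m / (m * a * b * f))" if "m \<noteq> 0" for x f a b m :: real
      using that by simp
    show ?thesis unfolding of_nat_mult e by (rule g) simp
  qed
  show "airy_coeff (3 * k) = airy_coeff 0 * (3 ^ k * pochhammer (1/3) k / fact (3 * k))"
  proof (induction k)
    case (Suc k)
    have e: "3 * Suc k = 3 * k + 3" by simp
    show ?case unfolding pochhammer_Suc e rec fact3 Suc.IH by (rule step) simp
  qed simp
  show "airy_coeff (3 * k + 1) = airy_coeff 1 * (3 ^ k * pochhammer (2/3) k / fact (3 * k + 1))"
  proof (induction k)
    case (Suc k)
    have e: "3 * Suc k + 1 = (3 * k + 1) + 3" by simp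
    show ?case unfolding pochhammer_Suc e rec fact3 Suc.IH by (rule step) simp
  qed simp
  show "airy_coeff (3 * k + 2) = 0"
  proof (induction k)
    case (Suc k)
    have "3 * Suc k + 2 = (3 * k + 2) + 3" by simp
    then show ?case by (simp only: rec Suc.IH div_0)
  qed (use airy_coeff_2 in \<open>simp add: numeral_2_eq_2\<close>)
qed

lemma Ai_eq_airyD: "Ai z = airyD 0 z"
proof -
  define f where "f n = airy_coeff n * z ^ n" for n
  have f: "f sums airyD 0 z" using airyD_sums[of 0 z] by (simp add: f_def[abs_def])
  \<comment> \<open>Convergence at the larger point \<open>\<bar>z\<bar> + 1\<close> yields absolute
    convergence at \<open>z\<close>, hence convergence of the subseries along each residue class mod
    3.\<close>
  have "summable (\<lambda>n. norm (f n))"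
  proof -
    have "summable (\<lambda>n. airy_coeff n * (\<bar>z\<bar> + 1) ^ n)"
      using airyD_sums[of 0 "\<bar>z\<bar> + 1"] sums_summable by simp blast
    then show ?thesis unfolding f_def by (rule powser_insidea) simp
  qed
  then have sub: "summable (\<lambda>k. f (3 * k + i))" for i
    by (intro summable_norm_cancel[OF summable_reindex[where g="\<lambda>k. 3 * k + i" and f="\<lambda>n. norm (f n)", unfolded o_def]])
       (auto intro: injI)
  have "(\<lambda>k. sum f {k * 3..<k * 3 + 3}) sums airyD 0 z" by (rule sums_group[OF f]) simp
  moreover have "sum f {k * 3..<k * 3 + 3} = f (3 * k + 0) + f (3 * k + 1)" for k
  proof -
    have "{k * 3..<k * 3 + 3} = {3 * k, 3 * k + 1, 3 * k + 2}" by auto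
    then show ?thesis using airy_coeff_triple(3)[of k] by (simp add: f_def)
  qed
  ultimately have "(\<lambda>k. f (3 * k + 0) + f (3 * k + 1)) sums airyD 0 z" by simp
  moreover have "(\<lambda>k. f (3 * k + 0) + f (3 * k + 1)) sums ((\<Sum>k. f (3 * k + 0)) + (\<Sum>k. f (3 * k + 1)))"
    by (intro sums_add summable_sums sub)
  ultimately have eq: "airyD 0 z = (\<Sum>k. f (3 * k + 0)) + (\<Sum>k. f (3 * k + 1))" by (rule sums_unique2)
  have pos: "airy_coeff 0 \<noteq> 0" "airy_coeff 1 \<noteq> 0"
    using less_imp_neq[OF Gamma_real_pos[of "1/3"]] less_imp_neq[OF Gamma_real_pos[of "2/3"]]
    by (auto simp: airy_coeff_0 airy_coeff_1[simplified])
  have "(\<Sum>k. f (3 * k + 0)) = airy_coeff 0 * airy_f z"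
  proof -
    have e: "f (3 * k + 0) = airy_coeff 0 * (3 ^ k * pochhammer (1/3) k * z ^ (3 * k) / fact (3 * k))" for k
      using airy_coeff_triple(1)[of k] by (simp add: f_def)
    have "summable (\<lambda>k. 3 ^ k * pochhammer (1/3) k * z ^ (3 * k) / fact (3 * k))"
      using summable_mult_D[OF sub[of 0, unfolded e]] pos by simp
    then show ?thesis unfolding e airy_f_def by (rule suminf_mult)
  qed
  moreover have "(\<Sum>k. f (3 * k + 1)) = airy_coeff 1 * airy_g z"
  proof -
    have e: "f (3 * k + 1) = airy_coeff 1 * (3 ^ k * pochhammer (2/3) k * z ^ (3 * k + 1) / fact (3 * k + 1))" for k
      unfolding f_def airy_coeff_triple(2)[of k] by simp
    have "summable (\<lambda>k. 3 ^ k * pochhammer (2/3) k * z ^ (3 * k + 1) / fact (3 * k + 1))"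
      using summable_mult_D[OF sub[of 1, unfolded e]] pos by simp
    then show ?thesis unfolding e airy_g_def by (rule suminf_mult)
  qed
  ultimately show ?thesis
    unfolding eq Ai_def airy_coeff_0 airy_coeff_1 by simp
qed

section \<open>Perturbed Airy integrals\<close>

text \<open>Not normalised: as \<open>\<i> - (-1)\<close> it spans the whole segment from the saddle
  point \<open>-1\<close> to \<open>\<i>\<close>, so that the Bessel contour is
  \<open>-1 + d45 * s\<close> with \<open>s\<close> in the unit interval.\<close>

definition d45 :: complex where "d45 = Complex 1 1"

lemma d45_pow: "d45 ^ 3 = Complex (-2) 2" "norm d45 = sqrt 2"
  by (simp_all add: d45_def power3_eq_cube complex_eq_iff cmod_def)

lemma Re_cube: "Re (p ^ 3) = Re p * ((Re p)\<^sup>2 - 3 * (Im p)\<^sup>2)"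
  by (simp add: power3_eq_cube power2_eq_square algebra_simps)

lemma norm_exp_le: "norm (exp (- (of_real z * w))) \<le> exp (\<bar>z\<bar> * norm (w::complex))"
proof -
  have "Re (- (of_real z * w)) \<le> norm (of_real z * w)"
    using abs_Re_le_cmod[of "of_real z * w"] by (simp add: abs_le_iff)
  then show ?thesis by (simp add: norm_mult)
qed

text \<open>The hypothesis on \<open>d\<close> holds for both ray directions. The bounds get weaker
  in turn: pure cubic decay, the Gaussian weight of the phase estimates, and the weight that also
  leaves room for powers of \<open>t\<close>.\<close>

lemma norm_airy_exp_le:
  assumes "Re (d ^ 3) \<le> -1" "t \<ge> 0"
  shows "norm (airy_exp d t) \<le> exp (- (t ^ 3) / 3)" "norm (airy_exp d t) \<le> exp (t / 2 - t\<^sup>2 / 4)"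
    "norm (airy_exp d t) \<le> 1 * exp (3 * t - t\<^sup>2 / 4)"
proof -
  have "(d * of_real t) ^ 3 / 3 = of_real (t ^ 3 / 3) * d ^ 3"
    by (simp add: power_mult_distrib)
  then have "Re ((d * of_real t) ^ 3 / 3) = (t ^ 3 / 3) * Re (d ^ 3)" by simp
  also have "\<dots> \<le> (t ^ 3 / 3) * (-1)" by (rule mult_left_mono) (use assms in auto)
  finally show 1: "norm (airy_exp d t) \<le> exp (- (t ^ 3) / 3)" by (simp add: airy_exp_def)
  then show 2: "norm (airy_exp d t) \<le> exp (t / 2 - t\<^sup>2 / 4)"
    using cubic_weight[OF assms(2)] by (meson exp_le_cancel_iff order_trans)
  also have "\<dots> \<le> 1 * exp (3 * t - t\<^sup>2 / 4)" using assms by simp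
  finally show "norm (airy_exp d t) \<le> 1 * exp (3 * t - t\<^sup>2 / 4)" .
qed

lemma airy_exp_continuous: "continuous_on A (airy_exp d)"
  unfolding airy_exp_def by (intro continuous_intros) auto

text \<open>Being linear in \<open>K\<close> and uniform in \<open>z\<close>, the bound passes
  smallness of \<open>F\<close> on to the integral. In the exponent, \<open>2 * Z\<close> comes from
  \<open>exp (- z p)\<close> with \<open>norm d \<le> 2\<close>, 3 from the weight, and 2 from
  \<open>gaussian_weight_le\<close>.\<close>

lemma airy_ray_integrand_bound:
  fixes d :: complex and F :: "real \<Rightarrow> complex"
  assumes F: "norm (F t) \<le> K * exp (3 * t - t\<^sup>2 / 4)" and t: "t \<ge> 0" and d: "norm d \<le> 2" and K: "K \<ge> 0"
    and z: "\<bar>z\<bar> \<le> Z"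
  shows "norm (d * (- (d * of_real t)) ^ j * exp (- (of_real z * (d * of_real t))) * F t)
           \<le> K * (2 ^ (j + 1) * fact j * exp ((2 * Z + 5)\<^sup>2)) * exp (- t)"
proof -
  have "norm (exp (- (of_real z * (d * of_real t)))) \<le> exp (\<bar>z\<bar> * norm (d * of_real t))" by (rule norm_exp_le)
  also have "\<bar>z\<bar> * norm (d * of_real t) \<le> Z * (2 * t)"
    using z d t by (intro mult_mono) (auto simp: norm_mult mult_right_mono)
  finally have e: "norm (exp (- (of_real z * (d * of_real t)))) \<le> exp (Z * (2 * t))" by simp
  have "norm (d * (- (d * of_real t)) ^ j * exp (- (of_real z * (d * of_real t))) * F t)
      = norm d * (norm d * t) ^ j * norm (exp (- (of_real z * (d * of_real t)))) * norm (F t)"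
    using t by (simp add: norm_mult norm_power)
  also have "\<dots> \<le> 2 * (2 * t) ^ j * exp (Z * (2 * t)) * (K * exp (3 * t - t\<^sup>2 / 4))"
    using t d by (intro mult_mono e F power_mono mult_right_mono) auto
  also have "\<dots> = K * 2 ^ (j + 1) * (t ^ j * exp ((2 * Z + 3) * t - t\<^sup>2 / 4))"
    by (simp add: power_mult_distrib exp_add exp_diff algebra_simps)
  also have "\<dots> \<le> K * 2 ^ (j + 1) * (fact j * exp ((2 * Z + 3 + 2)\<^sup>2) * exp (- t))"
    by (intro mult_left_mono gaussian_weight_le t) (use K in auto)
  finally show ?thesis by (simp add: ac_simps)
qed

lemma airy_ray_integrable:
  fixes d :: complex
  assumes m: "set_borel_measurable lborel {0..} F"
    and F: "\<And>t. t \<ge> 0 \<Longrightarrow> norm (F t) \<le> K * exp (3 * t - t\<^sup>2 / 4)" and d: "norm d \<le> 2" and K: "K \<ge> 0"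
  shows "set_integrable lborel {0..} (\<lambda>t. d * (- (d * of_real t)) ^ j * exp (- (of_real z * (d * of_real t))) * F t)" (is ?A)
    and "\<bar>z\<bar> \<le> Z \<Longrightarrow> \<bar>airy_ray d F j z\<bar> \<le> K * (2 ^ (j + 1) * fact j * exp ((2 * Z + 5)\<^sup>2))"
proof -
  have m': "set_borel_measurable lborel {0..} (\<lambda>t. d * (- (d * of_real t)) ^ j * exp (- (of_real z * (d * of_real t))) * F t)"
  proof -
    have "(\<lambda>t. d * (- (d * of_real t)) ^ j * exp (- (of_real z * (d * of_real t)))) \<in> borel_measurable borel"
      by (intro borel_measurable_continuous_onI continuous_intros)
    then have "(\<lambda>t. d * (- (d * of_real t)) ^ j * exp (- (of_real z * (d * of_real t))) * (indicator {0..} t *\<^sub>R F t)) \<in> borel_measurable lborel"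
      using m unfolding set_borel_measurable_def by (intro borel_measurable_times) simp_all
    then show ?thesis unfolding set_borel_measurable_def by (simp add: mult_ac)
  qed
  have bnd: "norm (d * (- (d * of_real t)) ^ j * exp (- (of_real z * (d * of_real t))) * F t)
      \<le> K * (2 ^ (j + 1) * fact j * exp ((2 * Z + 5)\<^sup>2)) * exp (- t)" if "\<bar>z\<bar> \<le> Z" "t \<ge> 0" for t Z
    by (rule airy_ray_integrand_bound) (use F d K that in auto)
  show ?A by (rule set_integrable_Ici_exp_bound(1)[OF m' bnd[OF order_refl]])
  assume z: "\<bar>z\<bar> \<le> Z"
  have b: "norm (LINT t:{0..}|lborel. d * (- (d * of_real t)) ^ j * exp (- (of_real z * (d * of_real t))) * F t)
      \<le> K * (2 ^ (j + 1) * fact j * exp ((2 * Z + 5)\<^sup>2))"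
    by (rule set_integrable_Ici_exp_bound(2)[OF m' bnd[OF z]])
  have "\<bar>airy_ray d F j z\<bar> \<le> norm (LINT t:{0..}|lborel. d * (- (d * of_real t)) ^ j * exp (- (of_real z * (d * of_real t))) * F t) / pi"
    unfolding airy_ray_def using abs_Im_le_cmod pi_gt_zero by (simp add: divide_right_mono)
  also have "\<dots> \<le> norm (LINT t:{0..}|lborel. d * (- (d * of_real t)) ^ j * exp (- (of_real z * (d * of_real t))) * F t) / 1"
    by (rule divide_left_mono) (use pi_gt3 in auto)
  finally show "\<bar>airy_ray d F j z\<bar> \<le> K * (2 ^ (j + 1) * fact j * exp ((2 * Z + 5)\<^sup>2))" using b by linarith
qed

text \<open>The Bessel contour leaves its saddle point at slope 1, so \<open>Ai\<close> is needed
  along this ray as well; \<open>Re (p ^ 3)\<close> stays negative on the chord between the two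
  directions.\<close>

lemma airy_ray_d45: "airy_ray d45 (airy_exp d45) j z = airyD j z"
proof -
  define f where "f w = (- w) ^ j * exp (- (of_real z * w)) * exp (w ^ 3 / 3)" for w :: complex
  have i: "set_integrable lborel {0..} (\<lambda>t. f (d * of_real t))" if d: "Re (d ^ 3) \<le> -1" "norm d \<le> 2" "d \<noteq> 0" for d
  proof -
    have "set_integrable lborel {0..} (\<lambda>t. d * (- (d * of_real t)) ^ j * exp (- (of_real z * (d * of_real t))) * airy_exp d t)"
    proof (rule airy_ray_integrable(1)[where K=1])
      show "set_borel_measurable lborel {0..} (airy_exp d)"
        by (rule set_borel_measurable_Ici_continuous airy_exp_continuous)+
      fix t :: real assume t: "t \<ge> 0"
      show "norm (airy_exp d t) \<le> 1 * exp (3 * t - t\<^sup>2 / 4)"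
        by (rule norm_airy_exp_le(3)[OF d(1) t])
    qed (use d in auto)
    then have "set_integrable lborel {0..} (\<lambda>t. inverse d * (d * (- (d * of_real t)) ^ j * exp (- (of_real z * (d * of_real t))) * airy_exp d t))"
      by (rule set_integrable_mult_right)
    then show ?thesis using d by (simp add: f_def airy_exp_def field_simps)
  qed
  have r: "airy_ray d (airy_exp d) j z = Im (d * (LINT t:{0..}|lborel. f (d * of_real t))) / pi" for d
    unfolding airy_ray_def f_def airy_exp_def set_integral_mult_right[symmetric] by (simp add: mult_ac)
  have s2: "sqrt 2 \<le> 2" using real_sqrt_le_iff[of 2 4] by simp
  have "d45 * (LINT t:{0..}|lborel. f (d45 * of_real t)) = d60 * (LINT t:{0..}|lborel. f (d60 * of_real t))"
  proof (rule ray_rotation)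
    show "f holomorphic_on UNIV" unfolding f_def by (intro holomorphic_intros) auto
    show "set_integrable lborel {0..} (\<lambda>t. f (d45 * of_real t))" "set_integrable lborel {0..} (\<lambda>t. f (d60 * of_real t))"
      using s2 by (auto intro!: i simp: d45_pow d60_pow) (auto simp: d45_def d60_def complex_eq_iff)
    \<comment> \<open>The rate \<open>5 / 24\<close> is one third of the bound \<open>5 / 8\<close>
      for \<open>- Re (p ^ 3)\<close>, which results from \<open>Re p \<ge> 1/2\<close> and
      \<open>(Re p)\<^sup>2 - 3 * (Im p)\<^sup>2 \<le> 1 - 9/4\<close>.\<close>
    show "((\<lambda>R. R * ((2 * R) ^ j * exp (2 * \<bar>z\<bar> * R - 5 / 24 * R ^ 3))) \<longlongrightarrow> 0) at_top" by real_asymp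
  next
    fix R :: real and p assume R: "R \<ge> 0" and p: "p \<in> closed_segment d45 d60"
    then obtain u where u: "0 \<le> u" "u \<le> 1" "p = (1 - u) *\<^sub>R d45 + u *\<^sub>R d60" by (auto simp: in_segment)
    have sq3: "sqrt 3 \<le> 2" using real_sqrt_le_iff[of 3 4] by simp
    have Re: "Re p = 1 - u / 2" and Im: "Im p = 1 - u + u * (sqrt 3 / 2)" using u by (simp_all add: d45_def d60_def)
    have "u * (sqrt 3 / 2) \<le> u * 1" using u sq3 by (intro mult_left_mono) auto
    then have Im1: "Im p \<le> 1" by (simp add: Im)
    have "(1 - u) * 1 \<ge> (1 - u) * (sqrt 3 / 2)" using u sq3 by (intro mult_left_mono) auto
    then have Im2: "Im p \<ge> sqrt 3 / 2" by (simp add: Im algebra_simps diff_divide_distrib)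
    have "(sqrt 3 / 2)\<^sup>2 \<le> (Im p)\<^sup>2" using Im2 by (intro power_mono) auto
    then have I2: "(Im p)\<^sup>2 \<ge> 3 / 4" by (simp add: power_divide)
    have R2: "(Re p)\<^sup>2 \<le> 1" unfolding Re using u by (intro power_le_one) auto
    have Rp: "Re p \<ge> 0" unfolding Re using u by simp
    have RI: "(Re p)\<^sup>2 - 3 * (Im p)\<^sup>2 \<le> -5/4" using I2 R2 by linarith
    have "Re (p ^ 3) \<le> Re p * (-5/4)" unfolding Re_cube by (rule mult_left_mono[OF RI Rp])
    moreover have "Re p \<ge> 1 / 2" unfolding Re using u by simp
    ultimately have p3: "Re (p ^ 3) \<le> -5/8" by linarith
    have "norm p \<le> \<bar>Re p\<bar> + \<bar>Im p\<bar>" by (rule cmod_le)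
    also have "\<dots> \<le> 2"
    proof -
      have "Re p \<le> 1" unfolding Re using u by simp
      moreover have "Im p \<ge> 0" using Im2 real_sqrt_ge_zero[of 3] by linarith
      ultimately show ?thesis using Im1 Rp by linarith
    qed
    finally have np: "norm p \<le> 2" .
    have "norm (exp (- (of_real z * (of_real R * p)))) \<le> exp (\<bar>z\<bar> * norm (of_real R * p))" by (rule norm_exp_le)
    also have "\<bar>z\<bar> * norm (of_real R * p) \<le> \<bar>z\<bar> * (R * 2)"
      using R np by (intro mult_left_mono) (auto simp: norm_mult mult_left_mono)
    finally have e: "norm (exp (- (of_real z * (of_real R * p)))) \<le> exp (\<bar>z\<bar> * (R * 2))" by simp
    have "(of_real R * p) ^ 3 / 3 = of_real (R ^ 3 / 3) * p ^ 3" by (simp add: power_mult_distrib)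
    then have "Re ((of_real R * p) ^ 3 / 3) = (R ^ 3 / 3) * Re (p ^ 3)" by simp
    also have "\<dots> \<le> (R ^ 3 / 3) * (-5/8)" by (rule mult_left_mono[OF p3]) (use R in auto)
    finally have e3: "norm (exp ((of_real R * p) ^ 3 / 3)) \<le> exp (- (5 / 24 * R ^ 3))" by simp
    have "norm (f (of_real R * p)) = (R * norm p) ^ j * norm (exp (- (of_real z * (of_real R * p)))) * norm (exp ((of_real R * p) ^ 3 / 3))"
      unfolding f_def using R by (simp add: norm_mult norm_power)
    also have "\<dots> \<le> (2 * R) ^ j * exp (\<bar>z\<bar> * (R * 2)) * exp (- (5 / 24 * R ^ 3))"
    proof -
      have "R * norm p \<le> 2 * R" using mult_left_mono[OF np R] by simp
      then have "(R * norm p) ^ j \<le> (2 * R) ^ j" by (rule power_mono) (use R in simp)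
      then show ?thesis using R by (intro mult_mono[OF mult_mono[OF _ e] e3]) auto
    qed
    also have "\<dots> = (2 * R) ^ j * exp (2 * \<bar>z\<bar> * R - 5 / 24 * R ^ 3)"
    proof -
      have "2 * \<bar>z\<bar> * R - 5 / 24 * R ^ 3 = \<bar>z\<bar> * (R * 2) + - (5 / 24 * R ^ 3)" by simp
      then show ?thesis by (simp only: exp_add mult.assoc)
    qed
    finally show "norm (f (of_real R * p)) \<le> (2 * R) ^ j * exp (2 * \<bar>z\<bar> * R - 5 / 24 * R ^ 3)" .
  qed
  then show ?thesis using airy_ray_d60[of j z] unfolding r by simp
qed

text \<open>The weight \<open>F\<close> is a perturbation \<open>exp (p\<^sup>3/3 + \<sigma>\<epsilon> p\<^sup>4/4 + O(\<epsilon>\<^sup>2))\<close> of the Airy weight,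
  uniformly on the ray \<open>p = d t\<close>; the factor \<open>p\<^sup>4\<close> turns into \<open>airyD 4\<close> after integration.\<close>
definition airy_kernel :: "real \<Rightarrow> complex \<Rightarrow> real \<Rightarrow> (real \<Rightarrow> complex) \<Rightarrow> bool" where
  "airy_kernel \<sigma> d \<epsilon> F \<longleftrightarrow> set_borel_measurable lborel {0..} F \<and>
     (\<forall>t\<ge>0. norm (F t - airy_exp d t) \<le> 10 ^ 9 * \<epsilon> * exp (3 * t - t\<^sup>2 / 4) \<and>
       norm (F t - airy_exp d t - of_real (\<sigma> * \<epsilon> / 4) * (d * of_real t) ^ 4 * airy_exp d t)
         \<le> 10 ^ 9 * \<epsilon>\<^sup>2 * exp (3 * t - t\<^sup>2 / 4))"

lemma airy_ray_diff:
  assumes "set_integrable lborel {0..} (\<lambda>t. d * (- (d * of_real t)) ^ j * exp (- (of_real z * (d * of_real t))) * F t)"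
    "set_integrable lborel {0..} (\<lambda>t. d * (- (d * of_real t)) ^ j * exp (- (of_real z * (d * of_real t))) * G t)"
  shows "airy_ray d (\<lambda>t. F t - G t) j z = airy_ray d F j z - airy_ray d G j z"
  unfolding airy_ray_def right_diff_distrib set_integral_diff(2)[OF assms] by (simp add: diff_divide_distrib)

text \<open>Uniformity in \<open>\<bar>z\<bar> \<le> Z\<close> is what allows zeros to be located
  afterwards. The constant \<open>10 ^ 10\<close> covers \<open>10 ^ 9 * 2 ^ (j + 1)\<close> for
  \<open>j = 0\<close> and \<open>j = 1\<close>.\<close>

lemma airy_kernel_asymp:
  assumes k: "airy_kernel \<sigma> d \<epsilon> F" and d: "d = d60 \<or> d = d45" and \<epsilon>: "0 < \<epsilon>" and z: "\<bar>z\<bar> \<le> Z"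
  shows "\<bar>airy_ray d F 0 z - airyD 0 z - \<sigma> * \<epsilon> / 4 * airyD 4 z\<bar> \<le> 10 ^ 10 * exp ((2 * Z + 5)\<^sup>2) * \<epsilon>\<^sup>2"
    and "\<bar>airy_ray d F 1 z - airyD 1 z\<bar> \<le> 10 ^ 10 * exp ((2 * Z + 5)\<^sup>2) * \<epsilon>"
proof -
  let ?V = "\<lambda>t. exp (3 * t - t\<^sup>2 / 4) :: real"
  let ?E = "airy_exp d"
  define c where "c = of_real (\<sigma> * \<epsilon> / 4) * (1::complex)"
  have s2: "sqrt 2 \<le> 2" using real_sqrt_le_iff[of 2 4] by simp
  have d3: "Re (d ^ 3) \<le> -1" and nd: "norm d \<le> 2" using d s2 by (auto simp: d45_pow d60_pow)
  have A: "airy_ray d ?E j z = airyD j z" for j using d airy_ray_d45 airy_ray_d60 by auto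
  have mF: "set_borel_measurable lborel {0..} F" using k by (simp add: airy_kernel_def)
  have mE: "set_borel_measurable lborel {0..} ?E" by (rule set_borel_measurable_Ici_continuous airy_exp_continuous)+
  have mE4: "set_borel_measurable lborel {0..} (\<lambda>t. c * (d * of_real t) ^ 4 * ?E t)"
    by (intro set_borel_measurable_Ici_continuous continuous_intros airy_exp_continuous)
  have bE: "norm (?E t) \<le> 1 * ?V t" if t: "t \<ge> 0" for t
    using norm_airy_exp_le(3)[OF d3 t] .
  have bF: "norm (F t) \<le> (10 ^ 9 * \<epsilon> + 1) * ?V t" if t: "t \<ge> 0" for t
  proof -
    have "norm (F t) \<le> norm (F t - ?E t) + norm (?E t)" using norm_triangle_sub by (simp add: add.commute)
    also have "\<dots> \<le> 10 ^ 9 * \<epsilon> * ?V t + 1 * ?V t" using k bE t by (intro add_mono) (auto simp: airy_kernel_def)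
    finally show ?thesis by (simp add: algebra_simps)
  qed
  have bE4: "norm (c * (d * of_real t) ^ 4 * ?E t) \<le> (norm c * 384) * ?V t" if t: "t \<ge> 0" for t
  proof -
    have "norm (c * (d * of_real t) ^ 4 * ?E t) = norm c * ((norm d * t) ^ 4 * norm (?E t))"
      using t by (simp add: norm_mult norm_power)
    also have "\<dots> \<le> norm c * ((2 * t) ^ 4 * exp (t / 2 - t\<^sup>2 / 4))"
      using t nd by (intro mult_left_mono mult_mono power_mono mult_right_mono norm_airy_exp_le d3) auto
    also have "\<dots> = norm c * 16 * (t ^ 4 * exp (t / 2 - t\<^sup>2 / 4))" by (simp add: power_mult_distrib)
    also have "\<dots> \<le> norm c * 16 * ((fact 4 * exp t) * exp (t / 2 - t\<^sup>2 / 4))"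
      using t by (intro mult_left_mono mult_right_mono power_le_fact_exp) auto
    also have "\<dots> = norm c * 384 * exp (t + (t / 2 - t\<^sup>2 / 4))"
      unfolding exp_add by (simp add: fact_numeral)
    also have "\<dots> \<le> norm c * 384 * ?V t" using t by (intro mult_left_mono) auto
    finally show ?thesis .
  qed
  have iF: "set_integrable lborel {0..} (\<lambda>t. d * (- (d * of_real t)) ^ j * exp (- (of_real z * (d * of_real t))) * F t)" for j
    by (rule airy_ray_integrable(1)[OF mF bF nd]) (use \<epsilon> in auto)
  have iE: "set_integrable lborel {0..} (\<lambda>t. d * (- (d * of_real t)) ^ j * exp (- (of_real z * (d * of_real t))) * ?E t)" for j
    by (rule airy_ray_integrable(1)[OF mE bE nd]) auto
  have iE4: "set_integrable lborel {0..} (\<lambda>t. d * (- (d * of_real t)) ^ j * exp (- (of_real z * (d * of_real t))) * (c * (d * of_real t) ^ 4 * ?E t))" for j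
    by (rule airy_ray_integrable(1)[OF mE4 bE4 nd]) auto
  have mD: "set_borel_measurable lborel {0..} (\<lambda>t. F t - ?E t)"
    using mF mE unfolding set_borel_measurable_def scaleR_diff_right by (rule borel_measurable_diff)
  have iD: "set_integrable lborel {0..} (\<lambda>t. d * (- (d * of_real t)) ^ j * exp (- (of_real z * (d * of_real t))) * (F t - ?E t))" for j
    using set_integral_diff(1)[OF iF[of j] iE[of j]] by (simp add: right_diff_distrib)
  have "\<bar>airy_ray d (\<lambda>t. F t - ?E t) 1 z\<bar> \<le> 10 ^ 9 * \<epsilon> * (2 ^ (1 + 1) * fact 1 * exp ((2 * Z + 5)\<^sup>2))"
    by (rule airy_ray_integrable(2)[OF mD _ nd _ z]) (use k \<epsilon> in \<open>auto simp: airy_kernel_def\<close>)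
  also have "\<dots> \<le> 10 ^ 10 * exp ((2 * Z + 5)\<^sup>2) * \<epsilon>" using \<epsilon> by simp
  finally show "\<bar>airy_ray d F 1 z - airyD 1 z\<bar> \<le> 10 ^ 10 * exp ((2 * Z + 5)\<^sup>2) * \<epsilon>"
    unfolding airy_ray_diff[OF iF iE] A .
  have mD2: "set_borel_measurable lborel {0..} (\<lambda>t. F t - ?E t - c * (d * of_real t) ^ 4 * ?E t)"
    using mD mE4 unfolding set_borel_measurable_def scaleR_diff_right by (rule borel_measurable_diff)
  have "\<bar>airy_ray d (\<lambda>t. F t - ?E t - c * (d * of_real t) ^ 4 * ?E t) 0 z\<bar> \<le> 10 ^ 9 * \<epsilon>\<^sup>2 * (2 ^ (0 + 1) * fact 0 * exp ((2 * Z + 5)\<^sup>2))"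
    by (rule airy_ray_integrable(2)[OF mD2 _ nd _ z]) (use k \<epsilon> in \<open>auto simp: airy_kernel_def c_def\<close>)
  also have "\<dots> \<le> 10 ^ 10 * exp ((2 * Z + 5)\<^sup>2) * \<epsilon>\<^sup>2" using \<epsilon> by simp
  also have "airy_ray d (\<lambda>t. F t - ?E t - c * (d * of_real t) ^ 4 * ?E t) 0 z
      = airy_ray d F 0 z - airyD 0 z - airy_ray d (\<lambda>t. c * (d * of_real t) ^ 4 * ?E t) 0 z"
    unfolding airy_ray_diff[OF iD iE4] airy_ray_diff[OF iF iE] A ..
  also have "airy_ray d (\<lambda>t. c * (d * of_real t) ^ 4 * ?E t) 0 z = \<sigma> * \<epsilon> / 4 * airy_ray d ?E 4 z"
  proof -
    \<comment> \<open>The correction \<open>p ^ 4\<close> equals \<open>(- p) ^ 4\<close>, the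
      factor belonging to the fourth derivative, so no sign arises.\<close>
    have "(\<lambda>t. d * (- (d * of_real t)) ^ 0 * exp (- (of_real z * (d * of_real t))) * (c * (d * of_real t) ^ 4 * ?E t))
      = (\<lambda>t. of_real (\<sigma> * \<epsilon> / 4) * (d * (- (d * of_real t)) ^ 4 * exp (- (of_real z * (d * of_real t))) * ?E t))"
      by (simp add: c_def mult_ac)
    then show ?thesis unfolding airy_ray_def by (simp only: set_integral_mult_right) simp
  qed
  finally show "\<bar>airy_ray d F 0 z - airyD 0 z - \<sigma> * \<epsilon> / 4 * airyD 4 z\<bar> \<le> 10 ^ 10 * exp ((2 * Z + 5)\<^sup>2) * \<epsilon>\<^sup>2"
    unfolding A .
qed

text \<open>Taylor's theorem on a half-plane, where all derivatives of \<open>exp\<close> are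
  bounded by \<open>exp \<beta>\<close>. In the second bound \<open>c\<close> stands for the main
  part of \<open>a - b\<close>, so the error is a square plus what \<open>c\<close> misses.\<close>

lemma exp_diff_bounds:
  fixes a b c :: complex
  assumes "Re a \<le> \<beta>" "Re b \<le> \<beta>"
  shows "norm (exp a - exp b) \<le> exp \<beta> * norm (a - b)"
    and "norm (exp a - exp b - c * exp b) \<le> exp \<beta> * ((norm (a - b))\<^sup>2 + norm (a - b - c))"
proof -
  let ?S = "{w::complex. Re w \<le> \<beta>}"
  have S: "convex ?S" by (rule convex_halfspace_Re_le)
  have T: "norm (exp a - (\<Sum>i\<le>n. exp b * (a - b) ^ i / fact i)) \<le> exp \<beta> * norm (a - b) ^ Suc n / fact n" for n
    by (rule complex_Taylor[OF S, where f="\<lambda>i. exp"])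
       (use assms in \<open>auto intro!: derivative_eq_intros\<close>)
  show "norm (exp a - exp b) \<le> exp \<beta> * norm (a - b)" using T[of 0] by simp
  have "norm (exp a - exp b - c * exp b) = norm ((exp a - (\<Sum>i\<le>1. exp b * (a - b) ^ i / fact i)) + exp b * (a - b - c))"
    by (simp add: algebra_simps)
  also have "\<dots> \<le> exp \<beta> * norm (a - b) ^ Suc 1 / fact 1 + norm (exp b) * norm (a - b - c)"
    using T[of 1] by (intro norm_triangle_mono) (simp_all add: norm_mult)
  also have "\<dots> \<le> exp \<beta> * norm (a - b) ^ Suc 1 / fact 1 + exp \<beta> * norm (a - b - c)"
    using assms by (intro add_left_mono mult_right_mono) auto
  finally show "norm (exp a - exp b - c * exp b) \<le> exp \<beta> * ((norm (a - b))\<^sup>2 + norm (a - b - c))"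
    by (simp add: power2_eq_square distrib_left)
qed

text \<open>A kernel enters only through its logarithm \<open>a\<close>: an expansion of
  \<open>a\<close> to two orders and a one-sided bound on \<open>Re a\<close>. Weakening
  \<open>t / 2\<close> to \<open>3 * t\<close> in the exponent absorbs the powers of
  \<open>t\<close>; the largest constant that arises is \<open>4096 * fact 8 + 128 * fact 5\<close>,
  which is below \<open>10 ^ 9\<close>.\<close>

lemma phase_estimate:
  assumes \<epsilon>: "0 < \<epsilon>" and d: "norm d \<le> 2" "Re (d ^ 3) \<le> -1" and t: "t \<ge> 0"
    and r: "norm (a - (d * of_real t) ^ 3 / 3) \<le> 4 * \<epsilon> * norm (d * of_real t) ^ 4"
    and r2: "norm (a - (d * of_real t) ^ 3 / 3 - of_real (\<sigma> * \<epsilon> / 4) * (d * of_real t) ^ 4) \<le> 4 * \<epsilon>\<^sup>2 * norm (d * of_real t) ^ 5"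
    and a: "Re a \<le> t / 2 - t\<^sup>2 / 4"
  shows "norm (exp a - airy_exp d t) \<le> 10 ^ 9 * \<epsilon> * exp (3 * t - t\<^sup>2 / 4)"
    and "norm (exp a - airy_exp d t - of_real (\<sigma> * \<epsilon> / 4) * (d * of_real t) ^ 4 * airy_exp d t)
         \<le> 10 ^ 9 * \<epsilon>\<^sup>2 * exp (3 * t - t\<^sup>2 / 4)"
proof -
  let ?b = "(d * of_real t) ^ 3 / 3"
  let ?e = "exp (t / 2 - t\<^sup>2 / 4)"
  have b: "Re ?b \<le> t / 2 - t\<^sup>2 / 4"
    using norm_airy_exp_le(2)[OF d(2) t] by (simp add: airy_exp_def)
  have n: "norm (d * of_real t) \<le> 2 * t" using d t by (simp add: norm_mult mult_right_mono)
  have n4: "norm (d * of_real t) ^ 4 \<le> 16 * t ^ 4"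
    using power_mono[OF n, of 4] by (simp add: power_mult_distrib)
  have n5: "norm (d * of_real t) ^ 5 \<le> 32 * t ^ 5"
    using power_mono[OF n, of 5] by (simp add: power_mult_distrib)
  have R: "norm (a - ?b) \<le> 64 * \<epsilon> * t ^ 4" 
  proof (rule order_trans[OF r])
    have "4 * \<epsilon> * norm (d * of_real t) ^ 4 \<le> 4 * \<epsilon> * (16 * t ^ 4)"
      by (rule mult_left_mono[OF n4]) (use \<epsilon> in auto)
    also have "\<dots> = 64 * \<epsilon> * t ^ 4" by simp
    finally show "4 * \<epsilon> * norm (d * of_real t) ^ 4 \<le> 64 * \<epsilon> * t ^ 4" .
  qed
  have R2: "norm (a - ?b - of_real (\<sigma> * \<epsilon> / 4) * (d * of_real t) ^ 4) \<le> 128 * \<epsilon>\<^sup>2 * t ^ 5"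
  proof (rule order_trans[OF r2])
    have "4 * \<epsilon>\<^sup>2 * norm (d * of_real t) ^ 5 \<le> 4 * \<epsilon>\<^sup>2 * (32 * t ^ 5)"
      by (rule mult_left_mono[OF n5]) auto
    also have "\<dots> = 128 * \<epsilon>\<^sup>2 * t ^ 5" by simp
    finally show "4 * \<epsilon>\<^sup>2 * norm (d * of_real t) ^ 5 \<le> 128 * \<epsilon>\<^sup>2 * t ^ 5" .
  qed
  have w: "t ^ m * ?e \<le> fact m * exp (3 * t - t\<^sup>2 / 4)" for m
  proof -
    have "t ^ m * ?e \<le> (fact m * exp t) * ?e" by (intro mult_right_mono power_le_fact_exp t) auto
    also have "\<dots> = fact m * exp (t + (t / 2 - t\<^sup>2 / 4))" unfolding exp_add by simp
    also have "\<dots> \<le> fact m * exp (3 * t - t\<^sup>2 / 4)" using t by (intro mult_left_mono) auto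
    finally show ?thesis .
  qed
  have "norm (exp a - exp ?b) \<le> ?e * norm (a - ?b)" by (rule exp_diff_bounds(1)[OF a b])
  also have "\<dots> \<le> ?e * (64 * \<epsilon> * t ^ 4)" by (intro mult_left_mono R) auto
  also have "\<dots> = 64 * \<epsilon> * (t ^ 4 * ?e)" by simp
  also have "\<dots> \<le> 64 * \<epsilon> * (fact 4 * exp (3 * t - t\<^sup>2 / 4))" by (intro mult_left_mono w) (use \<epsilon> in auto)
  also have "\<dots> = (64 * 24) * (\<epsilon> * exp (3 * t - t\<^sup>2 / 4))" by (simp add: fact_numeral)
  also have "\<dots> \<le> 10 ^ 9 * (\<epsilon> * exp (3 * t - t\<^sup>2 / 4))" using \<epsilon> by (intro mult_right_mono) auto
  finally show "norm (exp a - airy_exp d t) \<le> 10 ^ 9 * \<epsilon> * exp (3 * t - t\<^sup>2 / 4)" by (simp add: airy_exp_def)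
  have "norm (exp a - exp ?b - of_real (\<sigma> * \<epsilon> / 4) * (d * of_real t) ^ 4 * exp ?b)
     \<le> ?e * ((norm (a - ?b))\<^sup>2 + norm (a - ?b - of_real (\<sigma> * \<epsilon> / 4) * (d * of_real t) ^ 4))"
    by (rule exp_diff_bounds(2)[OF a b])
  also have "\<dots> \<le> ?e * ((64 * \<epsilon> * t ^ 4)\<^sup>2 + 128 * \<epsilon>\<^sup>2 * t ^ 5)"
    by (intro mult_left_mono add_mono R2 power_mono R) auto
  also have "\<dots> = \<epsilon>\<^sup>2 * (4096 * (t ^ 8 * ?e) + 128 * (t ^ 5 * ?e))"
    by (simp add: power_mult_distrib algebra_simps flip: power_mult)
  also have "\<dots> \<le> \<epsilon>\<^sup>2 * (4096 * (fact 8 * exp (3 * t - t\<^sup>2 / 4)) + 128 * (fact 5 * exp (3 * t - t\<^sup>2 / 4)))"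
    by (intro mult_left_mono add_mono w) auto
  also have "\<dots> = (4096 * 40320 + 128 * 120) * (\<epsilon>\<^sup>2 * exp (3 * t - t\<^sup>2 / 4))"
    by (simp add: fact_numeral)
  also have "\<dots> \<le> 10 ^ 9 * (\<epsilon>\<^sup>2 * exp (3 * t - t\<^sup>2 / 4))" by (intro mult_right_mono) auto
  finally show "norm (exp a - airy_exp d t - of_real (\<sigma> * \<epsilon> / 4) * (d * of_real t) ^ 4 * airy_exp d t)
         \<le> 10 ^ 9 * \<epsilon>\<^sup>2 * exp (3 * t - t\<^sup>2 / 4)" by (simp add: airy_exp_def)
qed

section \<open>Hermite polynomials in the transition region\<close>

text \<open>Monic rescaling of the physicists' Hermite polynomials: \<open>herm m = H\<^sub>m / 2\<^sup>m\<close>.\<close>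
fun herm :: "nat \<Rightarrow> real \<Rightarrow> real" where
  "herm 0 x = 1"
| "herm (Suc 0) x = x"
| "herm (Suc (Suc m)) x = x * herm (Suc m) x - real (Suc m) / 2 * herm m x"

text \<open>The ratio bound reproduces itself: for \<open>x\<^sup>2 \<ge> 2 * N\<close> the
  subtracted term of the recurrence is at most \<open>x\<^sup>2 / 4 * herm n x\<close>, hence at
  most half of \<open>x * herm (Suc n) x\<close>. Consequently there are no zeros beyond
  \<open>sqrt (2 * N)\<close>.\<close>

lemma herm_ratio:
  assumes "x > 0" "x\<^sup>2 \<ge> 2 * real N" "n \<le> N"
  shows "herm n x > 0 \<and> herm (Suc n) x \<ge> x / 2 * herm n x"
  using assms(3)
proof (induction n)
  case (Suc n)
  then have IH: "herm n x > 0" "herm (Suc n) x \<ge> x / 2 * herm n x" by auto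
  have p: "herm (Suc n) x > 0" using IH assms(1) by (smt (verit) divide_pos_pos mult_pos_pos)
  have "real (Suc n) / 2 * herm n x \<le> (x\<^sup>2 / 4) * herm n x"
    using assms Suc.prems IH by (intro mult_right_mono) auto
  also have "\<dots> = x / 2 * (x / 2 * herm n x)" by (simp add: power2_eq_square)
  also have "\<dots> \<le> x / 2 * herm (Suc n) x" using IH assms by (intro mult_left_mono) auto
  finally show ?case using p by simp
qed (use assms in auto)

lemma herm_pos: "x > 0 \<Longrightarrow> x\<^sup>2 \<ge> 2 * real N \<Longrightarrow> herm N x > 0"
  using herm_ratio by blast

lemma continuous_herm: "continuous_on A (herm n)"
proof (induction n rule: less_induct)
  case (less n)
  consider "n = 0" | "n = 1" | m where "n = Suc (Suc m)" by (metis One_nat_def not0_implies_Suc)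
  then show ?case
  proof cases
    case 1
    have "herm 0 = (\<lambda>x. 1)" by auto
    then show ?thesis using 1 by simp
  next
    case 2
    have "herm (Suc 0) = (\<lambda>x. x)" by auto
    then show ?thesis using 2 by simp
  next
    case 3
    have "herm (Suc (Suc m)) = (\<lambda>x. x * herm (Suc m) x - real (Suc m) / 2 * herm m x)" by auto
    then show ?thesis using 3 less[of m] less[of "Suc m"] by (auto intro!: continuous_intros)
  qed
qed

text \<open>The real part of the characteristic function of the standard normal law, halved by
  evenness and rescaled by \<open>sqrt 2\<close>.\<close>

lemma gaussian_cos_integral: "(LINT t:{0..}|lborel. exp (- t\<^sup>2) * cos (2 * y * t)) = sqrt pi / 2 * exp (- y\<^sup>2)"
proof -
  define u where "u = sqrt 2 * y"
  define g where "g x = std_normal_density x * cos (u * x)" for x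
  have i: "integrable lborel g"
  proof (rule Bochner_Integration.integrable_bound[OF integrable_normal_density[of 1 0]])
    show "AE x in lborel. norm (g x) \<le> norm (normal_density 0 1 x)"
      unfolding g_def by (auto simp: abs_mult normal_density_nonneg mult_left_le)
  qed (auto simp: g_def[abs_def])
  have "complex_of_real (exp (- (u\<^sup>2) / 2)) = char std_normal_distribution u"
    by (simp add: char_std_normal_distribution)
  also have "\<dots> = (CLINT x|lborel. std_normal_density x *\<^sub>R iexp (u * x))"
    unfolding char_def by (subst integral_density) (auto simp: normal_density_nonneg)
  finally have "exp (- (u\<^sup>2) / 2) = Re (CLINT x|lborel. std_normal_density x *\<^sub>R iexp (u * x))"
    by (metis Re_complex_of_real)
  also have "\<dots> = (LINT x|lborel. g x)"
  proof -
    have "integrable lborel (\<lambda>x. std_normal_density x *\<^sub>R iexp (u * x))"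
      by (rule Bochner_Integration.integrable_bound[OF integrable_normal_density[of 1 0]]) (auto simp: normal_density_nonneg)
    then have "Re (CLINT x|lborel. std_normal_density x *\<^sub>R iexp (u * x)) = (LINT x|lborel. Re (std_normal_density x *\<^sub>R iexp (u * x)))"
      by (rule integral_Re[symmetric])
    then show ?thesis by (simp add: g_def Re_exp)
  qed
  also have "(LINT x|lborel. g x) = (LINT x|lborel. indicator {0..} x *\<^sub>R g x + indicator {..<0} x *\<^sub>R g x)"
    by (rule Bochner_Integration.integral_cong) (auto simp: indicator_def)
  also have "\<dots> = (LINT x|lborel. indicator {0..} x *\<^sub>R g x) + (LINT x|lborel. indicator {..<0} x *\<^sub>R g x)"
    by (intro Bochner_Integration.integral_add integrable_mult_indicator i) auto
  also have "(LINT x|lborel. indicator {..<0} x *\<^sub>R g x) = (LINT x|lborel. indicator {0..} x *\<^sub>R g x)"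
  proof -
    have "(LINT x|lborel. indicator {..<0} x *\<^sub>R g x) = \<bar>-1\<bar> *\<^sub>R (LINT x|lborel. indicator {..<0} (0 + (-1) * x) *\<^sub>R g (0 + (-1) * x))"
      by (rule lborel_integral_real_affine) auto
    also have "\<dots> = (LINT x|lborel. indicator {..<0} (- x) *\<^sub>R g x)"
      by (simp add: g_def normal_density_def)
    also have "\<dots> = (LINT x|lborel. indicator {0..} x *\<^sub>R g x)"
    proof (rule integral_cong_AE)
      show "AE x in lborel. indicator {..<0} (- x) *\<^sub>R g x = indicator {0..} x *\<^sub>R g x"
        using AE_lborel_singleton[of 0] by eventually_elim (auto simp: indicator_def)
    qed (auto simp: g_def)
    finally show ?thesis .
  qed
  finally have "exp (- (u\<^sup>2) / 2) = 2 * (LINT x:{0..}|lborel. g x)" unfolding set_lebesgue_integral_def by simp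
  also have "(LINT x:{0..}|lborel. g x) = sqrt 2 * (LINT x:{0..}|lborel. g (sqrt 2 * x))"
    using set_integral_Ici_scale[of "sqrt 2" g] by simp
  also have "(\<lambda>x. g (sqrt 2 * x)) = (\<lambda>x. (1 / sqrt (2 * pi)) * (exp (- x\<^sup>2) * cos (2 * y * x)))"
  proof
    fix x
    have "u * (sqrt 2 * x) = 2 * y * x" by (simp add: u_def)
    then have "cos (u * (sqrt 2 * x)) = cos (2 * y * x)" by (simp only:)
    then show "g (sqrt 2 * x) = (1 / sqrt (2 * pi)) * (exp (- x\<^sup>2) * cos (2 * y * x))"
      by (simp add: g_def normal_density_def power_mult_distrib)
  qed
  finally show ?thesis
    by (simp add: u_def power_mult_distrib real_sqrt_mult field_simps)
qed

text \<open>Classically, the Hermite polynomial of degree \<open>N\<close> is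
  \<open>2 ^ N / sqrt pi\<close> times the integral of
  \<open>(x + i t) ^ N * exp (- t\<^sup>2)\<close> over the real line. Substituting
  \<open>s = x + i t\<close> gives, up to the factor \<open>exp (x\<^sup>2)\<close>, the integrand
  \<open>s ^ N * exp (s\<^sup>2 - 2 x s)\<close>, taken here along a ray.\<close>

definition herm_ray :: "complex \<Rightarrow> real \<Rightarrow> real \<Rightarrow> nat \<Rightarrow> real \<Rightarrow> complex" where
  "herm_ray D c x N t = (of_real c + D * of_real t) ^ N *
     exp ((of_real c + D * of_real t)\<^sup>2 - 2 * of_real x * (of_real c + D * of_real t))"

lemma herm_ray_bound:
  assumes r: "r > 0"
  obtains C where "\<And>t. t \<ge> 0 \<Longrightarrow> norm (herm_ray (of_real r * d60) c x N t) \<le> C * exp (- t)"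
proof
  fix t :: real assume t: "t \<ge> 0"
  \<comment> \<open>\<open>B\<close> and \<open>A\<close> collect the linear and constant terms of
    the exponent: the power contributes \<open>r * t + \<bar>c\<bar>\<close>, and the final 1 in
    \<open>B\<close> pays for the target \<open>exp (- t)\<close>.\<close>
  define B where "B = \<bar>c\<bar> * r + 2 * \<bar>x\<bar> * r + r + 1"
  define A where "A = c\<^sup>2 + (2 * \<bar>x\<bar> + 1) * \<bar>c\<bar>"
  let ?s = "of_real c + of_real r * d60 * of_real t"
  have ns: "norm ?s \<le> \<bar>c\<bar> + r * t"
    using norm_triangle_ineq[of "of_real c" "of_real r * d60 * of_real t"] r t by (simp add: norm_mult d60_pow)
  have "Re (?s\<^sup>2) = c\<^sup>2 + c * r * t + r\<^sup>2 * t\<^sup>2 * Re (d60\<^sup>2)"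
    by (simp add: power2_eq_square d60_def algebra_simps)
  then have 1: "Re (?s\<^sup>2) \<le> c\<^sup>2 + \<bar>c\<bar> * r * t - (r * t)\<^sup>2 / 2"
    using r t by (simp add: d60_pow power_mult_distrib mult_right_mono)
  have "Re (- (2 * of_real x * ?s)) \<le> norm (- (2 * of_real x * ?s))" by (rule complex_Re_le_cmod)
  also have "\<dots> = 2 * \<bar>x\<bar> * norm ?s" by (simp add: norm_mult)
  also have "\<dots> \<le> 2 * \<bar>x\<bar> * (\<bar>c\<bar> + r * t)" by (intro mult_left_mono ns) auto
  finally have 2: "Re (?s\<^sup>2 - 2 * of_real x * ?s) \<le> c\<^sup>2 + \<bar>c\<bar> * r * t - (r * t)\<^sup>2 / 2 + 2 * \<bar>x\<bar> * (\<bar>c\<bar> + r * t)"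
    using 1 by simp
  have "norm (herm_ray (of_real r * d60) c x N t) = norm ?s ^ N * exp (Re (?s\<^sup>2 - 2 * of_real x * ?s))"
    by (simp add: herm_ray_def norm_mult norm_power)
  also have "\<dots> \<le> (\<bar>c\<bar> + r * t) ^ N * exp (c\<^sup>2 + \<bar>c\<bar> * r * t - (r * t)\<^sup>2 / 2 + 2 * \<bar>x\<bar> * (\<bar>c\<bar> + r * t))"
    using 2 by (intro mult_mono power_mono ns) (use r t in auto)
  also have "\<dots> \<le> (fact N * exp (\<bar>c\<bar> + r * t)) * exp (c\<^sup>2 + \<bar>c\<bar> * r * t - (r * t)\<^sup>2 / 2 + 2 * \<bar>x\<bar> * (\<bar>c\<bar> + r * t))"
    by (intro mult_right_mono power_le_fact_exp) (use r t in auto)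
  also have "\<dots> = fact N * exp (\<bar>c\<bar> + r * t + (c\<^sup>2 + \<bar>c\<bar> * r * t - (r * t)\<^sup>2 / 2 + 2 * \<bar>x\<bar> * (\<bar>c\<bar> + r * t)))"
    by (simp only: exp_add mult.assoc)
  also have "\<dots> = fact N * exp (A + B * t - (r * t)\<^sup>2 / 2 - t)"
    by (simp add: A_def B_def algebra_simps)
  also have "\<dots> \<le> fact N * exp (A + B\<^sup>2 / (2 * r\<^sup>2) - t)"
  proof -
    have "0 \<le> (r * t - B / r)\<^sup>2 / 2" by simp
    also have "\<dots> = (r * t)\<^sup>2 / 2 - B * t + B\<^sup>2 / (2 * r\<^sup>2)"
      using r by (simp add: power2_eq_square field_simps)
    finally show ?thesis by simp
  qed
  also have "\<dots> = (fact N * exp (A + B\<^sup>2 / (2 * r\<^sup>2))) * exp (- t)" by (simp add: exp_diff exp_minus inverse_eq_divide)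
  finally show "norm (herm_ray (of_real r * d60) c x N t)
     \<le> (fact N * exp (c\<^sup>2 + (2 * \<bar>x\<bar> + 1) * \<bar>c\<bar> + (\<bar>c\<bar> * r + 2 * \<bar>x\<bar> * r + r + 1)\<^sup>2 / (2 * r\<^sup>2))) * exp (- t)"
    unfolding A_def B_def .
qed

lemma continuous_herm_ray: "continuous_on A (herm_ray D c x N)"
  unfolding herm_ray_def by (intro continuous_intros)

lemma herm_ray_integrable:
  assumes "r > 0"
  shows "set_integrable lborel {0..} (herm_ray (of_real r * d60) c x N)"
proof -
  obtain C where "\<And>t. t \<ge> 0 \<Longrightarrow> norm (herm_ray (of_real r * d60) c x N t) \<le> C * exp (- t)"
    using herm_ray_bound[OF assms] by metis
  then show ?thesis
    by (intro set_integrable_Ici_exp_bound(1)[where C=C] set_borel_measurable_Ici_continuous continuous_herm_ray)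
qed

text \<open>The ray starts on the real axis; since the integrand is real there, the imaginary part does not depend on \<open>c\<close>.\<close>
definition herm_int :: "real \<Rightarrow> real \<Rightarrow> real \<Rightarrow> nat \<Rightarrow> real" where
  "herm_int r c x N = Im (of_real r * d60 * (LINT t:{0..}|lborel. herm_ray (of_real r * d60) c x N t))"

text \<open>Integrates the derivative of \<open>s ^ N * exp (s\<^sup>2 - 2 x s)\<close> along the
  ray. The boundary term at the start is real and drops out of the imaginary part; what remains is
  the recurrence of \<open>herm\<close>. For \<open>N = 0\<close> the truncated index
  \<open>N - 1\<close> is multiplied by 0.\<close>

lemma herm_int_rec:
  assumes r: "r > 0"
  shows "herm_int r c x (Suc N) = x * herm_int r c x N - real N / 2 * herm_int r c x (N - 1)"
proof -
  let ?D = "of_real r * d60"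
  let ?h = "herm_ray ?D c x"
  define f where "f t = ?D * (of_nat N * ?h (N - 1) t + 2 * ?h (Suc N) t - 2 * of_real x * ?h N t)" for t
  note ii = herm_ray_integrable[OF r]
  have i0: "set_integrable lborel {0..} (\<lambda>t. of_nat N * ?h (N - 1) t + 2 * ?h (Suc N) t)"
    by (intro set_integral_add(1) set_integrable_mult_right ii)
  have i1: "set_integrable lborel {0..} (\<lambda>t. of_nat N * ?h (N - 1) t + 2 * ?h (Suc N) t - 2 * of_real x * ?h N t)"
    by (intro set_integral_diff(1) i0 set_integrable_mult_right ii)
  have D: "(?h N has_vector_derivative f t) (at t)" for t
  proof -
    have s: "((\<lambda>t. of_real c + ?D * of_real t) has_vector_derivative ?D) (at t)"
      by (auto intro!: derivative_eq_intros)
    have "((\<lambda>s. s ^ N * exp (s\<^sup>2 - 2 * of_real x * s)) has_field_derivative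
       (of_nat N * s ^ (N - 1) + 2 * s ^ Suc N - 2 * of_real x * s ^ N) * exp (s\<^sup>2 - 2 * of_real x * s)) (at s)" for s
      by (auto intro!: derivative_eq_intros simp: algebra_simps)
    note ch = field_vector_diff_chain_at[OF s this]
    have e: "?h N = (\<lambda>s. s ^ N * exp (s\<^sup>2 - 2 * of_real x * s)) \<circ> (\<lambda>t. of_real c + ?D * of_real t)"
      by (simp add: fun_eq_iff herm_ray_def)
    show ?thesis unfolding e
      by (rule has_vector_derivative_eq_rhs[OF ch]) (simp add: f_def herm_ray_def algebra_simps)
  qed
  have "((\<lambda>R. ?h N R - ?h N 0) \<longlongrightarrow> (LINT t:{0..}|lborel. f t)) at_top"
  proof (rule tendsto_integral_Ici_FTC)
    show "set_integrable lborel {0..} f" unfolding f_def by (intro set_integrable_mult_right i1)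
    show "continuous_on {0..} f" unfolding f_def by (intro continuous_intros continuous_herm_ray)
  qed (rule has_vector_derivative_at_within[OF D])
  moreover have "((\<lambda>R. ?h N R - ?h N 0) \<longlongrightarrow> 0 - ?h N 0) at_top"
  proof (intro tendsto_diff tendsto_const)
    obtain C where C: "\<And>t. t \<ge> 0 \<Longrightarrow> norm (?h N t) \<le> C * exp (- t)"
      using herm_ray_bound[OF r] by metis
    have "((\<lambda>t. C * exp (- t)) \<longlongrightarrow> 0) at_top" by real_asymp
    then show "(?h N \<longlongrightarrow> 0) at_top"
      by (rule Lim_null_comparison[rotated]) (auto intro: eventually_mono[OF eventually_ge_at_top[of 0]] C)
  qed
  ultimately have "(LINT t:{0..}|lborel. f t) = - ?h N 0"
    using tendsto_unique[OF trivial_limit_at_top_linorder] by force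
  moreover have "?h N 0 = of_real (c ^ N * exp (c\<^sup>2 - 2 * x * c))"
    by (simp add: herm_ray_def exp_of_real[symmetric] del: exp_of_real)
  ultimately have "Im (LINT t:{0..}|lborel. f t) = 0" by simp
  also have "(LINT t:{0..}|lborel. f t) = of_nat N * (?D * (LINT t:{0..}|lborel. ?h (N - 1) t))
     + 2 * (?D * (LINT t:{0..}|lborel. ?h (Suc N) t)) - of_real (2 * x) * (?D * (LINT t:{0..}|lborel. ?h N t))"
    unfolding f_def set_integral_mult_right set_integral_diff(2)[OF i0 set_integrable_mult_right[OF ii]]
      set_integral_add(2)[OF set_integrable_mult_right[OF ii] set_integrable_mult_right[OF ii]]
    by (simp add: algebra_simps)
  finally have "real N * herm_int r c x (N - 1) + 2 * herm_int r c x (Suc N) - (2 * x) * herm_int r c x N = 0"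
    unfolding herm_int_def by (simp only: minus_complex.sel plus_complex.sel) simp
  then show ?thesis by simp
qed

text \<open>Pulling out the real factor \<open>exp (y\<^sup>2 - x\<^sup>2)\<close> with
  \<open>y = x - c\<close> moves the start of the ray to 0. The ray can then be rotated to the
  imaginary axis, where the imaginary part becomes the Gaussian cosine integral.\<close>

lemma herm_int_0:
  assumes r: "r > 0"
  shows "herm_int r c x 0 = sqrt pi / 2 * exp (- x\<^sup>2)"
proof -
  define y where "y = x - c"
  define f where "f w = exp (w\<^sup>2 - 2 * of_real y * w)" for w :: complex
  let ?D = "of_real r * d60"
  \<comment> \<open>A lower bound for \<open>Im p\<close> on the chord from \<open>\<i>\<close> to
    \<open>r * d60\<close>. There also \<open>3 * (Re p)\<^sup>2 \<le> (Im p)\<^sup>2\<close>,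
    whence the decay rate \<open>2 / 3 * m\<^sup>2\<close>.\<close>
  define m where "m = min 1 (r * (sqrt 3 / 2))"
  have m: "m > 0" using r by (simp add: m_def)
  have fD: "f (?D * of_real t) = herm_ray ?D 0 y 0 t" for t by (simp add: f_def herm_ray_def)
  have fi: "f (\<i> * of_real t) = of_real (exp (- t\<^sup>2)) * cis (- (2 * y * t))" for t
  proof -
    have "(\<i> * of_real t)\<^sup>2 - 2 * of_real y * (\<i> * of_real t) = of_real (- t\<^sup>2) + \<i> * of_real (- (2 * y * t))"
      by (simp add: power_mult_distrib)
    then show ?thesis unfolding f_def by (simp only: exp_add exp_of_real cis_conv_exp)
  qed
  have ii: "set_integrable lborel {0..} (\<lambda>t. f (\<i> * of_real t))"
  proof (rule set_integrable_Ici_exp_bound(1)[where C="exp 1"])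
    show "set_borel_measurable lborel {0..} (\<lambda>t. f (\<i> * of_real t))"
      unfolding f_def by (intro set_borel_measurable_Ici_continuous continuous_intros)
    fix t :: real
    have "- t\<^sup>2 \<le> 1 - t" using zero_le_power2[of "t - 1/2"] by (simp add: power2_eq_square algebra_simps)
    then have "exp (- t\<^sup>2) \<le> exp (1 - t)" by simp
    then show "norm (f (\<i> * of_real t)) \<le> exp 1 * exp (- t)"
      by (simp add: fi norm_mult exp_diff exp_minus norm_divide inverse_eq_divide)
  qed
  have rot: "\<i> * (LINT t:{0..}|lborel. f (\<i> * of_real t)) = ?D * (LINT t:{0..}|lborel. f (?D * of_real t))"
  proof (rule ray_rotation)
    show "f holomorphic_on UNIV" unfolding f_def by (intro holomorphic_intros)
    show "set_integrable lborel {0..} (\<lambda>t. f (?D * of_real t))"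
      unfolding fD by (rule herm_ray_integrable[OF r])
    show "((\<lambda>R. R * exp (2 * \<bar>y\<bar> * (1 + r) * R - 2 / 3 * m\<^sup>2 * R\<^sup>2)) \<longlongrightarrow> 0) at_top" using m by real_asymp
    fix R :: real and p assume R: "R \<ge> 0" and p: "p \<in> closed_segment \<i> ?D"
    then obtain u where u: "0 \<le> u" "u \<le> 1" "p = (1 - u) *\<^sub>R \<i> + u *\<^sub>R ?D" by (auto simp: in_segment)
    have Re: "Re p = u * r / 2" and Im: "Im p = (1 - u) + u * (r * (sqrt 3 / 2))" using u by (simp_all add: d60_def)
    have "m \<le> (1 - u) * m + u * m" by (simp add: algebra_simps)
    also have "\<dots> \<le> (1 - u) * 1 + u * (r * (sqrt 3 / 2))" using u by (intro add_mono mult_left_mono) (auto simp: m_def)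
    finally have Im1: "Im p \<ge> m" by (simp add: Im)
    then have Im2: "m\<^sup>2 \<le> (Im p)\<^sup>2" using m by (intro power_mono) auto
    have "sqrt 3 * Re p \<le> Im p" unfolding Re Im using u(2) by (simp add: mult_ac)
    moreover have "0 \<le> sqrt 3 * Re p" unfolding Re using u r by simp
    ultimately have "(sqrt 3 * Re p)\<^sup>2 \<le> (Im p)\<^sup>2" by (rule power_mono)
    then have Re2: "3 * (Re p)\<^sup>2 \<le> (Im p)\<^sup>2" by (simp add: power_mult_distrib)
    have "Re (p\<^sup>2) = (Re p)\<^sup>2 - (Im p)\<^sup>2" by (simp add: power2_eq_square)
    then have p2: "Re (p\<^sup>2) \<le> - (2 / 3 * m\<^sup>2)" using Re2 Im2 by simp
    have "norm p \<le> norm ((1 - u) *\<^sub>R \<i>) + norm (u *\<^sub>R ?D)" unfolding u(3) by (rule norm_triangle_ineq)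
    also have "\<dots> \<le> 1 + 1 * r" using u r by (intro add_mono) (simp_all add: norm_mult d60_pow mult_right_mono)
    finally have np: "norm p \<le> 1 + r" by simp
    have "Re ((of_real R * p)\<^sup>2) = R\<^sup>2 * Re (p\<^sup>2)" by (simp add: power_mult_distrib flip: of_real_power)
    also have "\<dots> \<le> R\<^sup>2 * (- (2 / 3 * m\<^sup>2))" by (rule mult_left_mono[OF p2]) auto
    finally have 1: "Re ((of_real R * p)\<^sup>2) \<le> - (2 / 3 * m\<^sup>2 * R\<^sup>2)" by (simp add: mult_ac)
    have "Re (- (2 * of_real y * (of_real R * p))) \<le> norm (- (2 * of_real y * (of_real R * p)))" by (rule complex_Re_le_cmod)
    also have "\<dots> = 2 * \<bar>y\<bar> * R * norm p" using R by (simp add: norm_mult)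
    also have "\<dots> \<le> 2 * \<bar>y\<bar> * R * (1 + r)" using R by (intro mult_left_mono np) auto
    finally have "Re ((of_real R * p)\<^sup>2 - 2 * of_real y * (of_real R * p)) \<le> 2 * \<bar>y\<bar> * (1 + r) * R - 2 / 3 * m\<^sup>2 * R\<^sup>2"
      using 1 by (simp add: mult_ac)
    then show "norm (f (of_real R * p)) \<le> exp (2 * \<bar>y\<bar> * (1 + r) * R - 2 / 3 * m\<^sup>2 * R\<^sup>2)"
      by (simp add: f_def)
  qed (rule ii)
  have hr: "herm_ray ?D c x 0 t = of_real (exp (y\<^sup>2 - x\<^sup>2)) * f (?D * of_real t)" for t
  proof -
    have "(of_real c + ?D * of_real t)\<^sup>2 - 2 * of_real x * (of_real c + ?D * of_real t)
       = of_real (y\<^sup>2 - x\<^sup>2) + ((?D * of_real t)\<^sup>2 - 2 * of_real y * (?D * of_real t))"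
      by (simp add: y_def power2_eq_square algebra_simps)
    then show ?thesis unfolding herm_ray_def f_def power_0 mult_1 by (simp only: exp_add exp_of_real)
  qed
  have L: "(LINT t:{0..}|lborel. herm_ray ?D c x 0 t) = of_real (exp (y\<^sup>2 - x\<^sup>2)) * (LINT t:{0..}|lborel. f (?D * of_real t))"
    by (simp only: hr set_integral_mult_right)
  have "herm_int r c x 0 = Im (of_real (exp (y\<^sup>2 - x\<^sup>2)) * (?D * (LINT t:{0..}|lborel. f (?D * of_real t))))"
    unfolding herm_int_def L mult.left_commute[of ?D] ..
  also have "\<dots> = exp (y\<^sup>2 - x\<^sup>2) * Re (LINT t:{0..}|lborel. f (\<i> * of_real t))"
    unfolding rot[symmetric] by simp
  also have "Re (LINT t:{0..}|lborel. f (\<i> * of_real t)) = (LINT t:{0..}|lborel. Re (f (\<i> * of_real t)))"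
    using integral_Re[OF ii[unfolded set_integrable_def]] unfolding set_lebesgue_integral_def scaleR_complex.sel by simp
  also have "(\<lambda>t. Re (f (\<i> * of_real t))) = (\<lambda>t. exp (- t\<^sup>2) * cos (2 * y * t))" by (simp add: fi fun_eq_iff)
  also have "exp (y\<^sup>2 - x\<^sup>2) * (LINT t:{0..}|lborel. exp (- t\<^sup>2) * cos (2 * y * t)) = sqrt pi / 2 * exp (- x\<^sup>2)"
    unfolding gaussian_cos_integral by (simp add: exp_diff exp_minus field_simps)
  finally show ?thesis .
qed

lemma herm_eq_herm_int:
  assumes r: "r > 0"
  shows "sqrt pi / 2 * exp (- x\<^sup>2) * herm N x = herm_int r c x N"
proof (induction N rule: less_induct)
  case (less N)
  consider "N = 0" | "N = 1" | m where "N = Suc (Suc m)" by (metis One_nat_def not0_implies_Suc)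
  then show ?case
  proof cases
    case 3
    have "sqrt pi / 2 * exp (- x\<^sup>2) * herm N x =
       x * (sqrt pi / 2 * exp (- x\<^sup>2) * herm (Suc m) x) - real (Suc m) / 2 * (sqrt pi / 2 * exp (- x\<^sup>2) * herm m x)"
      unfolding 3 herm.simps by (simp only: right_diff_distrib mult_ac)
    also have "\<dots> = x * herm_int r c x (Suc m) - real (Suc m) / 2 * herm_int r c x m"
      using less[of m] less[of "Suc m"] 3 by simp
    also have "\<dots> = herm_int r c x N" unfolding 3 herm_int_rec[OF r, of c x "Suc m"] by simp
    finally show ?thesis .
  qed (use herm_int_0[OF r] herm_int_rec[OF r, of c x 0] in auto)
qed

lemma norm_one_plus_ge:
  fixes w :: complex assumes "Re w \<ge> 0" shows "norm (1 + w) \<ge> 1"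
  using complex_Re_le_cmod[of "1 + w"] assms by simp

text \<open>The derivative of \<open>G\<close> is \<open>w\<^sup>2 / (1 + w)\<close>. Subtracting
  one or two terms of its geometric expansion leaves a higher power of \<open>w\<close> divided by
  \<open>1 + w\<close>, and \<open>norm (1 + w) \<ge> 1\<close> on the right half-plane. The
  estimate thus reaches along the whole ray.\<close>

lemma herm_log_phase:
  fixes w0 :: complex
  assumes "Re w0 \<ge> 0"
  defines "G \<equiv> \<lambda>w. Ln (1 + w) - w + w\<^sup>2 / 2"
  shows "norm (G w0 - w0 ^ 3 / 3) \<le> norm w0 ^ 4" and "norm (G w0 - w0 ^ 3 / 3 + w0 ^ 4 / 4) \<le> norm w0 ^ 5"
proof -
  let ?S = "closed_segment 0 w0"
  have S: "Re w \<ge> 0 \<and> norm w \<le> norm w0" if w: "w \<in> ?S" for w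
  proof -
    obtain u where u: "0 \<le> u" "u \<le> 1" "w = (1 - u) *\<^sub>R 0 + u *\<^sub>R w0"
      using w unfolding in_segment by blast
    have "w = of_real u * w0" unfolding u(3) by (simp only: scaleR_zero_right mult_zero_right add_0_left scaleR_conv_of_real)
    then have "norm w = u * norm w0" "Re w = u * Re w0" using u(1) by (simp_all add: norm_mult)
    moreover have "u * norm w0 \<le> 1 * norm w0" by (rule mult_right_mono) (use u in auto)
    moreover have "0 \<le> u * Re w0" by (rule mult_nonneg_nonneg[OF u(1) assms(1)])
    ultimately show ?thesis by linarith
  qed
  have nz: "1 + w \<noteq> 0" if "w \<in> ?S" for w using S[OF that] by (auto simp: complex_eq_iff)
  have D: "(G has_field_derivative 1 / (1 + w) - 1 + w) (at w within ?S)" if "w \<in> ?S" for w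
  proof -
    have "1 + w \<notin> \<real>\<^sub>\<le>\<^sub>0" using S[OF that] by (auto simp: complex_nonpos_Reals_iff)
    then show ?thesis unfolding G_def by (auto intro!: derivative_eq_intros simp: inverse_eq_divide)
  qed
  have G0: "G 0 = 0" by (simp add: G_def)
  have "norm ((G w0 - w0 ^ 3 / 3) - (G 0 - 0 ^ 3 / 3)) \<le> norm w0 ^ 3 * norm (w0 - 0)"
  proof (rule field_differentiable_bound[where S = ?S])
    fix w assume w: "w \<in> ?S"
    show "((\<lambda>w. G w - w ^ 3 / 3) has_field_derivative 1 / (1 + w) - 1 + w - w\<^sup>2) (at w within ?S)"
      by (auto intro!: derivative_eq_intros D[OF w])
    have "1 / (1 + w) - 1 + w - w\<^sup>2 = - (w ^ 3) / (1 + w)"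
      using nz[OF w] by (simp add: divide_simps) (simp add: power2_eq_square power3_eq_cube algebra_simps)
    then have "norm (1 / (1 + w) - 1 + w - w\<^sup>2) = norm w ^ 3 / norm (1 + w)" by (simp add: norm_divide norm_power)
    also have "\<dots> \<le> norm w ^ 3 / 1"
      using S[OF w] norm_one_plus_ge[of w] by (intro divide_left_mono) (auto intro: less_le_trans[OF zero_less_one])
    also have "\<dots> \<le> norm w0 ^ 3" using S[OF w] by (simp add: power_mono)
    finally show "norm (1 / (1 + w) - 1 + w - w\<^sup>2) \<le> norm w0 ^ 3" .
  qed auto
  then show "norm (G w0 - w0 ^ 3 / 3) \<le> norm w0 ^ 4" by (simp add: G0 eval_nat_numeral mult_ac)
  have "norm ((G w0 - w0 ^ 3 / 3 + w0 ^ 4 / 4) - (G 0 - 0 ^ 3 / 3 + 0 ^ 4 / 4)) \<le> norm w0 ^ 4 * norm (w0 - 0)"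
  proof (rule field_differentiable_bound[where S = ?S])
    fix w assume w: "w \<in> ?S"
    show "((\<lambda>w. G w - w ^ 3 / 3 + w ^ 4 / 4) has_field_derivative 1 / (1 + w) - 1 + w - w\<^sup>2 + w ^ 3) (at w within ?S)"
      by (auto intro!: derivative_eq_intros D[OF w])
    have "1 / (1 + w) - 1 + w - w\<^sup>2 + w ^ 3 = w ^ 4 / (1 + w)"
      using nz[OF w] by (simp add: divide_simps) (simp add: eval_nat_numeral algebra_simps)
    then have "norm (1 / (1 + w) - 1 + w - w\<^sup>2 + w ^ 3) = norm w ^ 4 / norm (1 + w)" by (simp add: norm_divide norm_power)
    also have "\<dots> \<le> norm w ^ 4 / 1"
      using S[OF w] norm_one_plus_ge[of w] by (intro divide_left_mono) (auto intro: less_le_trans[OF zero_less_one])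
    also have "\<dots> \<le> norm w0 ^ 4" using S[OF w] by (simp add: power_mono)
    finally show "norm (1 / (1 + w) - 1 + w - w\<^sup>2 + w ^ 3) \<le> norm w0 ^ 4" .
  qed auto
  then show "norm (G w0 - w0 ^ 3 / 3 + w0 ^ 4 / 4) \<le> norm w0 ^ 5" by (simp add: G0 eval_nat_numeral mult_ac)
qed

text \<open>The left side is the real part of \<open>Ln (1 + w) - w + w\<^sup>2 / 2\<close> at
  \<open>w = u * d60\<close>. It behaves like \<open>- u ^ 3 / 3\<close> near 0 and like
  \<open>- u\<^sup>2 / 4\<close> at infinity; the right side has the same cubic and quadratic
  regimes.\<close>

lemma herm_ln_phase_le:
  assumes "(u::real) \<ge> 0"
  shows "ln (1 + u + u\<^sup>2) / 2 - u / 2 - u\<^sup>2 / 4 \<le> - (u ^ 3 / (4 * (1 + u)))"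
proof -
  define L where "L = (\<lambda>u::real. ln (1 + u + u\<^sup>2))"
  define p where "p = (\<lambda>u::real. 1 / 2 * L u - u / 2 - u\<^sup>2 / 4 + u ^ 3 / (4 * (1 + u)))"
  have "p u \<le> p 0"
  proof (rule DERIV_nonpos_imp_nonincreasing[OF assms])
    fix x :: real assume x: "0 \<le> x" "x \<le> u"
    have q: "1 + x + x\<^sup>2 > 0" using x by (simp add: add_pos_nonneg)
    define q' where "q' = (1 + 2 * x) / (1 + x + x\<^sup>2)"
    have DL: "(L has_real_derivative q') (at x)"
      unfolding L_def q'_def using q by (auto intro!: derivative_eq_intros)
    have "(p has_real_derivative 1 / 2 * q' - 1 / 2 - x / 2
        + (3 * x\<^sup>2 * (4 * (1 + x)) - x ^ 3 * 4) / (4 * (1 + x))\<^sup>2) (at x)"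
      unfolding p_def using x by (auto intro!: derivative_eq_intros DL simp: power2_eq_square)
    moreover have "1 / 2 * q' - 1 / 2 - x / 2
        + (3 * x\<^sup>2 * (4 * (1 + x)) - x ^ 3 * 4) / (4 * (1 + x))\<^sup>2 \<le> 0"
    proof -
      have a: "1 / 2 * q' - 1 / 2 - x / 2 = - (x\<^sup>2 * (1 + x / 2)) / (1 + x + x\<^sup>2)"
        unfolding q'_def using q by (simp add: divide_simps) (simp add: power2_eq_square algebra_simps)
      have b: "(3 * x\<^sup>2 * (4 * (1 + x)) - x ^ 3 * 4) / (4 * (1 + x))\<^sup>2 = x\<^sup>2 * ((3 + 2 * x) / 4) / (1 + x)\<^sup>2"
        using x by (simp add: divide_simps) (simp add: power2_eq_square power3_eq_cube algebra_simps)
      have "x\<^sup>2 * ((3 + 2 * x) / 4) / (1 + x)\<^sup>2 \<le> x\<^sup>2 * (1 + x / 2) / (1 + x + x\<^sup>2)"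
        using x q by (intro frac_le mult_left_mono) (auto simp: power2_eq_square algebra_simps)
      then show ?thesis unfolding a b by (simp add: minus_divide_left[symmetric])
    qed
    ultimately show "\<exists>y. (p has_real_derivative y) (at x) \<and> y \<le> 0" by blast
  qed
  then show ?thesis by (simp add: p_def L_def)
qed

text \<open>Moving the starting point of the ray to the double saddle point \<open>c = sqrt (N/2)\<close> and writing
  \<open>p = c (1 + w)\<close> cancels the linear and quadratic terms of \<open>N ln (1 + w)\<close>, leaving \<open>w\<^sup>3/3 - w\<^sup>4/4 + \<dots>\<close>.\<close>
definition herm_kernel :: "nat \<Rightarrow> real \<Rightarrow> real \<Rightarrow> complex" where
  "herm_kernel N \<epsilon> t = (let w = of_real \<epsilon> * d60 * of_real t in (1 + w) ^ N * exp (of_nat N * (w\<^sup>2 / 2 - w)))"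

text \<open>With \<open>N \<epsilon> ^ 3 = 1\<close> and \<open>w = \<epsilon> p\<close>, the term
  \<open>N w ^ 3 / 3\<close> is exactly \<open>p ^ 3 / 3\<close>, while \<open>N w ^ 4\<close> and
  \<open>N w ^ 5\<close> carry \<open>\<epsilon>\<close> and \<open>\<epsilon>\<^sup>2\<close>. The
  sign \<open>-1\<close> is that of \<open>w ^ 4 / 4\<close> in the logarithm.\<close>

lemma herm_kernel_airy:
  assumes N: "N > 0" and \<epsilon>: "\<epsilon> > 0" "real N * \<epsilon> ^ 3 = 1"
  shows "airy_kernel (-1) d60 \<epsilon> (herm_kernel N \<epsilon>)"
proof -
  \<comment> \<open>Gives \<open>\<epsilon> * t \<le> t\<close>, so that the decay bound takes the
    form \<open>t ^ 3 / (4 * (1 + t))\<close> uniformly in \<open>N\<close>.\<close>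
  have e1: "\<epsilon> \<le> 1"
  proof (rule ccontr)
    assume "\<not> \<epsilon> \<le> 1"
    then have "1 < \<epsilon> ^ 3" by (intro one_less_power) auto
    moreover have "1 * \<epsilon> ^ 3 \<le> real N * \<epsilon> ^ 3" by (rule mult_right_mono) (use N \<epsilon> in auto)
    ultimately show False using \<epsilon> by simp
  qed
  have Nw: "of_nat N * of_real \<epsilon> ^ 3 = (1::complex)"
    using \<epsilon>(2) by (metis of_real_1 of_real_mult of_real_of_nat_eq of_real_power)
  have *: "norm (herm_kernel N \<epsilon> t - airy_exp d60 t) \<le> 10 ^ 9 * \<epsilon> * exp (3 * t - t\<^sup>2 / 4) \<and>
       norm (herm_kernel N \<epsilon> t - airy_exp d60 t - of_real ((-1) * \<epsilon> / 4) * (d60 * of_real t) ^ 4 * airy_exp d60 t)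
         \<le> 10 ^ 9 * \<epsilon>\<^sup>2 * exp (3 * t - t\<^sup>2 / 4)" if t: "t \<ge> 0" for t
  proof -
    define u where "u = \<epsilon> * t"
    define w where "w = of_real u * d60"
    define D where "D = d60 * of_real t"
    have u: "u \<ge> 0" using t \<epsilon> by (simp add: u_def)
    have wD: "w = of_real \<epsilon> * D" by (simp add: w_def D_def u_def mult_ac)
    have Rew: "Re w \<ge> 0" using u by (simp add: w_def d60_def)
    define G where "G = Ln (1 + w) - w + w\<^sup>2 / 2"
    define a where "a = of_nat N * G"
    have nz: "1 + w \<noteq> 0" using norm_one_plus_ge[OF Rew] by auto
    have "exp a = (exp (Ln (1 + w))) ^ N * exp (of_nat N * (w\<^sup>2 / 2 - w))"
      unfolding exp_of_nat_mult[symmetric] exp_add[symmetric] a_def G_def by (simp add: algebra_simps)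
    then have ea: "exp a = herm_kernel N \<epsilon> t"
      using nz by (simp add: herm_kernel_def w_def u_def Let_def mult_ac)
    have w3: "of_nat N * w ^ 3 = D ^ 3"
    proof -
      have "of_nat N * w ^ 3 = (of_nat N * of_real \<epsilon> ^ 3) * D ^ 3"
        unfolding wD power_mult_distrib by (simp only: mult.assoc)
      then show ?thesis unfolding Nw by simp
    qed
    have w4: "of_nat N * w ^ 4 = of_real \<epsilon> * D ^ 4"
    proof -
      have "of_nat N * w ^ 4 = (of_nat N * w ^ 3) * w" by (simp add: eval_nat_numeral mult_ac)
      also have "\<dots> = D ^ 3 * w" unfolding w3 ..
      finally show ?thesis by (simp add: wD eval_nat_numeral mult_ac)
    qed
    have n3: "real N * norm w ^ 3 = norm D ^ 3"
      using arg_cong[OF w3, of norm] by (simp add: norm_mult norm_power)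
    have nw: "norm w = \<epsilon> * norm D" using \<epsilon> by (simp add: wD norm_mult)
    have n4: "real N * norm w ^ 4 = \<epsilon> * norm D ^ 4"
    proof -
      have "real N * norm w ^ 4 = (real N * norm w ^ 3) * norm w" by (simp add: eval_nat_numeral mult_ac)
      also have "\<dots> = norm D ^ 3 * norm w" unfolding n3 ..
      finally show ?thesis by (simp add: nw eval_nat_numeral mult_ac)
    qed
    have n5: "real N * norm w ^ 5 = \<epsilon>\<^sup>2 * norm D ^ 5"
    proof -
      have "real N * norm w ^ 5 = (real N * norm w ^ 3) * norm w * norm w" by (simp add: eval_nat_numeral mult_ac)
      also have "\<dots> = norm D ^ 3 * norm w * norm w" unfolding n3 ..
      finally show ?thesis by (simp add: nw eval_nat_numeral mult_ac)
    qed
    have "a - D ^ 3 / 3 = of_nat N * (G - w ^ 3 / 3)" by (simp add: a_def w3[symmetric] algebra_simps)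
    then have "norm (a - D ^ 3 / 3) = real N * norm (G - w ^ 3 / 3)" by (simp add: norm_mult)
    also have "\<dots> \<le> real N * norm w ^ 4" unfolding G_def by (intro mult_left_mono herm_log_phase Rew) auto
    finally have "norm (a - D ^ 3 / 3) \<le> \<epsilon> * norm D ^ 4" unfolding n4 .
    moreover have "0 \<le> \<epsilon> * norm D ^ 4" using \<epsilon> by simp
    ultimately have r1: "norm (a - D ^ 3 / 3) \<le> 4 * \<epsilon> * norm D ^ 4" by linarith
    have "a - D ^ 3 / 3 - of_real ((-1) * \<epsilon> / 4) * D ^ 4 = of_nat N * (G - w ^ 3 / 3 + w ^ 4 / 4)"
    proof -
      have "a - D ^ 3 / 3 - of_real ((-1) * \<epsilon> / 4) * D ^ 4 = a - D ^ 3 / 3 + (of_real \<epsilon> * D ^ 4) / 4" by simp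
      then show ?thesis unfolding w4[symmetric] w3[symmetric] a_def by (simp add: algebra_simps)
    qed
    then have "norm (a - D ^ 3 / 3 - of_real ((-1) * \<epsilon> / 4) * D ^ 4) = real N * norm (G - w ^ 3 / 3 + w ^ 4 / 4)" by (simp add: norm_mult)
    also have "\<dots> \<le> real N * norm w ^ 5" unfolding G_def by (intro mult_left_mono herm_log_phase Rew) auto
    finally have "norm (a - D ^ 3 / 3 - of_real ((-1) * \<epsilon> / 4) * D ^ 4) \<le> \<epsilon>\<^sup>2 * norm D ^ 5" unfolding n5 .
    moreover have "0 \<le> \<epsilon>\<^sup>2 * norm D ^ 5" by simp
    ultimately have r2: "norm (a - D ^ 3 / 3 - of_real ((-1) * \<epsilon> / 4) * D ^ 4) \<le> 4 * \<epsilon>\<^sup>2 * norm D ^ 5" by linarith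
    have "norm (1 + w) = sqrt (1 + u + u\<^sup>2)"
      by (simp add: w_def d60_def cmod_def power2_eq_square algebra_simps)
    then have "Re G = ln (1 + u + u\<^sup>2) / 2 - u / 2 - u\<^sup>2 / 4"
      using nz u d60_pow(1) by (simp add: G_def Re_Ln ln_sqrt w_def power_mult_distrib add_pos_nonneg) (simp add: d60_def)
    also have "\<dots> \<le> - (u ^ 3 / (4 * (1 + u)))" by (rule herm_ln_phase_le[OF u])
    finally have "real N * Re G \<le> real N * (- (u ^ 3 / (4 * (1 + u))))" by (intro mult_left_mono) auto
    also have "\<dots> = - ((real N * \<epsilon> ^ 3) * t ^ 3 / (4 * (1 + u)))" by (simp add: u_def power_mult_distrib)
    also have "\<dots> \<le> - (t ^ 3 / (4 * (1 + t)))"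
    proof -
      have "u \<le> t" using mult_right_mono[OF e1 t] by (simp add: u_def)
      then have "t ^ 3 / (4 * (1 + t)) \<le> t ^ 3 / (4 * (1 + u))"
        using t u by (intro divide_left_mono mult_pos_pos) auto
      then show ?thesis unfolding \<epsilon>(2) by simp
    qed
    also have "\<dots> \<le> t / 2 - t\<^sup>2 / 4"
    proof -
      have "(t\<^sup>2 / 4 - t / 2) * (4 * (1 + t)) \<le> t ^ 3"
        using t by (simp add: power2_eq_square power3_eq_cube algebra_simps)
      then have "t\<^sup>2 / 4 - t / 2 \<le> t ^ 3 / (4 * (1 + t))" using t by (subst pos_le_divide_eq) auto
      then show ?thesis by simp
    qed
    finally have Rea: "Re a \<le> t / 2 - t\<^sup>2 / 4" by (simp add: a_def)
    show ?thesis unfolding ea[symmetric]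
      using phase_estimate[OF \<epsilon>(1) _ _ t r1[unfolded D_def] r2[unfolded D_def] Rea] by (simp add: d60_pow)
  qed
  have "continuous_on {0..} (herm_kernel N \<epsilon>)"
    unfolding herm_kernel_def Let_def by (intro continuous_intros) auto
  then show ?thesis unfolding airy_kernel_def using * set_borel_measurable_Ici_continuous by blast
qed

lemma airy_kernel_integrable:
  assumes k: "airy_kernel \<sigma> d \<epsilon> F" and d: "d = d60 \<or> d = d45" and \<epsilon>: "0 < \<epsilon>"
  shows "set_integrable lborel {0..} (\<lambda>t. d * (- (d * of_real t)) ^ j * exp (- (of_real z * (d * of_real t))) * F t)"
proof (rule airy_ray_integrable(1)[where K="10 ^ 9 * \<epsilon> + 1"])
  have s2: "sqrt 2 \<le> 2" using real_sqrt_le_iff[of 2 4] by simp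
  have d3: "Re (d ^ 3) \<le> -1" using d by (auto simp: d45_pow d60_pow)
  show "norm d \<le> 2" using d s2 by (auto simp: d45_pow d60_pow)
  show "set_borel_measurable lborel {0..} F" using k by (simp add: airy_kernel_def)
  fix t :: real assume t: "t \<ge> 0"
  have "norm (F t) \<le> norm (F t - airy_exp d t) + norm (airy_exp d t)" using norm_triangle_sub by (simp add: add.commute)
  also have "\<dots> \<le> 10 ^ 9 * \<epsilon> * exp (3 * t - t\<^sup>2 / 4) + 1 * exp (3 * t - t\<^sup>2 / 4)"
    using k norm_airy_exp_le(3)[OF d3 t] t by (intro add_mono) (auto simp: airy_kernel_def)
  finally show "norm (F t) \<le> (10 ^ 9 * \<epsilon> + 1) * exp (3 * t - t\<^sup>2 / 4)" by (simp add: algebra_simps)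
qed (use \<epsilon> in auto)

text \<open>The turning point is \<open>2 * c = sqrt (2 * N)\<close>, and the offset
  \<open>z / (2 * c * \<epsilon>)\<close> is scaled so that it contributes \<open>- z p\<close> to
  the exponent. Raising the degree inserts one factor \<open>s = c * (1 + \<epsilon> p)\<close>;
  since \<open>airy_ray\<close> with index 1 carries \<open>- p\<close>, the derivative term has a
  minus sign.\<close>

lemma herm_airy_ray:
  assumes N: "N > 0" and \<epsilon>: "\<epsilon> > 0" and N\<epsilon>: "real N * \<epsilon> ^ 3 = 1" and c: "c > 0" "c\<^sup>2 = real N / 2"
    and x: "x = 2 * c + z / (2 * c * \<epsilon>)"
  defines "A \<equiv> 2 * sqrt pi * c ^ (N + 1) * \<epsilon> * exp (x\<^sup>2 - 3 * c\<^sup>2 - z / \<epsilon>)"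
  shows "herm N x = A * airy_ray d60 (herm_kernel N \<epsilon>) 0 z"
    and "herm (Suc N) x = A * c * (airy_ray d60 (herm_kernel N \<epsilon>) 0 z - \<epsilon> * airy_ray d60 (herm_kernel N \<epsilon>) 1 z)"
proof -
  define r where "r = c * \<epsilon>"
  have r: "r > 0" using c \<epsilon> by (simp add: r_def)
  let ?D = "of_real r * d60"
  define g where "g j t = d60 * (- (d60 * of_real t)) ^ j * exp (- (of_real z * (d60 * of_real t))) * herm_kernel N \<epsilon> t" for j t
  define K where "K = exp (- 3 * c\<^sup>2 - z / \<epsilon>)"
  have expo: "(of_real c + ?D * of_real t)\<^sup>2 - 2 * of_real x * (of_real c + ?D * of_real t)
      = of_real (- 3 * c\<^sup>2 - z / \<epsilon>) + (of_nat N * (w\<^sup>2 / 2 - w) + - (of_real z * (d60 * of_real t)))"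
    if w: "w = of_real \<epsilon> * d60 * of_real t" for t w
  proof -
    have s: "of_real c + ?D * of_real t = of_real c * (1 + w)" by (simp add: w r_def algebra_simps)
    define \<zeta> :: complex where "\<zeta> = of_real (z / \<epsilon>)"
    have "2 * x * c = 4 * c\<^sup>2 + z / \<epsilon>" unfolding x using c \<epsilon> by (simp add: field_simps power2_eq_square)
    then have xc: "2 * of_real x * of_real c = 4 * of_real c ^ 2 + (of_real (z / \<epsilon>) :: complex)"
      by (metis of_real_add of_real_mult of_real_numeral of_real_power)
    have c2: "of_nat N = 2 * (of_real c ^ 2 :: complex)"
      using c(2) by (metis (no_types) of_real_mult of_real_numeral of_real_of_nat_eq of_real_power nonzero_mult_div_cancel_left times_divide_eq_right zero_neq_numeral)
    have zw: "of_real (z / \<epsilon>) * w = of_real z * (d60 * of_real t)" using \<epsilon> by (simp add: w)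
    have "(of_real c * (1 + w))\<^sup>2 - 2 * of_real x * (of_real c * (1 + w))
      = of_real c ^ 2 * (1 + w)\<^sup>2 - (2 * of_real x * of_real c) * (1 + w)" by (simp add: power_mult_distrib)
    also have "\<dots> = - 3 * of_real c ^ 2 - of_real (z / \<epsilon>) + (2 * of_real c ^ 2 * (w\<^sup>2 / 2 - w) - of_real (z / \<epsilon>) * w)"
      unfolding xc \<zeta>_def[symmetric] by (simp add: power2_eq_square algebra_simps)
    finally show ?thesis unfolding s c2 zw by simp
  qed
  have hr: "?D * herm_ray ?D c x M t = of_real (r * c ^ N * K) * (d60 * (of_real c + ?D * of_real t) ^ (M - N)
       * exp (- (of_real z * (d60 * of_real t))) * herm_kernel N \<epsilon> t)" if M: "M \<ge> N" for M t
  proof -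
    let ?w = "of_real \<epsilon> * d60 * of_real t"
    have s: "of_real c + ?D * of_real t = of_real c * (1 + ?w)" by (simp add: r_def algebra_simps)
    have p: "(of_real c + ?D * of_real t) ^ M = (of_real c + ?D * of_real t) ^ (M - N) * (of_real c ^ N * (1 + ?w) ^ N)"
      using M unfolding s power_mult_distrib[symmetric] power_add[symmetric] by simp
    have E: "exp ((of_real c + ?D * of_real t)\<^sup>2 - 2 * of_real x * (of_real c + ?D * of_real t))
      = of_real K * (exp (of_nat N * (?w\<^sup>2 / 2 - ?w)) * exp (- (of_real z * (d60 * of_real t))))"
      unfolding expo[OF refl] exp_add K_def exp_of_real ..
    show ?thesis unfolding herm_ray_def p E herm_kernel_def Let_def of_real_mult of_real_power
      by (simp only: mult_ac)
  qed
  have g0: "airy_ray d60 (herm_kernel N \<epsilon>) j z = Im (LINT t:{0..}|lborel. g j t) / pi" for j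
    unfolding airy_ray_def g_def ..
  have ig: "set_integrable lborel {0..} (g j)" for j
    unfolding g_def by (rule airy_kernel_integrable[OF herm_kernel_airy[OF N \<epsilon> N\<epsilon>]]) (use \<epsilon> in auto)
  have Ai: "Im (LINT t:{0..}|lborel. g j t) = pi * airy_ray d60 (herm_kernel N \<epsilon>) j z" for j
    unfolding g0 by simp
  have ImR: "Im (of_real a * w) = a * Im w" for a w by simp
  have A: "y = A * b" if "sqrt pi / 2 * exp (- x\<^sup>2) * y = (r * c ^ N * K) * (pi * b)" for y b
  proof -
    have "y = (sqrt pi / 2 * exp (- x\<^sup>2) * y) * (2 / sqrt pi * exp (x\<^sup>2))" by (simp add: exp_minus)
    also have "\<dots> = 2 * (pi / sqrt pi) * r * c ^ N * (exp (x\<^sup>2) * K) * b" unfolding that by (simp add: mult_ac)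
    also have "pi / sqrt pi = sqrt pi" by (simp add: real_div_sqrt)
    also have "exp (x\<^sup>2) * K = exp (x\<^sup>2 - 3 * c\<^sup>2 - z / \<epsilon>)" unfolding K_def exp_add[symmetric] by (simp add: algebra_simps)
    finally show ?thesis by (simp add: A_def r_def mult_ac)
  qed
  show "herm N x = A * airy_ray d60 (herm_kernel N \<epsilon>) 0 z"
  proof (rule A)
    have "?D * (LINT t:{0..}|lborel. herm_ray ?D c x N t) = of_real (r * c ^ N * K) * (LINT t:{0..}|lborel. g 0 t)"
      unfolding set_integral_mult_right[symmetric] hr[OF order_refl] g_def by simp
    then have "herm_int r c x N = (r * c ^ N * K) * Im (LINT t:{0..}|lborel. g 0 t)"
      unfolding herm_int_def by (simp only: ImR minus_complex.sel)
    then show "sqrt pi / 2 * exp (- x\<^sup>2) * herm N x = (r * c ^ N * K) * (pi * airy_ray d60 (herm_kernel N \<epsilon>) 0 z)"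
      unfolding herm_eq_herm_int[OF r, where c = c] Ai .
  qed
  have "herm (Suc N) x = A * (c * (airy_ray d60 (herm_kernel N \<epsilon>) 0 z - \<epsilon> * airy_ray d60 (herm_kernel N \<epsilon>) 1 z))"
  proof (rule A)
    have e1: "of_real (r * c ^ N * K) * (d60 * (of_real c + ?D * of_real t) ^ (Suc N - N)
       * exp (- (of_real z * (d60 * of_real t))) * herm_kernel N \<epsilon> t) = of_real (r * c ^ N * K * c) * (g 0 t - of_real \<epsilon> * g 1 t)" for t
      by (simp add: g_def r_def algebra_simps)
    have "?D * (LINT t:{0..}|lborel. herm_ray ?D c x (Suc N) t) = (LINT t:{0..}|lborel. of_real (r * c ^ N * K * c) * (g 0 t - of_real \<epsilon> * g 1 t))"
      unfolding set_integral_mult_right[symmetric] hr[OF le_SucI[OF order_refl]] e1 ..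
    also have "\<dots> = of_real (r * c ^ N * K * c) * ((LINT t:{0..}|lborel. g 0 t) - of_real \<epsilon> * (LINT t:{0..}|lborel. g 1 t))"
      unfolding set_integral_mult_right set_integral_diff(2)[OF ig set_integrable_mult_right[OF ig]] ..
    finally have "herm_int r c x (Suc N) = (r * c ^ N * K * c) * (Im (LINT t:{0..}|lborel. g 0 t) - \<epsilon> * Im (LINT t:{0..}|lborel. g 1 t))"
      unfolding herm_int_def by (simp only: ImR minus_complex.sel)
    then show "sqrt pi / 2 * exp (- x\<^sup>2) * herm (Suc N) x = (r * c ^ N * K) * (pi * (c * (airy_ray d60 (herm_kernel N \<epsilon>) 0 z - \<epsilon> * airy_ray d60 (herm_kernel N \<epsilon>) 1 z)))"
      unfolding herm_eq_herm_int[OF r, where c = c] Ai by (simp add: algebra_simps)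
  qed
  then show "herm (Suc N) x = A * c * (airy_ray d60 (herm_kernel N \<epsilon>) 0 z - \<epsilon> * airy_ray d60 (herm_kernel N \<epsilon>) 1 z)"
    by simp
qed

section \<open>The first zero of the Airy function\<close>

lemma field_derivative_airyD: "(airyD 0 has_real_derivative airyD 1 z) (at z)"
    "(airyD 1 has_real_derivative z * airyD 0 z) (at z)"
  using has_field_derivative_airyD[of 0 z] has_field_derivative_airyD[of 1 z] airyD_2[of z]
  by (simp_all add: numeral_2_eq_2)

lemma isCont_airyD: "isCont (airyD j) z"
  using has_field_derivative_airyD by (rule DERIV_isCont)

lemma continuous_airyD: "continuous_on A (airyD j)"
  using isCont_airyD by (simp add: continuous_at_imp_continuous_on)

lemma airyD_0_0: "airyD 0 0 > 0" and airyD_1_0: "airyD 1 0 < 0"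
proof -
  have g: "Gamma (1/3) > (0::real)" "Gamma (2/3) > (0::real)" by (rule Gamma_real_pos; simp)+
  have 0: "airyD j 0 = airy_coeff j * fact j" for j
    using powser_zero[of "\<lambda>n. airy_coeff (n + j) * fact (n + j) / fact n"] by (simp add: airyD_def)
  show "airyD 0 0 > 0" using g unfolding 0 airy_coeff_0 by simp
  show "airyD 1 0 < 0" using g unfolding 0 airy_coeff_1 by simp
qed

definition cbrt_inv :: "nat \<Rightarrow> real" where "cbrt_inv N = real N powr (-1/3)"

lemma cbrt_inv: "N > 0 \<Longrightarrow> cbrt_inv N > 0" "N > 0 \<Longrightarrow> real N * cbrt_inv N ^ 3 = 1"
proof -
  assume N: "N > 0"
  then show "cbrt_inv N > 0" by (simp add: cbrt_inv_def)
  have "cbrt_inv N ^ 3 = cbrt_inv N powr 3" using N by (simp add: cbrt_inv_def)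
  also have "\<dots> = real N powr (-1)" by (simp add: cbrt_inv_def powr_powr)
  finally show "real N * cbrt_inv N ^ 3 = 1" using N by (simp add: powr_minus)
qed

lemma cbrt_inv_tendsto: "cbrt_inv \<longlonglongrightarrow> 0"
  unfolding cbrt_inv_def[abs_def] by real_asymp

text \<open>Positivity of \<open>Ai\<close> on the right half-line is inherited from that of the Hermite polynomials to the right of
  their zeros, so no real-line integral representation is needed.\<close>
lemma airyD_0_nonneg:
  assumes z: "z \<ge> 0"
  shows "airyD 0 z \<ge> 0"
proof -
  define M where "M = 10 ^ 10 * exp ((2 * \<bar>z\<bar> + 5)\<^sup>2)"
  have "(\<lambda>N. airyD 0 z + 1 * cbrt_inv N / 4 * \<bar>airyD 4 z\<bar> + M * (cbrt_inv N)\<^sup>2) \<longlonglongrightarrow> airyD 0 z + 1 * 0 / 4 * \<bar>airyD 4 z\<bar> + M * 0\<^sup>2"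
    by (intro tendsto_intros cbrt_inv_tendsto) auto
  then have lim: "(\<lambda>N. airyD 0 z + cbrt_inv N / 4 * \<bar>airyD 4 z\<bar> + M * (cbrt_inv N)\<^sup>2) \<longlonglongrightarrow> airyD 0 z" by simp
  have "0 \<le> airyD 0 z + cbrt_inv N / 4 * \<bar>airyD 4 z\<bar> + M * (cbrt_inv N)\<^sup>2" if N: "N > 0" for N
  proof -
    note e = cbrt_inv[OF N]
    define c where "c = sqrt (real N / 2)"
    have c: "c > 0" "c\<^sup>2 = real N / 2" using N by (simp_all add: c_def)
    define x where "x = 2 * c + z / (2 * c * cbrt_inv N)"
    have x: "x \<ge> 2 * c" using c e z by (simp add: x_def)
    have "(2 * c)\<^sup>2 \<le> x\<^sup>2" using x c by (intro power_mono) auto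
    then have "herm N x > 0" using x c by (intro herm_pos) (auto simp: power_mult_distrib)
    then have "airy_ray d60 (herm_kernel N (cbrt_inv N)) 0 z > 0"
      unfolding herm_airy_ray(1)[OF N e c x_def] by (rule zero_less_mult_pos) (use c e in simp)
    moreover have "\<bar>airy_ray d60 (herm_kernel N (cbrt_inv N)) 0 z - airyD 0 z - (-1) * cbrt_inv N / 4 * airyD 4 z\<bar> \<le> M * (cbrt_inv N)\<^sup>2"
      unfolding M_def by (rule airy_kernel_asymp(1)[OF herm_kernel_airy[OF N e]]) (use e in auto)
    moreover have "- (cbrt_inv N / 4 * \<bar>airyD 4 z\<bar>) \<le> cbrt_inv N / 4 * airyD 4 z"
    proof -
      have "cbrt_inv N / 4 * (- \<bar>airyD 4 z\<bar>) \<le> cbrt_inv N / 4 * airyD 4 z"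
        using e by (intro mult_left_mono) auto
      then show ?thesis by simp
    qed
    moreover have "cbrt_inv N / 4 * airyD 4 z \<le> cbrt_inv N / 4 * \<bar>airyD 4 z\<bar>"
      using e by (intro mult_left_mono) auto
    ultimately show ?thesis by (simp add: abs_le_iff)
  qed
  then show ?thesis
    by (intro LIMSEQ_le_const[OF lim] exI[of _ 1]) auto
qed

text \<open>Gronwall's argument for \<open>y'' = x y\<close>: the energy \<open>E\<close> satisfies
  \<open>\<bar>E'\<bar> \<le> K * E\<close> between 0 and \<open>a\<close>, so it cannot drop from a
  positive value to 0.\<close>

lemma airyD_no_double_zero: "airyD 0 a \<noteq> 0 \<or> airyD 1 a \<noteq> 0"
proof (rule ccontr)
  assume "\<not> ?thesis"
  then have z: "airyD 0 a = 0" "airyD 1 a = 0" by auto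
  define E where "E x = (airyD 0 x)\<^sup>2 + (airyD 1 x)\<^sup>2" for x
  define E' where "E' x = 2 * airyD 0 x * airyD 1 x * (1 + x)" for x
  define K where "K = 1 + \<bar>a\<bar>"
  have E': "\<bar>E' x\<bar> \<le> K * E x" if "\<bar>x\<bar> \<le> \<bar>a\<bar>" for x
  proof -
    have "2 * \<bar>airyD 0 x * airyD 1 x\<bar> \<le> E x"
      unfolding E_def abs_mult using sum_squares_bound[of "\<bar>airyD 0 x\<bar>" "\<bar>airyD 1 x\<bar>"] by simp
    moreover have "\<bar>1 + x\<bar> \<le> K" using that by (simp add: K_def)
    ultimately have "(2 * \<bar>airyD 0 x * airyD 1 x\<bar>) * \<bar>1 + x\<bar> \<le> E x * K"
      by (intro mult_mono) (auto simp: E_def)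
    then show ?thesis by (simp add: E'_def abs_mult mult_ac)
  qed
  have DE: "(E has_real_derivative E' x) (at x)" for x
    unfolding E_def E'_def by (auto intro!: derivative_eq_intros field_derivative_airyD[unfolded One_nat_def] simp: algebra_simps)
  have E0: "E 0 > 0" using airyD_0_0 by (simp add: E_def add_pos_nonneg)
  have Ea: "E a = 0" using z by (simp add: E_def)
  show False
  proof (cases "a \<le> 0")
    case True
    have "E 0 * exp (- K * 0) \<le> E a * exp (- K * a)"
    proof (rule DERIV_nonpos_imp_nonincreasing[OF True])
      fix x assume x: "a \<le> x" "x \<le> 0"
      have "((\<lambda>x. E x * exp (- K * x)) has_real_derivative (E' x - K * E x) * exp (- K * x)) (at x)"
        by (auto intro!: derivative_eq_intros DE simp: algebra_simps)
      moreover have "(E' x - K * E x) * exp (- K * x) \<le> 0"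
        using E'[of x] x by (intro mult_nonpos_nonneg) auto
      ultimately show "\<exists>y. ((\<lambda>x. E x * exp (- K * x)) has_real_derivative y) (at x) \<and> y \<le> 0" by blast
    qed
    then show False using E0 Ea by simp
  next
    case False
    then have "0 \<le> a" by simp
    then have "E 0 * exp (K * 0) \<le> E a * exp (K * a)"
    proof (rule DERIV_nonneg_imp_nondecreasing)
      fix x assume x: "0 \<le> x" "x \<le> a"
      have "((\<lambda>x. E x * exp (K * x)) has_real_derivative (E' x + K * E x) * exp (K * x)) (at x)"
        by (auto intro!: derivative_eq_intros DE simp: algebra_simps)
      moreover have "(E' x + K * E x) * exp (K * x) \<ge> 0"
        using E'[of x] x by (intro mult_nonneg_nonneg) auto
      ultimately show "\<exists>y. ((\<lambda>x. E x * exp (K * x)) has_real_derivative y) (at x) \<and> y \<ge> 0" by blast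
    qed
    then show False using E0 Ea by simp
  qed
qed

text \<open>A zero at \<open>z > 0\<close> would be a local minimum of a nonnegative function, hence
  a double zero.\<close>

lemma airyD_0_pos:
  assumes "z \<ge> 0" shows "airyD 0 z > 0"
proof (rule ccontr)
  assume "\<not> ?thesis"
  then have z: "airyD 0 z = 0" using airyD_0_nonneg[OF assms] by simp
  then have zp: "z > 0" using assms airyD_0_0 by (cases "z = 0") auto
  have "airyD 1 z = 0"
    by (rule DERIV_local_min[OF field_derivative_airyD(1) zp]) (auto simp: z intro!: airyD_0_nonneg)
  then show False using airyD_no_double_zero[of z] z by simp
qed

text \<open>Otherwise \<open>Ai\<close> is positive, hence concave, on the left half-line. Either
  its slope is positive somewhere, and the tangent there forces a zero further left; or the slope is
  never positive, \<open>Ai\<close> stays above \<open>Ai 0\<close>, and integrating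
  \<open>Ai'' = x * Ai\<close> makes the slope positive after all.\<close>

lemma airyD_zero_exists: "\<exists>z<0. airyD 0 z = 0"
proof (rule ccontr)
  assume no: "\<not> ?thesis"
  have pos: "airyD 0 z > 0" if z: "z \<le> 0" for z
  proof (rule ccontr)
    assume "\<not> airyD 0 z > 0"
    then obtain y where "z \<le> y" "y \<le> 0" "airyD 0 y = 0"
      using IVT'[of "airyD 0" z 0 0] z airyD_0_0 continuous_airyD[of "{z..0}" 0] by auto
    then show False using no airyD_0_0 by (cases "y = 0") auto
  qed
  have A1mono: "airyD 1 y \<le> airyD 1 z" if "z \<le> y" "y \<le> 0" for y z
  proof (rule DERIV_nonpos_imp_nonincreasing[OF that(1)])
    fix x assume "z \<le> x" "x \<le> y"
    then have "x * airyD 0 x \<le> 0" using pos[of x] that by (intro mult_nonpos_nonneg) auto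
    then show "\<exists>d. (airyD 1 has_real_derivative d) (at x) \<and> d \<le> 0" using field_derivative_airyD(2) by blast
  qed
  show False
  proof (cases "\<exists>x\<le>0. airyD 1 x > 0")
    case True
    then obtain x where x: "x \<le> 0" "airyD 1 x > 0" by blast
    \<comment> \<open>The point where the tangent at \<open>x\<close> meets the axis.\<close>
    define z where "z = x - airyD 0 x / airyD 1 x"
    have zx: "z < x" using pos[OF x(1)] x by (simp add: z_def)
    then obtain t where t: "z < t" "t < x" "airyD 0 x - airyD 0 z = (x - z) * airyD 1 t"
      using MVT2[of z x "airyD 0" "airyD 1"] field_derivative_airyD(1) by blast
    have "(x - z) * airyD 1 x \<le> (x - z) * airyD 1 t" using A1mono[of t x] t x by (intro mult_left_mono) auto
    then have "airyD 0 z \<le> 0" using t x by (simp add: z_def)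
    then show False using pos[of z] zx x by simp
  next
    case False
    then have neg: "airyD 1 x \<le> 0" if "x \<le> 0" for x using that by (meson not_less)
    define \<alpha> where "\<alpha> = airyD 0 0"
    have \<alpha>: "\<alpha> > 0" using airyD_0_0 by (simp add: \<alpha>_def)
    have ge: "airyD 0 z \<ge> \<alpha>" if "z \<le> 0" for z
      unfolding \<alpha>_def
      by (rule DERIV_nonpos_imp_nonincreasing[OF that]) (use neg field_derivative_airyD(1) in blast)
    \<comment> \<open>Chosen so that the lower bound
      \<open>airyD 1 0 + \<alpha> / 2 * z\<^sup>2\<close> for the slope at \<open>z\<close> equals
      1.\<close>
    define z where "z = - sqrt (2 * (1 - airyD 1 0) / \<alpha>)"
    have q: "2 * (1 - airyD 1 0) / \<alpha> \<ge> 0" using airyD_1_0 \<alpha> by simp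
    have z: "z \<le> 0" using q by (simp add: z_def)
    have "airyD 1 0 - \<alpha> / 2 * 0\<^sup>2 \<le> airyD 1 z - \<alpha> / 2 * z\<^sup>2"
    proof (rule DERIV_nonpos_imp_nonincreasing[OF z])
      fix x assume x: "z \<le> x" "x \<le> 0"
      have "((\<lambda>x. airyD 1 x - \<alpha> / 2 * x\<^sup>2) has_real_derivative x * (airyD 0 x - \<alpha>)) (at x)"
        by (auto intro!: derivative_eq_intros field_derivative_airyD(2)[unfolded One_nat_def] simp: algebra_simps)
      moreover have "x * (airyD 0 x - \<alpha>) \<le> 0" using ge[of x] x by (intro mult_nonpos_nonneg) auto
      ultimately show "\<exists>y. ((\<lambda>x. airyD 1 x - \<alpha> / 2 * x\<^sup>2) has_real_derivative y) (at x) \<and> y \<le> 0" by blast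
    qed
    moreover have "\<alpha> / 2 * z\<^sup>2 = 1 - airyD 1 0" using q \<alpha> by (simp add: z_def)
    ultimately show False using neg[OF z] by simp
  qed
qed

text \<open>\<open>GREATEST\<close> picks a genuine zero because the zero set is closed, nonempty
  and bounded above. To its right \<open>Ai\<close> is positive, so the slope at this zero is
  nonnegative, and it is not 0 since there are no double zeros.\<close>

lemma airy_i1: "airyD 0 airy_i1 = 0" "airy_i1 < 0" "z > airy_i1 \<Longrightarrow> airyD 0 z > 0"
  and airy_i1_deriv: "airyD 1 airy_i1 > 0" "deriv Ai airy_i1 = airyD 1 airy_i1"
proof -
  define S where "S = {z. airyD 0 z = 0}"
  have AD: "Ai = airyD 0" by (simp add: fun_eq_iff Ai_eq_airyD)
  have ne: "S \<noteq> {}" using airyD_zero_exists by (auto simp: S_def)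
  have neg: "z < 0" if "z \<in> S" for z using that airyD_0_pos[of z] by (force simp: S_def)
  then have bd: "bdd_above S" by (intro bdd_aboveI[of _ 0]) (simp add: less_imp_le)
  have "closed S" unfolding S_def by (intro closed_Collect_eq continuous_airyD continuous_on_const)
  then have Sup: "Sup S \<in> S" using closed_contains_Sup[OF ne bd] by blast
  have "airy_i1 = Sup S" unfolding airy_i1_def AD
    by (rule Greatest_equality) (use Sup bd in \<open>auto simp: S_def intro: cSup_upper\<close>)
  then show i1: "airyD 0 airy_i1 = 0" "airy_i1 < 0" using Sup neg by (auto simp: S_def)
  show gt: "airyD 0 z > 0" if z: "z > airy_i1" for z
  proof (rule ccontr)
    assume n: "\<not> ?thesis"
    then have z0: "z \<le> 0" using airyD_0_pos[of z] by force
    obtain y where "z \<le> y" "airyD 0 y = 0"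
      using IVT'[of "airyD 0" z 0 0] n z0 airyD_0_0 continuous_airyD[of "{z..0}" 0] by auto
    then show False using cSup_upper[of y S] bd \<open>airy_i1 = Sup S\<close> z by (simp add: S_def)
  qed
  have "airyD 1 airy_i1 \<noteq> 0" using airyD_no_double_zero[of airy_i1] i1 by simp
  moreover have "\<not> airyD 1 airy_i1 < 0"
  proof
    assume "airyD 1 airy_i1 < 0"
    then obtain d where d: "d > 0" "\<And>h. 0 < h \<Longrightarrow> h < d \<Longrightarrow> airyD 0 (airy_i1 + h) < airyD 0 airy_i1"
      using DERIV_neg_dec_right[OF field_derivative_airyD(1)] by blast
    have "airyD 0 (airy_i1 + d / 2) < 0" using d(2)[of "d / 2"] d(1) i1(1) by simp
    moreover have "airyD 0 (airy_i1 + d / 2) > 0" using d(1) by (intro gt) simp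
    ultimately show False by simp
  qed
  ultimately show "airyD 1 airy_i1 > 0" by simp
  show "deriv Ai airy_i1 = airyD 1 airy_i1" unfolding AD by (rule DERIV_imp_deriv[OF field_derivative_airyD(1)])
qed

text \<open>Turns smallness of \<open>airyD 0 Y\<close> into closeness of \<open>Y\<close> to the
  zero: near it by the slope, on the remaining compact interval by a positive minimum. The range
  extends to 1 because the shifted argument \<open>z + \<sigma> * \<epsilon> / 2\<close> of some
  \<open>z \<le> 0\<close> may exceed 0.\<close>

lemma airyD_linear_bound:
  obtains r c where "0 < r" "r \<le> 1" "0 < c"
    "\<And>Y. airy_i1 \<le> Y \<Longrightarrow> Y \<le> 1 \<Longrightarrow> airyD 0 Y \<ge> c * (Y - airy_i1)"
    "\<And>Y. airy_i1 - r \<le> Y \<Longrightarrow> Y \<le> airy_i1 \<Longrightarrow> airyD 0 Y \<le> c * (Y - airy_i1)"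
proof -
  let ?i = airy_i1
  define q where "q = airyD 1 ?i / 2"
  have q: "q > 0" using airy_i1_deriv by (simp add: q_def)
  have "eventually (\<lambda>x. q < airyD 1 x) (at ?i)"
    by (rule order_tendstoD(1)[OF isCont_airyD[where j = 1 and z = ?i, unfolded isCont_def]])
       (use q in \<open>simp add: q_def\<close>)
  then obtain d where d: "d > 0" "\<And>x. x \<noteq> ?i \<Longrightarrow> dist x ?i < d \<Longrightarrow> q < airyD 1 x"
    unfolding eventually_at by auto
  define r where "r = min (d / 2) 1"
  have r: "0 < r" "r \<le> 1" "r < d" using d by (auto simp: r_def)
  have mvt: "airyD 0 Y - airyD 0 X \<ge> q * (Y - X)" if "X \<le> Y" "?i - r \<le> X" "Y \<le> ?i + r" "X \<noteq> Y" for X Y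
  proof -
    have XY: "X < Y" using that by simp
    obtain t where t: "X < t" "t < Y" "airyD 0 Y - airyD 0 X = (Y - X) * airyD 1 t"
      using MVT2[of X Y "airyD 0" "airyD 1"] field_derivative_airyD(1) XY by auto
    have "q \<le> airyD 1 t"
    proof (cases "t = ?i")
      case True then show ?thesis using q by (simp add: q_def)
    next
      case False
      have "dist t ?i < d" using t that r by (auto simp: dist_real_def)
      then show ?thesis using d(2)[OF False] by simp
    qed
    then show ?thesis using t by (simp add: mult.commute mult_left_mono)
  qed
  have "compact {?i + r..1}" by simp
  have i0: "?i < 0" by (rule airy_i1)
  then have ne: "{?i + r..1} \<noteq> {}" using r by simp
  obtain y where y: "y \<in> {?i + r..1}" "\<And>x. x \<in> {?i + r..1} \<Longrightarrow> airyD 0 y \<le> airyD 0 x"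
    using continuous_attains_inf[OF \<open>compact {?i + r..1}\<close> ne continuous_airyD] by blast
  define \<mu> where "\<mu> = airyD 0 y"
  have \<mu>: "\<mu> > 0" unfolding \<mu>_def using y r by (intro airy_i1(3)) auto
  define c where "c = min q (\<mu> / (1 - ?i))"
  have c: "c > 0" "c \<le> q" "c \<le> \<mu> / (1 - ?i)" using q \<mu> i0 by (auto simp: c_def)
  show ?thesis
  proof (rule that[OF r(1,2) c(1)])
    fix Y assume Y: "?i \<le> Y" "Y \<le> 1"
    show "airyD 0 Y \<ge> c * (Y - ?i)"
    proof (cases "Y \<le> ?i + r")
      case True
      have "c * (Y - ?i) \<le> q * (Y - ?i)" using c Y by (intro mult_right_mono) auto
      moreover have "q * (Y - ?i) \<le> airyD 0 Y" using mvt[of ?i Y] True Y r airy_i1(1) by (cases "Y = ?i") auto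
      ultimately show ?thesis by (rule order_trans)
    next
      case False
      have "c * (Y - ?i) \<le> \<mu> / (1 - ?i) * (1 - ?i)" using c Y i0 \<mu> by (intro mult_mono) auto
      also have "\<dots> = \<mu>" using i0 by simp
      also have "\<mu> \<le> airyD 0 Y" unfolding \<mu>_def using y(2)[of Y] False Y by simp
      finally show ?thesis .
    qed
  next
    fix Y assume Y: "?i - r \<le> Y" "Y \<le> ?i"
    have "q * (Y - ?i) \<le> c * (Y - ?i)" using c Y by (intro mult_right_mono_neg) auto
    then show "airyD 0 Y \<le> c * (Y - ?i)" using mvt[of Y ?i] Y r airy_i1(1) by (cases "Y = ?i") (auto simp: algebra_simps)
  qed
qed

lemma airyD_bounded: "\<exists>B>0. \<forall>x\<in>{a..b}. \<bar>airyD j x\<bar> \<le> B"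
proof -
  have "bounded (airyD j ` {a..b})"
    by (intro compact_imp_bounded compact_continuous_image continuous_airyD) simp
  then show ?thesis unfolding bounded_pos by (auto simp: image_iff)
qed

text \<open>Since \<open>airyD 4 z = z\<^sup>2 airyD 0 z + 2 airyD 1 z\<close>, a first-order correction proportional to
  \<open>airyD 4\<close> amounts, up to second order, to the shift \<open>z \<mapsto> z + \<sigma>\<epsilon>/2\<close> of the argument
  and multiplication by a non-vanishing factor.\<close>
lemma airy_root:
  assumes \<sigma>: "\<bar>\<sigma>\<bar> = 1" and M: "M > 0"
  shows "\<exists>z0 K \<epsilon>0. airy_i1 - 1 \<le> z0 \<and> z0 < 0 \<and> K > 0 \<and> \<epsilon>0 > 0 \<and>
    (\<forall>\<epsilon> G. 0 < \<epsilon> \<longrightarrow> \<epsilon> < \<epsilon>0 \<longrightarrow> (\<forall>z. z0 \<le> z \<longrightarrow> z \<le> 0 \<longrightarrow> \<bar>G z - airyD 0 z - \<sigma> * \<epsilon> / 4 * airyD 4 z\<bar> \<le> M * \<epsilon>\<^sup>2)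
       \<longrightarrow> G z0 < 0 \<and> (\<forall>z. z0 \<le> z \<longrightarrow> z \<le> 0 \<longrightarrow> G z = 0 \<longrightarrow> \<bar>z + \<sigma> * \<epsilon> / 2 - airy_i1\<bar> \<le> K * \<epsilon>\<^sup>2))"
proof -
  let ?i = airy_i1
  obtain r c where rc: "0 < r" "r \<le> 1" "0 < c"
    "\<And>Y. ?i \<le> Y \<Longrightarrow> Y \<le> 1 \<Longrightarrow> airyD 0 Y \<ge> c * (Y - ?i)"
    "\<And>Y. ?i - r \<le> Y \<Longrightarrow> Y \<le> ?i \<Longrightarrow> airyD 0 Y \<le> c * (Y - ?i)"
    using airyD_linear_bound by blast
  obtain B1 where B1: "B1 > 0" "\<And>x. x \<in> {?i - 2..1} \<Longrightarrow> \<bar>airyD 1 x\<bar> \<le> B1" using airyD_bounded by blast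
  obtain B2 where B2: "B2 > 0" "\<And>x. x \<in> {?i - 2..1} \<Longrightarrow> \<bar>airyD 2 x\<bar> \<le> B2" using airyD_bounded by blast
  define I where "I = (1 - ?i)\<^sup>2"
  have I: "I \<ge> 1" unfolding I_def using airy_i1(2) by (intro one_le_power) auto
  \<comment> \<open>Three errors of order \<open>\<epsilon>\<^sup>2\<close>: the given one, the
    Taylor remainder of the shift, and the change of argument in the term with the factor
    \<open>z\<^sup>2\<close>, which \<open>I\<close> bounds.\<close>
  define M' where "M' = M + B2 + I * B1"
  have M': "M' > 0" using M B1 B2 I by (simp add: M'_def add_pos_pos)
  define z0 where "z0 = ?i - r / 2"
  \<comment> \<open>The three entries keep the shift below \<open>r / 4\<close>, the factor
    \<open>f\<close> above 1/2, and the error below \<open>c * r / 16\<close>; together they settle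
    the sign at \<open>z0\<close>.\<close>
  define \<epsilon>0 where "\<epsilon>0 = min (r / 2) (min (2 / I) (c * r / (16 * M')))"
  have i0: "?i < 0" by (rule airy_i1)
  have \<epsilon>0: "\<epsilon>0 > 0" using rc M' I by (simp add: \<epsilon>0_def)
  show ?thesis
  proof (rule exI[of _ z0], rule exI[of _ "2 * M' / c"], rule exI[of _ \<epsilon>0], intro conjI[OF _ conjI[OF _ conjI[OF _ conjI]]] allI impI)
    fix \<epsilon> :: real and G :: "real \<Rightarrow> real"
    assume \<epsilon>: "0 < \<epsilon>" "\<epsilon> < \<epsilon>0"
      and "\<forall>z. z0 \<le> z \<longrightarrow> z \<le> 0 \<longrightarrow> \<bar>G z - airyD 0 z - \<sigma> * \<epsilon> / 4 * airyD 4 z\<bar> \<le> M * \<epsilon>\<^sup>2"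
    then have G: "\<bar>G z - airyD 0 z - \<sigma> * \<epsilon> / 4 * airyD 4 z\<bar> \<le> M * \<epsilon>\<^sup>2" if "z0 \<le> z" "z \<le> 0" for z using that by blast
    have \<epsilon>': "\<epsilon> < r / 2" "\<epsilon> < 2 / I" "\<epsilon> < c * r / (16 * M')" using \<epsilon> by (auto simp: \<epsilon>0_def)
    have e1: "\<epsilon> < 1" using \<epsilon>' rc by simp
    have "\<epsilon> * I < 2" using \<epsilon>' I by (simp add: pos_less_divide_eq)
    have se: "\<bar>\<sigma> * \<epsilon> / 2\<bar> = \<epsilon> / 2" using \<sigma> \<epsilon> by (simp add: abs_mult)
    define f where "f z = 1 + \<sigma> * \<epsilon> / 4 * z\<^sup>2" for z
    have f: "f z \<ge> 1 / 2" and zI: "z\<^sup>2 \<le> I" if "z0 \<le> z" "z \<le> 0" for z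
    proof -
      have "\<bar>z\<bar> \<le> 1 - ?i" using that rc i0 by (simp add: z0_def)
      then have "\<bar>z\<bar>\<^sup>2 \<le> (1 - ?i)\<^sup>2" by (intro power_mono) auto
      then show zI: "z\<^sup>2 \<le> I" by (simp add: I_def)
      have "\<bar>\<sigma> * \<epsilon> / 4 * z\<^sup>2\<bar> = \<epsilon> * z\<^sup>2 / 4" using \<sigma> \<epsilon> by (simp add: abs_mult)
      also have "\<dots> \<le> \<epsilon> * I / 4" using zI \<epsilon> by simp
      also have "\<dots> \<le> 1 / 2" using \<open>\<epsilon> * I < 2\<close> by (simp add: mult.commute)
      finally have "\<bar>\<sigma> * \<epsilon> / 4 * z\<^sup>2\<bar> \<le> 1 / 2" .
      then show "f z \<ge> 1 / 2" unfolding f_def by linarith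
    qed
    have main: "\<bar>G z - f z * airyD 0 (z + \<sigma> * \<epsilon> / 2)\<bar> \<le> M' * \<epsilon>\<^sup>2" if z: "z0 \<le> z" "z \<le> 0" for z
    proof -
      define Y where "Y = z + \<sigma> * \<epsilon> / 2"
      have Yz: "\<bar>Y - z\<bar> = \<epsilon> / 2" using se by (simp add: Y_def)
      have zS: "z \<in> {?i - 2..1}" "Y \<in> {?i - 2..1}" using z Yz e1 rc i0 by (auto simp: z0_def abs_if split: if_splits)
      have DS: "(airyD i has_field_derivative airyD (Suc i) x) (at x within {?i - 2..1})" for i x
        by (rule has_field_derivative_at_within[OF has_field_derivative_airyD])
      have L: "norm (airyD 0 Y - (\<Sum>i\<le>1. airyD i z * (Y - z) ^ i / fact i)) \<le> B2 * norm (Y - z) ^ Suc 1 / fact 1"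
      proof (rule field_Taylor[where S = "{?i - 2..1}"])
        show "norm (airyD (Suc 1) x) \<le> B2" if "x \<in> {?i - 2..1}" for x
          using B2(2)[OF that] by (simp add: numeral_2_eq_2)
      qed (use DS zS in auto)
      then have T1: "\<bar>airyD 0 Y - airyD 0 z - airyD 1 z * (Y - z)\<bar> \<le> B2 * \<epsilon>\<^sup>2"
      proof -
        have N: "norm (Y - z) ^ Suc 1 = \<epsilon>\<^sup>2 / 4" by (simp only: real_norm_def Yz) (simp add: power2_eq_square)
        have "B2 * (\<epsilon>\<^sup>2 / 4) \<le> B2 * \<epsilon>\<^sup>2" using B2(1) by simp
        moreover have S: "(\<Sum>i\<le>1. airyD i z * (Y - z) ^ i / fact i) = airyD 0 z + airyD 1 z * (Y - z)" by simp
        moreover have "\<bar>airyD 0 Y - airyD 0 z - airyD 1 z * (Y - z)\<bar> \<le> B2 * (\<epsilon>\<^sup>2 / 4)"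
          using L unfolding S N by (simp only: real_norm_def fact_1 div_by_1 diff_diff_eq)
        ultimately show ?thesis by linarith
      qed
      have "norm (airyD 0 Y - (\<Sum>i\<le>0. airyD i z * (Y - z) ^ i / fact i)) \<le> B1 * norm (Y - z) ^ Suc 0 / fact 0"
        by (rule field_Taylor[where S = "{?i - 2..1}"]) (use DS B1 zS in auto)
      then have "\<bar>airyD 0 z - airyD 0 Y\<bar> \<le> B1 * (\<epsilon> / 2)" using Yz by (simp add: abs_minus_commute)
      moreover have "B1 * (\<epsilon> / 2) \<le> B1 * \<epsilon>" using B1(1) \<epsilon> by simp
      ultimately have T0: "\<bar>airyD 0 z - airyD 0 Y\<bar> \<le> B1 * \<epsilon>" by linarith
      have "\<bar>\<sigma> * \<epsilon> / 4 * z\<^sup>2 * (airyD 0 z - airyD 0 Y)\<bar> = \<epsilon> / 4 * z\<^sup>2 * \<bar>airyD 0 z - airyD 0 Y\<bar>"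
        using \<sigma> \<epsilon> by (simp add: abs_mult)
      also have "\<dots> \<le> \<epsilon> / 4 * I * (B1 * \<epsilon>)" using \<epsilon> I zI[OF z] T0 by (intro mult_mono) auto
      also have "\<dots> \<le> I * B1 * \<epsilon>\<^sup>2" using I B1 by (simp add: power2_eq_square)
      finally have T2: "\<bar>\<sigma> * \<epsilon> / 4 * z\<^sup>2 * (airyD 0 z - airyD 0 Y)\<bar> \<le> I * B1 * \<epsilon>\<^sup>2" .
      have "G z - f z * airyD 0 Y = (G z - airyD 0 z - \<sigma> * \<epsilon> / 4 * airyD 4 z)
          - (airyD 0 Y - airyD 0 z - airyD 1 z * (Y - z)) + \<sigma> * \<epsilon> / 4 * z\<^sup>2 * (airyD 0 z - airyD 0 Y)"
        unfolding airyD_4 f_def by (simp add: Y_def algebra_simps)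
      also have "\<bar>\<dots>\<bar> \<le> M * \<epsilon>\<^sup>2 + B2 * \<epsilon>\<^sup>2 + I * B1 * \<epsilon>\<^sup>2"
        using G[OF z] T1 T2 by linarith
      finally show ?thesis by (simp add: M'_def Y_def algebra_simps)
    qed
    have "G z0 < 0"
    proof -
      define Y where "Y = z0 + \<sigma> * \<epsilon> / 2"
      have Y: "?i - r \<le> Y" "Y \<le> ?i - r / 4" using se \<epsilon>' rc by (auto simp: Y_def z0_def abs_if split: if_splits)
      have "airyD 0 Y \<le> c * (Y - ?i)" using Y rc by (intro rc(5)) auto
      also have "\<dots> \<le> c * (- (r / 4))" using Y rc by (intro mult_left_mono) auto
      finally have AY: "airyD 0 Y \<le> - (c * r / 4)" by simp
      have z: "z0 \<le> z0" "z0 \<le> 0" using i0 rc by (auto simp: z0_def)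
      have "f z0 * airyD 0 Y \<le> 1 / 2 * airyD 0 Y"
        using f[OF z] AY rc by (intro mult_right_mono_neg) (auto intro: order_trans)
      then have "G z0 \<le> - (c * r / 8) + M' * \<epsilon>\<^sup>2" using main[OF z] AY unfolding Y_def by linarith
      also have "M' * \<epsilon>\<^sup>2 < c * r / 16"
      proof -
        have "M' * \<epsilon>\<^sup>2 \<le> M' * \<epsilon>" using M' e1 \<epsilon> by (simp add: power2_eq_square)
        also have "\<dots> < M' * (c * r / (16 * M'))" using \<epsilon>' M' by (intro mult_strict_left_mono) auto
        finally show ?thesis using M' by simp
      qed
      finally have "G z0 < - (c * r / 16)" by simp
      moreover have "c * r > 0" using rc by simp
      ultimately show ?thesis by linarith
    qed
    moreover have "\<bar>z + \<sigma> * \<epsilon> / 2 - ?i\<bar> \<le> 2 * M' / c * \<epsilon>\<^sup>2" if z: "z0 \<le> z" "z \<le> 0" "G z = 0" for z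
    proof -
      define Y where "Y = z + \<sigma> * \<epsilon> / 2"
      have "1 / 2 * \<bar>airyD 0 Y\<bar> \<le> f z * \<bar>airyD 0 Y\<bar>" using f[OF z(1,2)] by (intro mult_right_mono) auto
      also have "\<dots> = \<bar>f z * airyD 0 Y\<bar>" using f[OF z(1,2)] by (simp add: abs_mult)
      also have "\<dots> \<le> M' * \<epsilon>\<^sup>2" using main[OF z(1,2)] z by (simp add: Y_def)
      finally have AY: "\<bar>airyD 0 Y\<bar> \<le> 2 * M' * \<epsilon>\<^sup>2" by simp
      have Y: "?i - r \<le> Y" "Y \<le> 1" using se \<epsilon>' rc z e1 by (auto simp: Y_def z0_def abs_if split: if_splits)
      have "c * \<bar>Y - ?i\<bar> \<le> \<bar>airyD 0 Y\<bar>"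
        using rc(4)[of Y] rc(5)[of Y] Y by (cases "Y \<le> ?i") (auto simp: abs_if algebra_simps)
      then have "\<bar>Y - ?i\<bar> \<le> 2 * M' * \<epsilon>\<^sup>2 / c" using AY rc by (subst pos_le_divide_eq) (auto simp: mult.commute)
      then show ?thesis by (simp add: Y_def)
    qed
    ultimately show "G z0 < 0 \<and> (\<forall>z. z0 \<le> z \<longrightarrow> z \<le> 0 \<longrightarrow> G z = 0 \<longrightarrow> \<bar>z + \<sigma> * \<epsilon> / 2 - ?i\<bar> \<le> 2 * M' / c * \<epsilon>\<^sup>2)" by blast
  qed (use rc M' i0 \<epsilon>0 in \<open>auto simp: z0_def\<close>)
qed

section \<open>Spherical Bessel functions in the transition region\<close>

text \<open>The factors \<open>2 * (k + i) + 1\<close> are the denominators in the recursion for the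
  derivatives of the Chebyshev polynomials at 1; the series with these coefficients is the limit of
  the Taylor expansions there.\<close>

definition bess_coeff :: "nat \<Rightarrow> nat \<Rightarrow> real" where
  "bess_coeff k j = (-1) ^ j / (fact j * (\<Prod>i<j. real (2 * (k + i) + 1)))"

text \<open>\<open>bess k (\<theta>\<^sup>2/2)\<close> is the spherical Bessel function \<open>j\<^bsub>k-1\<^esub> \<theta>\<close> divided by its leading term at \<open>0\<close>.\<close>
definition bess :: "nat \<Rightarrow> real \<Rightarrow> real" where
  "bess k u = (\<Sum>j. bess_coeff k j * u ^ j)"

lemma bess_prod_pos: "(\<Prod>i<j. real (2 * (k + i) + 1)) > 0"
  by (intro prod_pos) auto

lemma bess_prod_ge: "(\<Prod>i<j. real (2 * (k + i) + 1)) \<ge> real (2 * k + 1) ^ j"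
proof -
  have "(\<Prod>i<j. real (2 * k + 1)) \<le> (\<Prod>i<j. real (2 * (k + i) + 1))" by (intro prod_mono) auto
  then show ?thesis by simp
qed

lemma bess_coeff_bound: "\<bar>bess_coeff k j\<bar> \<le> (1 / real (2 * k + 1)) ^ j / fact j"
proof -
  have "\<bar>bess_coeff k j\<bar> = 1 / (fact j * (\<Prod>i<j. real (2 * (k + i) + 1)))"
    unfolding bess_coeff_def abs_divide using bess_prod_pos[of k j] by (simp add: power_abs abs_mult)
  also have "\<dots> \<le> 1 / (fact j * real (2 * k + 1) ^ j)"
    by (intro divide_left_mono mult_left_mono bess_prod_ge mult_pos_pos bess_prod_pos) auto
  finally show ?thesis by (simp add: power_divide mult.commute)
qed

lemma exp_sums_divide: "(\<lambda>j. x ^ j / fact j) sums exp (x::real)"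
  using exp_converges[of x] by (simp add: divide_inverse mult.commute)

lemma bess_sums: "(\<lambda>j. bess_coeff k j * u ^ j) sums bess k u"
proof -
  have "summable (\<lambda>j. (\<bar>u\<bar> / real (2 * k + 1)) ^ j / fact j)"
    using exp_sums_divide sums_summable by blast
  then have "summable (\<lambda>j. bess_coeff k j * u ^ j)"
  proof (rule summable_comparison_test'[where N = 0])
    fix j :: nat
    have "norm (bess_coeff k j * u ^ j) = \<bar>bess_coeff k j\<bar> * \<bar>u\<bar> ^ j" by (simp add: abs_mult power_abs)
    also have "\<dots> \<le> ((1 / real (2 * k + 1)) ^ j / fact j) * \<bar>u\<bar> ^ j" by (intro mult_right_mono bess_coeff_bound) auto
    finally show "norm (bess_coeff k j * u ^ j) \<le> (\<bar>u\<bar> / real (2 * k + 1)) ^ j / fact j" by (simp add: power_divide)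
  qed
  then show ?thesis unfolding bess_def by (rule summable_sums)
qed

lemma bess_0: "bess k 0 = 1"
  unfolding bess_def using powser_zero[of "bess_coeff k"] by (simp add: bess_coeff_def)

text \<open>For fixed \<open>u\<close> this forces \<open>bess k u\<close> to 1 as \<open>k\<close>
  grows, which starts the descending induction in \<open>bess_pos\<close>.\<close>

lemma bess_near_1: "\<bar>bess k u - 1\<bar> \<le> exp (\<bar>u\<bar> / real (2 * k + 1)) - 1"
proof -
  let ?x = "\<bar>u\<bar> / real (2 * k + 1)"
  have A: "(\<lambda>j. bess_coeff k (Suc j) * u ^ Suc j) sums (bess k u - 1)"
    using bess_sums[of k u] by (subst sums_Suc_iff) (simp add: bess_coeff_def)
  have e: "(\<lambda>j. ?x ^ Suc j / fact (Suc j)) sums (exp ?x - 1)"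
    using exp_sums_divide[of ?x] by (subst sums_Suc_iff) simp
  have le: "norm (bess_coeff k (Suc j) * u ^ Suc j) \<le> ?x ^ Suc j / fact (Suc j)" for j
  proof -
    have "norm (bess_coeff k (Suc j) * u ^ Suc j) = \<bar>bess_coeff k (Suc j)\<bar> * \<bar>u\<bar> ^ Suc j" by (simp add: abs_mult power_abs del: power_Suc)
    also have "\<dots> \<le> ((1 / real (2 * k + 1)) ^ Suc j / fact (Suc j)) * \<bar>u\<bar> ^ Suc j" by (intro mult_right_mono bess_coeff_bound) auto
    finally show ?thesis by (simp add: power_divide del: power_Suc fact_Suc)
  qed
  have "norm (bess k u - 1) \<le> exp ?x - 1"
    using norm_suminf_le[OF le sums_summable[OF e]]
    unfolding sums_unique[OF A, symmetric] sums_unique[OF e, symmetric] .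
  then show ?thesis by simp
qed

lemma bess_coeff_Suc: "bess_coeff k (Suc j) = - bess_coeff (Suc k) j / (real (Suc j) * real (2 * k + 1))"
proof -
  have "(\<Prod>i<Suc j. real (2 * (k + i) + 1)) = real (2 * k + 1) * (\<Prod>i<j. real (2 * (Suc k + i) + 1))"
    by (subst prod.lessThan_Suc_shift) simp
  then show ?thesis unfolding bess_coeff_def by simp
qed

lemma DERIV_bess: "(bess k has_real_derivative - bess (Suc k) u / real (2 * k + 1)) (at u)"
proof -
  have "((\<lambda>x. \<Sum>n. bess_coeff k n * x ^ n) has_field_derivative (\<Sum>n. diffs (bess_coeff k) n * u ^ n)) (at u)"
    by (rule termdiffs_strong_converges_everywhere) (use bess_sums sums_summable in blast)
  moreover have "diffs (bess_coeff k) n = (- 1 / real (2 * k + 1)) * bess_coeff (Suc k) n" for n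
    unfolding diffs_def bess_coeff_Suc by (simp del: of_nat_Suc)
  moreover have "(\<Sum>n. ((- 1 / real (2 * k + 1)) * bess_coeff (Suc k) n) * u ^ n) = (- 1 / real (2 * k + 1)) * bess (Suc k) u"
    unfolding mult.assoc bess_def using bess_sums[of "Suc k" u] by (intro suminf_mult) (rule sums_summable)
  ultimately show ?thesis unfolding bess_def[abs_def] by simp
qed

lemma continuous_bess: "continuous_on A (bess k)"
  using DERIV_bess by (intro continuous_at_imp_continuous_on ballI DERIV_isCont) blast

text \<open>Comparison of coefficients: the products for \<open>k + 1\<close> and
  \<open>k + 2\<close> overlap except for their end factors, which is the relation
  \<open>PQ\<close>.\<close>

lemma bess_rec: "bess k u = bess (Suc k) u - 2 * u / (real (2 * k + 1) * real (2 * k + 3)) * bess (Suc (Suc k)) u"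
proof -
  let ?c = "2 / (real (2 * k + 1) * real (2 * k + 3))"
  define g where "g j = (case j of 0 \<Rightarrow> 0 | Suc i \<Rightarrow> ?c * bess_coeff (Suc (Suc k)) i * u ^ Suc i)" for j
  have "(\<lambda>i. ?c * u * (bess_coeff (Suc (Suc k)) i * u ^ i)) sums (?c * u * bess (Suc (Suc k)) u)"
    by (intro sums_mult bess_sums)
  then have "(\<lambda>i. g (Suc i)) sums (?c * u * bess (Suc (Suc k)) u - g 0)"
    by (simp add: g_def mult_ac)
  then have "g sums (?c * u * bess (Suc (Suc k)) u)"
    by (subst (asm) sums_Suc_iff) (simp add: g_def)
  then have "(\<lambda>j. bess_coeff (Suc k) j * u ^ j - g j) sums (bess (Suc k) u - ?c * u * bess (Suc (Suc k)) u)"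
    by (intro sums_diff bess_sums)
  moreover have "bess_coeff (Suc k) j * u ^ j - g j = bess_coeff k j * u ^ j" for j
  proof (cases j)
    case 0 then show ?thesis by (simp add: g_def bess_coeff_def)
  next
    case (Suc i)
    have p: "(\<Prod>i<Suc i. real (2 * (Suc k + i) + 1)) = real (2 * k + 3) * (\<Prod>l<i. real (2 * (Suc (Suc k) + l) + 1))"
      by (subst prod.lessThan_Suc_shift) simp
    have p': "(\<Prod>l<Suc i. real (2 * (Suc k + l) + 1)) = (\<Prod>l<i. real (2 * (Suc k + l) + 1)) * real (2 * (Suc k + i) + 1)"
      by simp
    define P where "P = (\<Prod>l<i. real (2 * (Suc k + l) + 1))"
    define Q where "Q = (\<Prod>l<i. real (2 * (Suc (Suc k) + l) + 1))"
    have PQ: "P * real (2 * k + 2 * i + 3) = real (2 * k + 3) * Q"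
      using p p' unfolding P_def Q_def by (simp add: algebra_simps)
    have P: "P > 0" and Q: "Q > 0" unfolding P_def Q_def using bess_prod_pos by blast+
    have k1: "bess_coeff k (Suc i) = - ((-1) ^ i / (fact i * P)) / (real (Suc i) * real (2 * k + 1))"
      unfolding bess_coeff_Suc[of k] unfolding bess_coeff_def P_def ..
    have k2: "bess_coeff (Suc k) (Suc i) = - ((-1) ^ i / (fact i * Q)) / (real (Suc i) * real (2 * k + 3))"
      unfolding bess_coeff_Suc[of "Suc k"] unfolding bess_coeff_def Q_def by (simp add: numeral_3_eq_3)
    have k3: "bess_coeff (Suc (Suc k)) i = (-1) ^ i / (fact i * Q)" unfolding bess_coeff_def Q_def ..
    have Qe: "Q = P * real (2 * k + 2 * i + 3) / real (2 * k + 3)" using PQ by (simp add: field_simps)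
    have "- (s / (f * Q)) / (a * c) - (2 / (b * c)) * (s / (f * Q)) = - (s / (f * P)) / (a * b)"
      if "a > 0" "b > 0" "c > 0" "f > 0" "P * (b + 2 * a) = c * Q" for s f a b c :: real
    proof -
      have "- (s / (f * Q)) / (a * c) - (2 / (b * c)) * (s / (f * Q)) = - s * (b + 2 * a) / (f * a * b * (c * Q))"
        using that Q by (simp add: field_simps)
      also have "\<dots> = - s * (b + 2 * a) / (f * a * b * (P * (b + 2 * a)))" unfolding that(5) ..
      also have "\<dots> = - (s / (f * P)) / (a * b)"
      proof -
        have "b + 2 * a \<noteq> 0" using that(1,2) by simp
        then have "- s * m / (f * a * b * (P * m)) = - s / (f * a * b * P)" if "m = b + 2 * a" for m using that by simp
        then show ?thesis by (simp add: mult_ac)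
      qed
      finally show ?thesis .
    qed
    from this[of "real (Suc i)" "real (2 * k + 1)" "real (2 * k + 3)" "fact i" "(-1) ^ i"]
    have e: "bess_coeff (Suc k) (Suc i) - ?c * bess_coeff (Suc (Suc k)) i = bess_coeff k (Suc i)"
      unfolding k1 k2 k3 using PQ by (simp add: algebra_simps)
    show ?thesis unfolding Suc g_def nat.case e[symmetric] left_diff_distrib ..
  qed
  ultimately have "(\<lambda>j. bess_coeff k j * u ^ j) sums (bess (Suc k) u - ?c * u * bess (Suc (Suc k)) u)" by simp
  then show ?thesis using sums_unique2[OF bess_sums[of k u]] by simp
qed

text \<open>Splitting the factorials of \<open>2 * j\<close> and \<open>2 * j + 1\<close> into even
  and odd factors turns the cosine and sine series into those of \<open>bess\<close>.\<close>

lemma bess_base: "bess 0 (\<theta>\<^sup>2 / 2) = cos \<theta>" "\<theta> \<noteq> 0 \<Longrightarrow> bess 1 (\<theta>\<^sup>2 / 2) = sin \<theta> / \<theta>"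
proof -
  have f: "fact (2 * j) = 2 ^ j * (fact j * (\<Prod>i<j. real (2 * (0 + i) + 1)))" for j
    by (induction j) (auto simp: algebra_simps)
  have f1: "fact (2 * j + 1) = 2 ^ j * (fact j * (\<Prod>i<j. real (2 * (1 + i) + 1)))" for j
    by (induction j) (auto simp: algebra_simps)
  have "(\<lambda>j. (-1) ^ j / fact (2 * j) * \<theta> ^ (2 * j)) sums cos \<theta>" by (rule cos_paired)
  moreover have "(-1) ^ j / fact (2 * j) * \<theta> ^ (2 * j) = bess_coeff 0 j * (\<theta>\<^sup>2 / 2) ^ j" for j
    unfolding f bess_coeff_def by (simp add: power_mult power_divide)
  ultimately show "bess 0 (\<theta>\<^sup>2 / 2) = cos \<theta>" using sums_unique2[OF bess_sums[of 0 "\<theta>\<^sup>2 / 2"]] by simp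
  assume \<theta>: "\<theta> \<noteq> 0"
  have "(\<lambda>j. (-1) ^ j / fact (2 * j + 1) * \<theta> ^ (2 * j + 1) / \<theta>) sums (sin \<theta> / \<theta>)" by (intro sums_divide sin_paired)
  moreover have "(-1) ^ j / fact (2 * j + 1) * \<theta> ^ (2 * j + 1) / \<theta> = bess_coeff 1 j * (\<theta>\<^sup>2 / 2) ^ j" for j
    unfolding f1 bess_coeff_def using \<theta> by (simp add: power_mult power_divide)
  ultimately show "bess 1 (\<theta>\<^sup>2 / 2) = sin \<theta> / \<theta>" using sums_unique2[OF bess_sums[of 1 "\<theta>\<^sup>2 / 2"]] by simp
qed

text \<open>Descending induction from large indices, where all values are near 1. The condition
  \<open>\<theta> \<le> k\<close> makes the recurrence coefficient at most 1/4; since the invariant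
  bounds the next value by twice the current one, at most half of the leading term is lost and the
  invariant persists.\<close>

lemma bess_pos:
  assumes \<theta>: "0 \<le> \<theta>" "\<theta> \<le> real k"
  shows "bess k (\<theta>\<^sup>2 / 2) > 0"
proof -
  let ?u = "\<theta>\<^sup>2 / 2"
  define P where "P j \<longleftrightarrow> bess j ?u > 0 \<and> 0 < bess (Suc j) ?u \<and> bess (Suc j) ?u \<le> 2 * bess j ?u" for j
  have step: "P j" if "P (Suc j)" "j \<ge> k" for j
  proof -
    define B1 where "B1 = bess (Suc j) ?u"
    define B2 where "B2 = bess (Suc (Suc j)) ?u"
    have B: "B1 > 0" "B2 \<le> 2 * B1" "B2 > 0" using that(1) by (auto simp: P_def B1_def B2_def)
    have "\<theta>\<^sup>2 \<le> (real j)\<^sup>2" using \<theta> that(2) by (intro power_mono) auto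
    then have "2 * ?u \<le> 1 / 4 * (real (2 * j + 1) * real (2 * j + 3))"
      by (simp add: power2_eq_square algebra_simps)
    then have "2 * ?u / (real (2 * j + 1) * real (2 * j + 3)) \<le> 1 / 4"
      by (subst pos_divide_le_eq) auto
    then have "2 * ?u / (real (2 * j + 1) * real (2 * j + 3)) * B2 \<le> 1 / 4 * (2 * B1)"
      using B by (intro mult_mono) auto
    then have "bess j ?u \<ge> B1 / 2" using bess_rec[of j ?u] by (simp add: B1_def B2_def)
    then show ?thesis using B by (simp add: P_def B1_def B2_def)
  qed
  have "(\<lambda>j. exp (\<bar>?u\<bar> / real (2 * j + 1)) - 1) \<longlonglongrightarrow> 0" by real_asymp
  then have "eventually (\<lambda>j. exp (\<bar>?u\<bar> / real (2 * j + 1)) - 1 < 1 / 4) sequentially"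
    by (rule order_tendstoD) simp
  then obtain J where J: "\<And>j. j \<ge> J \<Longrightarrow> exp (\<bar>?u\<bar> / real (2 * j + 1)) - 1 < 1 / 4"
    unfolding eventually_sequentially by blast
  have base: "P j" if j: "j \<ge> J" for j
    using bess_near_1[of j ?u] bess_near_1[of "Suc j" ?u] J[OF j] J[of "Suc j"] j by (auto simp: P_def abs_le_iff)
  have "P k"
    by (rule inc_induct[of k "max J k" P]) (auto intro: base step)
  then show ?thesis by (simp add: P_def)
qed

text \<open>Poisson's integral over the upper half of the segment from \<open>-\<i>\<close> to \<open>\<i>\<close> may start at the saddle point \<open>-1\<close>
  instead of \<open>0\<close>, because only imaginary parts matter and the integrands are real on the real axis.\<close>
definition bess_int :: "(complex \<Rightarrow> complex) \<Rightarrow> real" where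
  "bess_int g = Im (contour_integral (linepath (-1) \<i>) g)"

section \<open>Poisson integrals and their recurrences\<close>

lemma bess_int_linear:
  assumes "continuous_on UNIV f" "continuous_on UNIV g"
  shows "bess_int (\<lambda>y. of_real a * f y + of_real b * g y) = a * bess_int f + b * bess_int g"
proof -
  have i: "f contour_integrable_on linepath (-1) \<i>" "g contour_integrable_on linepath (-1) \<i>"
    using assms by (auto intro!: contour_integrable_continuous_linepath intro: continuous_on_subset)
  have "contour_integral (linepath (-1) \<i>) (\<lambda>y. of_real a * f y + of_real b * g y)
     = of_real a * contour_integral (linepath (-1) \<i>) f + of_real b * contour_integral (linepath (-1) \<i>) g"
    using i by (simp add: contour_integral_add contour_integrable_lmul contour_integral_lmul)
  then show ?thesis by (simp add: bess_int_def)
qed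

lemma bess_int_FTC:
  assumes "\<And>y. (F has_field_derivative f y) (at y)"
  shows "bess_int f = Im (F \<i>) - Im (F (-1))"
proof -
  have "(f has_contour_integral (F (pathfinish (linepath (-1) \<i>)) - F (pathstart (linepath (-1) \<i>)))) (linepath (-1) \<i>)"
    by (rule contour_integral_primitive[where S = UNIV]) (use assms in auto)
  then show ?thesis by (simp add: bess_int_def contour_integral_unique)
qed

definition bessK :: "nat \<Rightarrow> real \<Rightarrow> real" where
  "bessK m \<theta> = bess_int (\<lambda>y. ((1 + y\<^sup>2) / 2) ^ m * exp (of_real \<theta> * y))"

text \<open>The \<open>\<theta>\<close>-derivative of \<open>bessK m\<close>; the two families close
  up under integration by parts.\<close>

definition bessL :: "nat \<Rightarrow> real \<Rightarrow> real" where
  "bessL m \<theta> = bess_int (\<lambda>y. ((1 + y\<^sup>2) / 2) ^ m * y * exp (of_real \<theta> * y))"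

lemma DERIV_half_power:
  "((\<lambda>y::complex. ((1 + y\<^sup>2) / 2) ^ Suc m) has_field_derivative of_nat (Suc m) * (y * ((1 + y\<^sup>2) / 2) ^ m)) (at y)"
proof -
  have "((\<lambda>y::complex. (1 + y\<^sup>2) / 2) has_field_derivative y) (at y)" by (auto intro!: derivative_eq_intros)
  from DERIV_power_Suc[OF this, of m] show ?thesis by simp
qed

lemma DERIV_exp_mult: "((\<lambda>y::complex. exp (c * y)) has_field_derivative c * exp (c * y)) (at y)"
  by (auto intro!: derivative_eq_intros)

text \<open>Integrates the derivative of
  \<open>((1 + y\<^sup>2) / 2) ^ Suc m * exp (\<theta> * y)\<close>. This primitive vanishes at
  \<open>\<i>\<close> and is real at \<open>-1\<close>, so the boundary terms leave nothing in the
  imaginary part.\<close>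

lemma bessL_rec: "real (Suc m) * bessL m \<theta> + \<theta> * bessK (Suc m) \<theta> = 0"
proof -
  let ?P = "\<lambda>y::complex. (1 + y\<^sup>2) / 2"
  have "bess_int (\<lambda>y. of_real (real (Suc m)) * (?P y ^ m * y * exp (of_real \<theta> * y)) + of_real \<theta> * (?P y ^ Suc m * exp (of_real \<theta> * y)))
     = Im (?P \<i> ^ Suc m * exp (of_real \<theta> * \<i>)) - Im (?P (-1) ^ Suc m * exp (of_real \<theta> * (-1)))"
  proof (rule bess_int_FTC[where F = "\<lambda>y. ?P y ^ Suc m * exp (of_real \<theta> * y)"])
    show "((\<lambda>y. ?P y ^ Suc m * exp (of_real \<theta> * y)) has_field_derivative
      of_real (real (Suc m)) * (?P y ^ m * y * exp (of_real \<theta> * y)) + of_real \<theta> * (?P y ^ Suc m * exp (of_real \<theta> * y))) (at y)" for y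
      by (rule DERIV_cong[OF DERIV_mult[OF DERIV_half_power DERIV_exp_mult]]) (simp only: mult_ac of_real_of_nat_eq)
  qed
  also have "\<dots> = 0" by (simp add: Im_exp)
  finally show ?thesis
    unfolding bessK_def bessL_def by (subst (asm) bess_int_linear) (auto intro!: continuous_intros)
qed

text \<open>The same with an additional factor \<open>y\<close> in the primitive; with
  \<open>P = (1 + y\<^sup>2) / 2\<close>, the relation \<open>y\<^sup>2 = 2 * P - 1\<close> brings
  the resulting integrand back to the two families.\<close>

lemma bessK_rec: "real (2 * m + 3) * bessK (Suc m) \<theta> - real (Suc m) * bessK m \<theta> + \<theta> * bessL (Suc m) \<theta> = 0"
proof -
  let ?P = "\<lambda>y::complex. (1 + y\<^sup>2) / 2"
  let ?f = "\<lambda>y. of_real (real (2 * m + 3)) * (?P y ^ Suc m * exp (of_real \<theta> * y)) + of_real (- real (Suc m)) * (?P y ^ m * exp (of_real \<theta> * y))"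
  have "bess_int (\<lambda>y. of_real 1 * ?f y + of_real \<theta> * (?P y ^ Suc m * y * exp (of_real \<theta> * y)))
     = Im (?P \<i> ^ Suc m * \<i> * exp (of_real \<theta> * \<i>)) - Im (?P (-1) ^ Suc m * (-1) * exp (of_real \<theta> * (-1)))"
  proof (rule bess_int_FTC[where F = "\<lambda>y. ?P y ^ Suc m * y * exp (of_real \<theta> * y)"])
    fix y :: complex
    let ?E = "exp (of_real \<theta> * y)"
    have key: "of_nat (Suc m) * (y * ?P y ^ m) * y = of_nat (Suc m) * (2 * ?P y ^ Suc m - ?P y ^ m)"
    proof -
      have "y * ?P y ^ m * y = 2 * ?P y ^ Suc m - ?P y ^ m"
        by (simp add: power2_eq_square algebra_simps)
      then show ?thesis by (simp only: mult.assoc)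
    qed
    have alg: "(of_nat (Suc m) * (2 * X - Y) + 1 * X) * E + c * E * (X * y)
      = of_real 1 * (of_real (real (2 * m + 3)) * (X * E) + of_real (- real (Suc m)) * (Y * E)) + c * (X * y * E)" for X Y E c :: complex
      by (simp add: algebra_simps)
    show "((\<lambda>y. ?P y ^ Suc m * y * exp (of_real \<theta> * y)) has_field_derivative
       of_real 1 * ?f y + of_real \<theta> * (?P y ^ Suc m * y * exp (of_real \<theta> * y))) (at y)"
      by (rule DERIV_cong[OF DERIV_mult[OF DERIV_mult[OF DERIV_half_power DERIV_ident] DERIV_exp_mult]])
         (simp only: key alg)
  qed
  also have "\<dots> = 0" by (simp add: Im_exp)
  finally have "1 * bess_int ?f + \<theta> * bessL (Suc m) \<theta> = 0"
    unfolding bessL_def by (subst (asm) bess_int_linear) (auto intro!: continuous_intros)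
  also have "bess_int ?f = real (2 * m + 3) * bessK (Suc m) \<theta> + (- real (Suc m)) * bessK m \<theta>"
    unfolding bessK_def by (rule bess_int_linear) (auto intro!: continuous_intros)
  finally show ?thesis by (simp add: algebra_simps)
qed

text \<open>With exponent 0 the primitive no longer vanishes at \<open>\<i>\<close>, and its value
  there supplies the sine and the cosine.\<close>

lemma bessK_0: "\<theta> * bessK 0 \<theta> = sin \<theta>" "bessK 0 \<theta> + \<theta> * bessL 0 \<theta> = cos \<theta>"
proof -
  have "bess_int (\<lambda>y. of_real \<theta> * exp (of_real \<theta> * y) + of_real 0 * 0) = Im (exp (of_real \<theta> * \<i>)) - Im (exp (of_real \<theta> * (-1)))"
    by (rule bess_int_FTC) (auto intro!: derivative_eq_intros)
  then show "\<theta> * bessK 0 \<theta> = sin \<theta>"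
    unfolding bessK_def by (subst (asm) bess_int_linear) (auto intro!: continuous_intros simp: Im_exp)
  have "bess_int (\<lambda>y. of_real 1 * exp (of_real \<theta> * y) + of_real \<theta> * (y * exp (of_real \<theta> * y))) = Im (\<i> * exp (of_real \<theta> * \<i>)) - Im ((-1) * exp (of_real \<theta> * (-1)))"
    by (rule bess_int_FTC) (auto intro!: derivative_eq_intros simp: algebra_simps)
  then show "bessK 0 \<theta> + \<theta> * bessL 0 \<theta> = cos \<theta>"
    unfolding bessK_def bessL_def by (subst (asm) bess_int_linear) (auto intro!: continuous_intros simp: Im_exp Re_exp)
qed

text \<open>In closed form \<open>(2 m + 1)!! / m!\<close>.\<close>

fun bess_const :: "nat \<Rightarrow> real" where
  "bess_const 0 = 1"
| "bess_const (Suc m) = bess_const m * real (2 * m + 3) / real (Suc m)"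

lemma bess_const_pos: "bess_const m > 0"
  by (induction m) auto

text \<open>Eliminating \<open>bessL\<close> from the two integrations by parts leaves a three-term
  recurrence for \<open>bessK\<close>, which is \<open>bess_rec\<close> up to the factors collected
  in \<open>bess_const\<close>. Indices 0 and 1 are matched through sine and cosine.\<close>

lemma bess_eq_bessK:
  assumes \<theta>: "\<theta> > 0"
  shows "bess (Suc m) (\<theta>\<^sup>2 / 2) = bess_const m * bessK m \<theta>"
proof (induction m rule: less_induct)
  case (less m)
  consider "m = 0" | "m = 1" | n where "m = Suc (Suc n)" by (metis One_nat_def not0_implies_Suc)
  then show ?case
  proof cases
    case 1
    have "\<theta> * bess 1 (\<theta>\<^sup>2 / 2) = \<theta> * bessK 0 \<theta>" using bess_base(2)[of \<theta>] bessK_0(1)[of \<theta>] \<theta> by simp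
    then show ?thesis using 1 \<theta> by simp
  next
    case 2
    have "\<theta> * bess 1 (\<theta>\<^sup>2 / 2) = \<theta> * bessK 0 \<theta>" using bess_base(2)[of \<theta>] bessK_0(1)[of \<theta>] \<theta> by simp
    then have b1: "bess 1 (\<theta>\<^sup>2 / 2) = bessK 0 \<theta>" using \<theta> by simp
    have "bessL 0 \<theta> = - \<theta> * bessK 1 \<theta>" using bessL_rec[of 0 \<theta>] by simp
    then have "bessK 0 \<theta> - \<theta>\<^sup>2 * bessK 1 \<theta> = cos \<theta>" using bessK_0(2)[of \<theta>] by (simp add: power2_eq_square)
    moreover have "cos \<theta> = bess 1 (\<theta>\<^sup>2 / 2) - \<theta>\<^sup>2 / 3 * bess 2 (\<theta>\<^sup>2 / 2)"
      using bess_rec[of 0 "\<theta>\<^sup>2 / 2"] bess_base(1)[of \<theta>] by (simp add: numeral_2_eq_2)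
    ultimately have "\<theta>\<^sup>2 * bessK 1 \<theta> = \<theta>\<^sup>2 * (bess 2 (\<theta>\<^sup>2 / 2) / 3)" using b1 by simp
    then have "bessK 1 \<theta> = bess 2 (\<theta>\<^sup>2 / 2) / 3" using \<theta> by (subst (asm) mult_left_cancel) auto
    then show ?thesis using 2 by (simp add: numeral_2_eq_2)
  next
    case 3
    let ?u = "\<theta>\<^sup>2 / 2"
    define a where "a = real (2 * n + 3)"
    define b where "b = real (2 * n + 5)"
    define s where "s = real (Suc n)"
    define r where "r = real (Suc (Suc n))"
    have pos: "a > 0" "b > 0" "s > 0" "r > 0" by (simp_all add: a_def b_def s_def r_def)
    have IH: "bess (Suc n) ?u = bess_const n * bessK n \<theta>"
      "bess (Suc (Suc n)) ?u = bess_const n * a / s * bessK (Suc n) \<theta>"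
      using less[of n] less[of "Suc n"] 3 by (simp_all add: a_def s_def)
    have B: "bess (Suc n) ?u = bess (Suc (Suc n)) ?u - \<theta>\<^sup>2 / (a * b) * bess (Suc (Suc (Suc n))) ?u"
      using bess_rec[of "Suc n" ?u] by (simp add: a_def b_def algebra_simps)
    have L: "bessL (Suc n) \<theta> = - (\<theta> / r) * bessK (Suc (Suc n)) \<theta>"
      using bessL_rec[of "Suc n" \<theta>] pos by (simp add: r_def[symmetric] field_simps del: of_nat_Suc)
    have K: "s * bessK n \<theta> = a * bessK (Suc n) \<theta> - \<theta>\<^sup>2 / r * bessK (Suc (Suc n)) \<theta>"
      using bessK_rec[of n \<theta>] unfolding L by (simp add: a_def s_def power2_eq_square algebra_simps)
    have K': "bessK n \<theta> = a / s * bessK (Suc n) \<theta> - \<theta>\<^sup>2 / (r * s) * bessK (Suc (Suc n)) \<theta>"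
    proof -
      have "bessK n \<theta> = (s * bessK n \<theta>) / s" using pos by simp
      also have "\<dots> = a / s * bessK (Suc n) \<theta> - \<theta>\<^sup>2 / (r * s) * bessK (Suc (Suc n)) \<theta>"
        unfolding K by (simp add: diff_divide_distrib)
      finally show ?thesis .
    qed
    have "\<theta>\<^sup>2 / (a * b) * bess (Suc (Suc (Suc n))) ?u = bess_const n * (\<theta>\<^sup>2 / (r * s) * bessK (Suc (Suc n)) \<theta>)"
      using B unfolding IH unfolding K' by (simp add: algebra_simps)
    also have "\<dots> = \<theta>\<^sup>2 / (a * b) * (bess_const n * a / s * b / r * bessK (Suc (Suc n)) \<theta>)"
      using pos by (simp add: field_simps)
    finally have "bess (Suc (Suc (Suc n))) ?u = bess_const n * a / s * b / r * bessK (Suc (Suc n)) \<theta>"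
      using \<theta> pos by (subst (asm) mult_left_cancel) auto
    then show ?thesis unfolding 3 by (simp add: a_def b_def s_def r_def)
  qed
qed

text \<open>Along \<open>y = -1 + v\<close> one has \<open>(1 + y\<^sup>2)/2 = 1 - v + v\<^sup>2/2\<close>; the segment from \<open>-1\<close> to \<open>\<i>\<close> has slope 1 and
  is exhausted at \<open>\<epsilon> t = 1\<close>.\<close>
definition bess_kernel :: "nat \<Rightarrow> real \<Rightarrow> real \<Rightarrow> complex" where
  "bess_kernel k \<epsilon> t = (if \<epsilon> * t \<le> 1 then
     (let v = of_real \<epsilon> * d45 * of_real t in (1 - v + v\<^sup>2 / 2) ^ k * exp (of_nat k * v)) else 0)"

text \<open>At \<open>v = u * d45\<close> the quadratic \<open>1 - v + v\<^sup>2 / 2\<close> factors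
  as \<open>(1 - u) * (1 - i u)\<close>, so the left side is the real part of its logarithm plus
  \<open>v\<close>. The right side is the exact leading term \<open>Re (v ^ 3) / 6\<close>.\<close>

lemma bess_ln_phase_le:
  assumes "0 \<le> (u::real)" "u < 1"
  shows "ln (1 - u) + ln (1 + u\<^sup>2) / 2 + u \<le> - (u ^ 3 / 3)"
proof -
  define L where "L = (\<lambda>u::real. ln (1 - u))"
  define R where "R = (\<lambda>u::real. ln (1 + u\<^sup>2))"
  define p where "p = (\<lambda>u::real. L u + 1 / 2 * R u + u + 1 / 3 * u ^ 3)"
  have "p u \<le> p 0"
  proof (rule DERIV_nonpos_imp_nonincreasing[OF assms(1)])
    fix x :: real assume x: "0 \<le> x" "x \<le> u"
    have x1: "1 - x > 0" using x assms by simp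
    have q: "1 + x\<^sup>2 > 0" by (simp add: add_pos_nonneg)
    define l where "l = - 1 / (1 - x)"
    define r where "r = 2 * x / (1 + x\<^sup>2)"
    have DL: "(L has_real_derivative l) (at x)"
      unfolding L_def l_def using x1 by (auto intro!: derivative_eq_intros simp: divide_simps)
    have DR: "(R has_real_derivative r) (at x)"
      unfolding R_def r_def using q by (auto intro!: derivative_eq_intros simp: divide_simps)
    have "(p has_real_derivative l + 1 / 2 * r + 1 + x\<^sup>2) (at x)"
      unfolding p_def by (auto intro!: derivative_eq_intros DL DR simp: power2_eq_square)
    moreover have "l + 1 / 2 * r + 1 + x\<^sup>2 \<le> 0"
    proof -
      have "l + 1 / 2 * r + 1 = - (x\<^sup>2 * ((1 + x) / ((1 - x) * (1 + x\<^sup>2))))"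
        unfolding l_def r_def using x1 q by (simp add: divide_simps) (simp add: power2_eq_square algebra_simps)
      moreover have "x\<^sup>2 * 1 \<le> x\<^sup>2 * ((1 + x) / ((1 - x) * (1 + x\<^sup>2)))"
      proof (rule mult_left_mono)
        have "(1 - x) * (1 + x\<^sup>2) \<le> 1 * (1 + x)"
        proof -
          have "x\<^sup>2 \<le> x" using x assms by (simp add: power2_eq_square mult_left_le)
          then have "(1 - x) * (1 + x\<^sup>2) \<le> 1 * (1 + x)" using x x1 by (intro mult_mono) auto
          then show ?thesis .
        qed
        then show "1 \<le> (1 + x) / ((1 - x) * (1 + x\<^sup>2))" using x1 q by (subst pos_le_divide_eq) auto
      qed auto
      ultimately show ?thesis by simp
    qed
    ultimately show "\<exists>y. (p has_real_derivative y) (at x) \<and> y \<le> 0" by blast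
  qed
  then show ?thesis by (simp add: p_def L_def R_def)
qed

lemma quadratic_d45_factor: "1 - of_real u * d45 + (of_real u * d45)\<^sup>2 / 2 = of_real (1 - u) * Complex 1 (- u)"
  by (simp add: d45_def complex_eq_iff power2_eq_square algebra_simps)

lemma norm_quadratic_d45: "norm (1 - of_real u * d45 + (of_real u * d45)\<^sup>2 / 2) = \<bar>1 - u\<bar> * sqrt (1 + u\<^sup>2)"
  unfolding quadratic_d45_factor norm_mult by (simp add: cmod_def)

text \<open>The derivative of \<open>G\<close> is \<open>v\<^sup>2\<close> over the quadratic; the
  factor 2 in \<open>G\<close> normalises the leading term to \<open>v ^ 3 / 3\<close> and is
  compensated later by \<open>N = k / 2\<close>. Restricting to the first half of the segment keeps
  the modulus of the quadratic at least 1/2, away from its zero at parameter 1.\<close>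

lemma bess_log_phase:
  assumes u0: "0 \<le> u0" "u0 \<le> 1 / 2"
  defines "v0 \<equiv> of_real u0 * d45"
  defines "G \<equiv> \<lambda>v. 2 * (Ln (1 - v + v\<^sup>2 / 2) + v)"
  shows "norm (G v0 - v0 ^ 3 / 3) \<le> 4 * norm v0 ^ 4" and "norm (G v0 - v0 ^ 3 / 3 - v0 ^ 4 / 4) \<le> 4 * norm v0 ^ 5"
proof -
  let ?S = "closed_segment 0 v0"
  let ?P = "\<lambda>v::complex. 1 - v + v\<^sup>2 / 2"
  have S: "norm v \<le> norm v0 \<and> norm v \<le> 1 \<and> norm (?P v) \<ge> 1 / 2 \<and> Re (?P v) > 0" if v: "v \<in> ?S" for v
  proof -
    obtain s where s: "0 \<le> s" "s \<le> 1" "v = (1 - s) *\<^sub>R 0 + s *\<^sub>R v0"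
      using v unfolding in_segment by blast
    define u where "u = s * u0"
    have vu: "v = of_real u * d45" unfolding s(3) v0_def u_def by (simp add: scaleR_conv_of_real)
    have "s * u0 \<le> 1 * u0" using s u0 by (intro mult_right_mono) auto
    then have u: "0 \<le> u" "u \<le> u0" "u \<le> 1 / 2" using s u0 by (auto simp: u_def)
    have nv: "norm v = u * sqrt 2" "norm v0 = u0 * sqrt 2" using u u0 by (simp_all add: vu v0_def norm_mult d45_pow)
    have s2: "sqrt 2 \<le> 2" using real_sqrt_le_iff[of 2 4] by simp
    have "u * sqrt 2 \<le> 1 / 2 * 2" using u s2 by (intro mult_mono) auto
    moreover have "1 / 2 * 1 \<le> \<bar>1 - u\<bar> * sqrt (1 + u\<^sup>2)" using u by (intro mult_mono) auto
    moreover have "Re (?P v) = 1 - u" unfolding vu quadratic_d45_factor by simp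
    ultimately show ?thesis using nv u unfolding vu norm_quadratic_d45 by (auto simp: vu mult_right_mono)
  qed
  have D: "(G has_field_derivative v\<^sup>2 / ?P v) (at v within ?S)" if v: "v \<in> ?S" for v
  proof -
    have Pn: "?P v \<notin> \<real>\<^sub>\<le>\<^sub>0" using S[OF v] by (auto simp: complex_nonpos_Reals_iff)
    have Pz: "?P v \<noteq> 0" using S[OF v] by auto
    have "(G has_field_derivative 2 * ((v - 1) / ?P v + 1)) (at v within ?S)"
      unfolding G_def using Pn by (auto intro!: derivative_eq_intros simp: inverse_eq_divide)
    moreover have "2 * ((v - 1) / ?P v + 1) = v\<^sup>2 / ?P v"
    proof -
      have "2 * ((v - 1) / p + 1) = v\<^sup>2 / p" if "p \<noteq> 0" "2 * (v - 1 + p) = v\<^sup>2" for p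
        using that by (simp add: divide_simps algebra_simps)
      from this[OF Pz] show ?thesis by (simp add: algebra_simps)
    qed
    ultimately show ?thesis by simp
  qed
  have G0: "G 0 = 0" by (simp add: G_def)
  have "norm ((G v0 - v0 ^ 3 / 3) - (G 0 - 0 ^ 3 / 3)) \<le> (4 * norm v0 ^ 3) * norm (v0 - 0)"
  proof (rule field_differentiable_bound[where S = ?S])
    fix v assume v: "v \<in> ?S"
    show "((\<lambda>v. G v - v ^ 3 / 3) has_field_derivative v\<^sup>2 / ?P v - v\<^sup>2) (at v within ?S)"
      by (auto intro!: derivative_eq_intros D[OF v])
    have Pz: "?P v \<noteq> 0" using S[OF v] by auto
    have e: "v\<^sup>2 / ?P v - v\<^sup>2 = v ^ 3 * (1 - v / 2) / ?P v"
    proof -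
      have "v\<^sup>2 / p - v\<^sup>2 = v\<^sup>2 * (1 - p) / p" if "p \<noteq> 0" for p
        using that by (simp add: divide_simps algebra_simps)
      from this[OF Pz] show ?thesis by (simp add: power2_eq_square power3_eq_cube algebra_simps)
    qed
    have "norm (v\<^sup>2 / ?P v - v\<^sup>2) = norm v ^ 3 * norm (1 - v / 2) / norm (?P v)"
      unfolding e by (simp only: norm_mult norm_divide norm_power)
    also have "\<dots> \<le> norm v0 ^ 3 * 2 / (1 / 2)"
    proof (intro frac_le mult_mono power_mono)
      show "norm (1 - v / 2) \<le> 2" using norm_triangle_ineq4[of 1 "v / 2"] S[OF v] by (simp add: norm_divide)
    qed (use S[OF v] in auto)
    finally show "norm (v\<^sup>2 / ?P v - v\<^sup>2) \<le> 4 * norm v0 ^ 3" by simp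
  qed auto
  then show "norm (G v0 - v0 ^ 3 / 3) \<le> 4 * norm v0 ^ 4" by (simp add: G0 eval_nat_numeral mult_ac)
  have "norm ((G v0 - v0 ^ 3 / 3 - v0 ^ 4 / 4) - (G 0 - 0 ^ 3 / 3 - 0 ^ 4 / 4)) \<le> (4 * norm v0 ^ 4) * norm (v0 - 0)"
  proof (rule field_differentiable_bound[where S = ?S])
    fix v assume v: "v \<in> ?S"
    show "((\<lambda>v. G v - v ^ 3 / 3 - v ^ 4 / 4) has_field_derivative v\<^sup>2 / ?P v - v\<^sup>2 - v ^ 3) (at v within ?S)"
      by (auto intro!: derivative_eq_intros D[OF v])
    have Pz: "?P v \<noteq> 0" using S[OF v] by auto
    have e: "v\<^sup>2 / ?P v - v\<^sup>2 - v ^ 3 = v ^ 4 * ((1 - v) / 2) / ?P v"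
    proof -
      have "v\<^sup>2 / p - v\<^sup>2 - v ^ 3 = v\<^sup>2 * (1 - p - v * p) / p" if "p \<noteq> 0" for p
        using that by (simp add: divide_simps power2_eq_square power3_eq_cube algebra_simps)
      note this[OF Pz]
      also have "v\<^sup>2 * (1 - ?P v - v * ?P v) = v ^ 4 * ((1 - v) / 2)" by (simp add: eval_nat_numeral algebra_simps)
      finally show ?thesis .
    qed
    have "norm (v\<^sup>2 / ?P v - v\<^sup>2 - v ^ 3) = norm v ^ 4 * norm ((1 - v) / 2) / norm (?P v)"
      unfolding e by (simp only: norm_mult norm_divide norm_power)
    also have "\<dots> \<le> norm v0 ^ 4 * 2 / (1 / 2)"
    proof (intro frac_le mult_mono power_mono)
      show "norm ((1 - v) / 2) \<le> 2" using norm_triangle_ineq4[of 1 v] S[OF v] by (simp add: norm_divide)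
    qed (use S[OF v] in auto)
    finally show "norm (v\<^sup>2 / ?P v - v\<^sup>2 - v ^ 3) \<le> 4 * norm v0 ^ 4" by simp
  qed auto
  then show "norm (G v0 - v0 ^ 3 / 3 - v0 ^ 4 / 4) \<le> 4 * norm v0 ^ 5" by (simp add: G0 eval_nat_numeral mult_ac)
qed

lemma bess_int_lebesgue:
  assumes c: "continuous_on UNIV f"
  shows "bess_int f = Im (LINT s:{0..1}|lborel. f (-1 + d45 * of_real s) * d45)"
proof -
  have "f contour_integrable_on linepath (-1) \<i>"
    using c by (intro contour_integrable_continuous_linepath) (auto intro: continuous_on_subset)
  then have "(f has_contour_integral contour_integral (linepath (-1) \<i>) f) (linepath (-1) \<i>)"
    by (rule has_contour_integral_integral)
  then have "((\<lambda>s. f (linepath (-1) \<i> s) * (\<i> - (-1))) has_integral contour_integral (linepath (-1) \<i>) f) {0..1}"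
    unfolding has_contour_integral_linepath .
  moreover have "linepath (-1) \<i> s = -1 + d45 * of_real s" for s
    by (simp add: linepath_def d45_def complex_eq_iff)
  moreover have "\<i> - (-1) = d45" by (simp add: d45_def complex_eq_iff)
  ultimately have "((\<lambda>s. f (-1 + d45 * of_real s) * d45) has_integral contour_integral (linepath (-1) \<i>) f) {0..1}"
    by simp
  then have "contour_integral (linepath (-1) \<i>) f = integral {0..1} (\<lambda>s. f (-1 + d45 * of_real s) * d45)"
    by (rule integral_unique[symmetric])
  also have "\<dots> = (LINT s:{0..1}|lborel. f (-1 + d45 * of_real s) * d45)"
    by (rule set_borel_integral_eq_integral(2)[symmetric], rule borel_integrable_atLeastAtMost')
       (intro continuous_intros continuous_on_compose2[OF c], auto)
  finally show ?thesis by (simp add: bess_int_def)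
qed

lemma set_integral_Icc_scale:
  fixes h :: "real \<Rightarrow> complex"
  assumes "\<epsilon> > 0"
  shows "(LINT s:{0..1}|lborel. h s) = of_real \<epsilon> * (LINT t:{0..}|lborel. if \<epsilon> * t \<le> 1 then h (\<epsilon> * t) else 0)"
proof -
  have "(LINT s:{0..1}|lborel. h s) = (LINT s:{0..}|lborel. if s \<le> 1 then h s else 0)"
    unfolding set_lebesgue_integral_def
    by (rule Bochner_Integration.integral_cong) (auto simp: indicator_def)
  also have "\<dots> = \<epsilon> *\<^sub>R (LINT t:{0..}|lborel. if \<epsilon> * t \<le> 1 then h (\<epsilon> * t) else 0)"
    by (rule set_integral_Ici_scale[OF assms])
  finally show ?thesis by (simp add: scaleR_conv_of_real)
qed

lemma bess_int_ray:
  assumes \<epsilon>: "\<epsilon> > 0" and c: "continuous_on UNIV f"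
  shows "bess_int f = Im (of_real \<epsilon> * (LINT t:{0..}|lborel. if \<epsilon> * t \<le> 1 then f (-1 + d45 * of_real (\<epsilon> * t)) * d45 else 0))"
  unfolding bess_int_lebesgue[OF c] set_integral_Icc_scale[OF \<epsilon>] ..

text \<open>For \<open>\<theta> = k\<close> the point \<open>-1\<close> is a double saddle; the
  deviation \<open>- z / \<epsilon>\<close> contributes \<open>- z p\<close> to the exponent. Since
  \<open>1 + y = v = \<epsilon> p\<close>, adding \<open>bessK\<close> to \<open>bessL\<close>
  inserts exactly one factor \<open>\<epsilon> p\<close>, and at a zero of \<open>bessK\<close> the
  sum is \<open>bessL\<close> itself.\<close>

lemma bess_airy_ray:
  assumes \<epsilon>: "\<epsilon> > 0" and \<theta>: "\<theta> = real k - z / \<epsilon>"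
  shows "bessK k \<theta> = \<epsilon> * exp (- \<theta>) * pi * airy_ray d45 (bess_kernel k \<epsilon>) 0 z"
    and "bessL k \<theta> + bessK k \<theta> = - (\<epsilon>\<^sup>2 * exp (- \<theta>) * pi * airy_ray d45 (bess_kernel k \<epsilon>) 1 z)"
proof -
  let ?P = "\<lambda>y::complex. (1 + y\<^sup>2) / 2"
  define g where "g j t = d45 * (- (d45 * of_real t)) ^ j * exp (- (of_real z * (d45 * of_real t))) * bess_kernel k \<epsilon> t" for j t
  have ImR: "Im (of_real a * w) = a * Im w" for a w by simp
  have Ai: "Im (LINT t:{0..}|lborel. g j t) = pi * airy_ray d45 (bess_kernel k \<epsilon>) j z" for j
    unfolding airy_ray_def g_def by simp
  have key: "?P (-1 + v) ^ k * exp (of_real \<theta> * (-1 + v)) = of_real (exp (- \<theta>)) *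
      ((1 - v + v\<^sup>2 / 2) ^ k * exp (of_nat k * v) * exp (- (of_real z * (d45 * of_real t))))"
    if v: "v = of_real \<epsilon> * d45 * of_real t" for v t
  proof -
    have P: "?P (-1 + v) = 1 - v + v\<^sup>2 / 2" by (simp add: power2_eq_square field_simps)
    define \<zeta> where "\<zeta> = complex_of_real (z / \<epsilon>)"
    have \<zeta>: "\<zeta> * v = of_real z * (d45 * of_real t)" using \<epsilon> by (simp add: v \<zeta>_def)
    have th: "complex_of_real \<theta> = of_nat k - \<zeta>" by (simp add: \<theta> \<zeta>_def)
    have "of_real \<theta> * (-1 + v) = of_real (- \<theta>) + of_real \<theta> * v" by (simp add: algebra_simps)
    also have "of_real \<theta> * v = of_nat k * v + - (\<zeta> * v)" unfolding th by (simp add: algebra_simps)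
    finally have "of_real \<theta> * (-1 + v) = of_real (- \<theta>) + (of_nat k * v + - (\<zeta> * v))" .
    then have "of_real \<theta> * (-1 + v) = of_real (- \<theta>) + (of_nat k * v + - (of_real z * (d45 * of_real t)))"
      unfolding \<zeta> .
    then have "exp (of_real \<theta> * (-1 + v)) = of_real (exp (- \<theta>)) * (exp (of_nat k * v) * exp (- (of_real z * (d45 * of_real t))))"
      by (simp only: exp_add exp_of_real)
    then show ?thesis unfolding P by (simp only: mult_ac)
  qed
  have v: "d45 * of_real (\<epsilon> * t) = of_real \<epsilon> * d45 * of_real t" for t by simp
  have "(if \<epsilon> * t \<le> 1 then ?P (-1 + d45 * of_real (\<epsilon> * t)) ^ k * exp (of_real \<theta> * (-1 + d45 * of_real (\<epsilon> * t))) * d45 else 0)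
      = of_real (exp (- \<theta>)) * g 0 t" for t
    unfolding v key[OF refl] g_def bess_kernel_def Let_def by (simp add: mult_ac)
  note e0 = this
  have "bessK k \<theta> = Im (of_real \<epsilon> * (LINT t:{0..}|lborel. of_real (exp (- \<theta>)) * g 0 t))"
    unfolding bessK_def e0[symmetric]
    by (rule bess_int_ray[OF \<epsilon>]) (auto intro!: continuous_intros)
  then show "bessK k \<theta> = \<epsilon> * exp (- \<theta>) * pi * airy_ray d45 (bess_kernel k \<epsilon>) 0 z"
    unfolding set_integral_mult_right ImR Ai by simp
  have "(if \<epsilon> * t \<le> 1 then ?P (-1 + d45 * of_real (\<epsilon> * t)) ^ k * (1 + (-1 + d45 * of_real (\<epsilon> * t))) * exp (of_real \<theta> * (-1 + d45 * of_real (\<epsilon> * t))) * d45 else 0)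
      = of_real (- (\<epsilon> * exp (- \<theta>))) * g 1 t" for t
  proof -
    have "?P (-1 + d45 * of_real (\<epsilon> * t)) ^ k * (1 + (-1 + d45 * of_real (\<epsilon> * t))) * exp (of_real \<theta> * (-1 + d45 * of_real (\<epsilon> * t))) * d45
      = (?P (-1 + d45 * of_real (\<epsilon> * t)) ^ k * exp (of_real \<theta> * (-1 + d45 * of_real (\<epsilon> * t)))) * (d45 * of_real (\<epsilon> * t)) * d45"
      by (simp add: mult_ac)
    then show ?thesis unfolding v key[OF refl] g_def bess_kernel_def Let_def by (simp add: mult_ac)
  qed
  note e1 = this
  have "bessL k \<theta> + bessK k \<theta> = 1 * bess_int (\<lambda>y. ?P y ^ k * y * exp (of_real \<theta> * y)) + 1 * bess_int (\<lambda>y. ?P y ^ k * exp (of_real \<theta> * y))"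
    by (simp add: bessL_def bessK_def)
  also have "\<dots> = bess_int (\<lambda>y. of_real 1 * (?P y ^ k * y * exp (of_real \<theta> * y)) + of_real 1 * (?P y ^ k * exp (of_real \<theta> * y)))"
    by (rule bess_int_linear[symmetric]) (auto intro!: continuous_intros)
  also have "\<dots> = bess_int (\<lambda>y. ?P y ^ k * (1 + y) * exp (of_real \<theta> * y))"
    by (simp add: algebra_simps)
  also have "\<dots> = Im (of_real \<epsilon> * (LINT t:{0..}|lborel. of_real (- (\<epsilon> * exp (- \<theta>))) * g 1 t))"
    unfolding e1[symmetric]
    by (rule bess_int_ray[OF \<epsilon>]) (auto intro!: continuous_intros)
  finally show "bessL k \<theta> + bessK k \<theta> = - (\<epsilon>\<^sup>2 * exp (- \<theta>) * pi * airy_ray d45 (bess_kernel k \<epsilon>) 1 z)"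
    unfolding set_integral_mult_right ImR Ai by (simp add: power2_eq_square)
qed

text \<open>The logarithm is expanded on the first half of the segment. Beyond it
  \<open>1 \<le> 2 * \<epsilon> * t\<close>, so it suffices that both kernels lie below the weight:
  multiplying by this inequality once or twice supplies the powers of
  \<open>\<epsilon>\<close>.\<close>

lemma bess_kernel_airy:
  assumes k: "k > 0" and \<epsilon>: "\<epsilon> > 0" "real k * \<epsilon> ^ 3 = 2"
  shows "airy_kernel 1 d45 \<epsilon> (bess_kernel k \<epsilon>)"
proof -
  define N where "N = real k / 2"
  have N: "N > 0" "N * \<epsilon> ^ 3 = 1" using k \<epsilon> by (simp_all add: N_def)
  have s2: "sqrt 2 \<le> 2" using real_sqrt_le_iff[of 2 4] by simp
  have d3: "Re (d45 ^ 3) \<le> -1" by (simp add: d45_pow)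
  have *: "norm (bess_kernel k \<epsilon> t - airy_exp d45 t) \<le> 10 ^ 9 * \<epsilon> * exp (3 * t - t\<^sup>2 / 4) \<and>
       norm (bess_kernel k \<epsilon> t - airy_exp d45 t - of_real (1 * \<epsilon> / 4) * (d45 * of_real t) ^ 4 * airy_exp d45 t)
         \<le> 10 ^ 9 * \<epsilon>\<^sup>2 * exp (3 * t - t\<^sup>2 / 4)" if t: "t \<ge> 0" for t
  proof -
    define u where "u = \<epsilon> * t"
    define v where "v = of_real u * d45"
    define D where "D = d45 * of_real t"
    let ?P = "1 - v + v\<^sup>2 / 2"
    let ?w = "exp (t / 2 - t\<^sup>2 / 4)"
    have u: "u \<ge> 0" using t \<epsilon> by (simp add: u_def)
    have vD: "v = of_real \<epsilon> * D" by (simp add: v_def D_def u_def mult_ac)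
    have kern: "bess_kernel k \<epsilon> t = (if u \<le> 1 then ?P ^ k * exp (of_nat k * v) else 0)"
      unfolding bess_kernel_def Let_def v_def u_def by (simp add: mult_ac)
    have cub: "- (t ^ 3 / 3) \<le> t / 2 - t\<^sup>2 / 4" using cubic_weight[OF t] by simp
    have Rebound: "real k * (ln (1 - u) + ln (1 + u\<^sup>2) / 2 + u) \<le> t / 2 - t\<^sup>2 / 4" if "u < 1"
    proof -
      have "real k * (ln (1 - u) + ln (1 + u\<^sup>2) / 2 + u) \<le> real k * (- (u ^ 3 / 3))"
        by (rule mult_left_mono[OF bess_ln_phase_le[OF u that]]) simp
      also have "\<dots> = - ((real k * \<epsilon> ^ 3) * t ^ 3 / 3)" by (simp add: u_def power_mult_distrib)
      also have "\<dots> \<le> - (t ^ 3 / 3)" unfolding \<epsilon>(2) using t by simp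
      finally show ?thesis using cub by linarith
    qed
    have lnP: "ln (norm ?P) = ln (1 - u) + ln (1 + u\<^sup>2) / 2" if "u < 1"
    proof -
      have "1 + u\<^sup>2 > 0" by (simp add: add_pos_nonneg)
      then have "ln (\<bar>1 - u\<bar> * sqrt (1 + u\<^sup>2)) = ln (1 - u) + ln (1 + u\<^sup>2) / 2"
        using that by (subst ln_mult_pos) (auto simp: ln_sqrt)
      then show ?thesis unfolding v_def norm_quadratic_d45 .
    qed
    have w: "t ^ m * ?w \<le> fact m * exp (3 * t - t\<^sup>2 / 4)" for m
    proof -
      have "t ^ m * ?w \<le> (fact m * exp t) * ?w" by (intro mult_right_mono power_le_fact_exp t) auto
      also have "\<dots> = fact m * exp (t + (t / 2 - t\<^sup>2 / 4))" unfolding exp_add by simp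
      also have "\<dots> \<le> fact m * exp (3 * t - t\<^sup>2 / 4)" using t by (intro mult_left_mono) auto
      finally show ?thesis .
    qed
    show ?thesis
    proof (cases "u \<le> 1 / 2")
      case True
      then have u1: "u < 1" by simp
      define G where "G = 2 * (Ln ?P + v)"
      define a where "a = of_real N * G"
      have Pz: "?P \<noteq> 0"
      proof
        assume "?P = 0"
        then have "norm ?P = 0" by simp
        then show False unfolding v_def norm_quadratic_d45 using u1 by (simp add: add_nonneg_eq_0_iff)
      qed
      have a: "a = of_nat k * Ln ?P + of_nat k * v" by (simp add: a_def N_def G_def algebra_simps)
      have "exp a = exp (Ln ?P) ^ k * exp (of_nat k * v)"
        unfolding a exp_add exp_of_nat_mult ..
      then have ea: "exp a = bess_kernel k \<epsilon> t" using Pz u1 by (simp add: kern)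
      have N3: "of_real N * of_real \<epsilon> ^ 3 = (1::complex)"
        using N(2) by (metis of_real_1 of_real_mult of_real_power)
      have v3: "of_real N * v ^ 3 = D ^ 3"
      proof -
        have "of_real N * v ^ 3 = (of_real N * of_real \<epsilon> ^ 3) * D ^ 3"
          unfolding vD power_mult_distrib by (simp only: mult.assoc)
        then show ?thesis unfolding N3 by simp
      qed
      have v4: "of_real N * v ^ 4 = of_real \<epsilon> * D ^ 4"
      proof -
        have "of_real N * v ^ 4 = (of_real N * v ^ 3) * v" by (simp add: eval_nat_numeral mult_ac)
        also have "\<dots> = D ^ 3 * v" unfolding v3 ..
        finally show ?thesis by (simp add: vD eval_nat_numeral mult_ac)
      qed
      have n3: "N * norm v ^ 3 = norm D ^ 3"
        using arg_cong[OF v3, of norm] N by (simp add: norm_mult norm_power)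
      have nv: "norm v = \<epsilon> * norm D" using \<epsilon> by (simp add: vD norm_mult)
      have n4: "N * norm v ^ 4 = \<epsilon> * norm D ^ 4"
      proof -
        have "N * norm v ^ 4 = (N * norm v ^ 3) * norm v" by (simp add: eval_nat_numeral mult_ac)
        also have "\<dots> = norm D ^ 3 * norm v" unfolding n3 ..
        finally show ?thesis by (simp add: nv eval_nat_numeral mult_ac)
      qed
      have n5: "N * norm v ^ 5 = \<epsilon>\<^sup>2 * norm D ^ 5"
      proof -
        have "N * norm v ^ 5 = (N * norm v ^ 3) * norm v * norm v" by (simp add: eval_nat_numeral mult_ac)
        also have "\<dots> = norm D ^ 3 * norm v * norm v" unfolding n3 ..
        finally show ?thesis by (simp add: nv eval_nat_numeral mult_ac)
      qed
      have nN: "norm (complex_of_real N) = N" using N by simp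
      have "a - D ^ 3 / 3 = of_real N * (G - v ^ 3 / 3)" unfolding v3[symmetric] a_def by (simp add: algebra_simps)
      then have "norm (a - D ^ 3 / 3) = N * norm (G - v ^ 3 / 3)" by (simp only: norm_mult nN)
      also have "\<dots> \<le> N * (4 * norm v ^ 4)"
        unfolding G_def v_def by (intro mult_left_mono bess_log_phase(1) u True) (use N in auto)
      also have "\<dots> = 4 * (N * norm v ^ 4)" by simp
      finally have r1: "norm (a - D ^ 3 / 3) \<le> 4 * \<epsilon> * norm D ^ 4" unfolding n4 by simp
      have "a - D ^ 3 / 3 - of_real (1 * \<epsilon> / 4) * D ^ 4 = of_real N * (G - v ^ 3 / 3 - v ^ 4 / 4)"
      proof -
        have "a - D ^ 3 / 3 - of_real (1 * \<epsilon> / 4) * D ^ 4 = a - D ^ 3 / 3 - (of_real \<epsilon> * D ^ 4) / 4" by simp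
        then show ?thesis unfolding v4[symmetric] v3[symmetric] a_def by (simp add: algebra_simps)
      qed
      then have "norm (a - D ^ 3 / 3 - of_real (1 * \<epsilon> / 4) * D ^ 4) = N * norm (G - v ^ 3 / 3 - v ^ 4 / 4)" by (simp only: norm_mult nN)
      also have "\<dots> \<le> N * (4 * norm v ^ 5)"
        unfolding G_def v_def by (intro mult_left_mono bess_log_phase(2) u True) (use N in auto)
      also have "\<dots> = 4 * (N * norm v ^ 5)" by simp
      finally have r2: "norm (a - D ^ 3 / 3 - of_real (1 * \<epsilon> / 4) * D ^ 4) \<le> 4 * \<epsilon>\<^sup>2 * norm D ^ 5" unfolding n5 by simp
      have "Re a = real k * (ln (norm ?P) + u)" unfolding a using Pz by (simp add: Re_Ln v_def d45_def algebra_simps)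
      then have Rea: "Re a \<le> t / 2 - t\<^sup>2 / 4" using Rebound[OF u1] lnP[OF u1] by simp
      show ?thesis unfolding ea[symmetric]
        using phase_estimate[OF \<epsilon>(1) _ d3 t r1[unfolded D_def] r2[unfolded D_def] Rea] s2 by (simp add: d45_pow)
    next
      case False
      then have u2: "1 \<le> 2 * u" by simp
      have nF: "norm (bess_kernel k \<epsilon> t) \<le> ?w"
      proof (cases "u < 1")
        case True
        have np: "norm ?P > 0" unfolding v_def norm_quadratic_d45 using True by (simp add: add_pos_nonneg)
        have "norm (bess_kernel k \<epsilon> t) = norm ?P ^ k * exp (real k * u)"
          using True by (simp add: kern norm_mult norm_power v_def d45_def)
        also have "\<dots> = exp (real k * ln (norm ?P)) * exp (real k * u)" using np by (simp add: exp_of_nat_mult)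
        also have "\<dots> = exp (real k * (ln (1 - u) + ln (1 + u\<^sup>2) / 2 + u))"
          unfolding lnP[OF True] exp_add[symmetric] by (simp add: algebra_simps)
        also have "\<dots> \<le> ?w" using Rebound[OF True] by simp
        finally show ?thesis .
      next
        case False
        \<comment> \<open>At \<open>u = 1\<close> the logarithm breaks down but the quadratic
          vanishes; for larger \<open>u\<close> the kernel is 0 by definition.\<close>
        have "norm ?P ^ k = 0" if "u = 1" unfolding v_def norm_quadratic_d45 using that k by simp
        then have "bess_kernel k \<epsilon> t = 0" using False by (auto simp: kern norm_power[symmetric])
        then show ?thesis by simp
      qed
      have nE: "norm (airy_exp d45 t) \<le> ?w" by (rule norm_airy_exp_le(2)[OF d3 t])
      have nd: "norm (bess_kernel k \<epsilon> t - airy_exp d45 t) \<le> 2 * ?w"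
        using norm_triangle_ineq4[of "bess_kernel k \<epsilon> t" "airy_exp d45 t"] nF nE by simp
      also have "\<dots> \<le> (2 * u) * (2 * ?w)" using u2 mult_right_mono[of 1 "2 * u" "2 * ?w"] by simp
      also have "\<dots> = 4 * \<epsilon> * (t ^ 1 * ?w)" by (simp add: u_def)
      also have "\<dots> \<le> 4 * \<epsilon> * (fact 1 * exp (3 * t - t\<^sup>2 / 4))" by (intro mult_left_mono w) (use \<epsilon> in auto)
      also have "\<dots> \<le> 10 ^ 9 * \<epsilon> * exp (3 * t - t\<^sup>2 / 4)" using \<epsilon> by simp
      finally have 1: "norm (bess_kernel k \<epsilon> t - airy_exp d45 t) \<le> 10 ^ 9 * \<epsilon> * exp (3 * t - t\<^sup>2 / 4)" .
      have u4: "1 \<le> (2 * u)\<^sup>2" using u2 by (intro one_le_power) auto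
      have "norm (of_real (1 * \<epsilon> / 4) * (d45 * of_real t) ^ 4 * airy_exp d45 t) = (\<epsilon> / 4) * (sqrt 2 * t) ^ 4 * norm (airy_exp d45 t)"
        using \<epsilon> t by (simp add: norm_mult norm_power d45_pow)
      also have "(sqrt 2 * t) ^ 4 = 4 * t ^ 4"
      proof -
        have "sqrt 2 ^ 4 = (4::real)" using power_mult[of "sqrt 2" 2 2] by simp
        then show ?thesis by (simp add: power_mult_distrib)
      qed
      also have "(\<epsilon> / 4) * (4 * t ^ 4) * norm (airy_exp d45 t) \<le> (\<epsilon> / 4) * (4 * t ^ 4) * ?w"
        by (intro mult_left_mono nE) (use \<epsilon> t in auto)
      also have "\<dots> = 1 * (\<epsilon> * t ^ 4 * ?w)" by simp
      also have "\<dots> \<le> (2 * u) * (\<epsilon> * t ^ 4 * ?w)" using u2 \<epsilon> t by (intro mult_right_mono) auto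
      also have "\<dots> = 2 * \<epsilon>\<^sup>2 * (t ^ 5 * ?w)" by (simp add: u_def eval_nat_numeral)
      finally have c: "norm (of_real (1 * \<epsilon> / 4) * (d45 * of_real t) ^ 4 * airy_exp d45 t) \<le> 2 * \<epsilon>\<^sup>2 * (t ^ 5 * ?w)" .
      have "2 * ?w \<le> (2 * u)\<^sup>2 * (2 * ?w)" using u4 mult_right_mono[of 1 "(2 * u)\<^sup>2" "2 * ?w"] by simp
      also have "\<dots> = 8 * \<epsilon>\<^sup>2 * (t ^ 2 * ?w)" by (simp add: u_def power_mult_distrib)
      finally have d: "2 * ?w \<le> 8 * \<epsilon>\<^sup>2 * (t ^ 2 * ?w)" .
      have "norm (bess_kernel k \<epsilon> t - airy_exp d45 t - of_real (1 * \<epsilon> / 4) * (d45 * of_real t) ^ 4 * airy_exp d45 t)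
         \<le> norm (bess_kernel k \<epsilon> t - airy_exp d45 t) + norm (of_real (1 * \<epsilon> / 4) * (d45 * of_real t) ^ 4 * airy_exp d45 t)"
        by (rule norm_triangle_ineq4)
      also have "\<dots> \<le> 8 * \<epsilon>\<^sup>2 * (t ^ 2 * ?w) + 2 * \<epsilon>\<^sup>2 * (t ^ 5 * ?w)" using nd c d by linarith
      also have "\<dots> \<le> 8 * \<epsilon>\<^sup>2 * (fact 2 * exp (3 * t - t\<^sup>2 / 4)) + 2 * \<epsilon>\<^sup>2 * (fact 5 * exp (3 * t - t\<^sup>2 / 4))"
        by (intro add_mono mult_left_mono w) auto
      also have "\<dots> = 256 * (\<epsilon>\<^sup>2 * exp (3 * t - t\<^sup>2 / 4))" by (simp add: fact_numeral)
      also have "\<dots> \<le> 10 ^ 9 * (\<epsilon>\<^sup>2 * exp (3 * t - t\<^sup>2 / 4))" by (intro mult_right_mono) auto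
      finally have 2: "norm (bess_kernel k \<epsilon> t - airy_exp d45 t - of_real (1 * \<epsilon> / 4) * (d45 * of_real t) ^ 4 * airy_exp d45 t)
         \<le> 10 ^ 9 * \<epsilon>\<^sup>2 * exp (3 * t - t\<^sup>2 / 4)" by (simp only: mult.assoc)
      show ?thesis using 1 2 by (rule conjI)
    qed
  qed
  have "set_borel_measurable lborel {0..} (bess_kernel k \<epsilon>)"
  proof -
    let ?f = "\<lambda>t::real. let v = of_real \<epsilon> * d45 * of_real t in (1 - v + v\<^sup>2 / 2) ^ k * exp (of_nat k * v)"
    have "(\<lambda>t. indicator {0..1 / \<epsilon>} t *\<^sub>R ?f t) \<in> borel_measurable borel"
      unfolding Let_def by (rule borel_measurable_continuous_on_indicator) (auto intro!: continuous_intros)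
    moreover have "indicator {0..1 / \<epsilon>} t *\<^sub>R ?f t = indicator {0..} t *\<^sub>R bess_kernel k \<epsilon> t" for t
    proof -
      have "t \<le> 1 / \<epsilon> \<longleftrightarrow> \<epsilon> * t \<le> 1" using \<epsilon>(1) by (simp add: pos_le_divide_eq mult.commute)
      then show ?thesis by (simp add: indicator_def bess_kernel_def)
    qed
    ultimately show ?thesis unfolding set_borel_measurable_def by simp
  qed
  then show ?thesis unfolding airy_kernel_def using * by blast
qed

section \<open>Derivatives of Chebyshev polynomials\<close>

text \<open>\<open>GREATEST\<close> says something only once a largest zero exists: the sign change
  and the positivity beyond \<open>b\<close> make the zero set nonempty and bounded above, and
  continuity makes it closed. Positivity to the right of the largest zero is the intermediate value
  theorem again.\<close>

lemma Greatest_zero: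
  fixes f :: "real \<Rightarrow> real"
  assumes c: "continuous_on UNIV f" and a: "f a < 0" and b: "\<And>x. x \<ge> b \<Longrightarrow> f x > 0"
  defines "w \<equiv> (GREATEST x. f x = 0)"
  shows "f w = 0" "a < w" "w < b" "\<And>x. x > w \<Longrightarrow> f x > 0"
proof -
  define S where "S = {x. f x = 0}"
  have ab: "a < b" using a b[of a] by (cases "a < b") auto
  have c': "continuous_on {p..q} f" for p q using c by (rule continuous_on_subset) simp
  have ivt: "\<exists>y\<ge>p. y \<in> S" if p: "f p \<le> 0" for p
  proof -
    have pb: "p \<le> b" using p b[of p] by (cases "p \<le> b") auto
    then show ?thesis using IVT'[of f p 0 b] p b[of b] c' by (auto simp: S_def)
  qed
  have lt: "x < b" if "x \<in> S" for x using that b[of x] by (cases "x < b") (auto simp: S_def)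
  have bd: "bdd_above S" using lt by (intro bdd_aboveI[of _ b]) (simp add: less_imp_le)
  have ne: "S \<noteq> {}" using ivt[of a] a by auto
  have "closed S" unfolding S_def by (intro closed_Collect_eq c continuous_on_const)
  then have Sup: "Sup S \<in> S" using closed_contains_Sup[OF ne bd] by blast
  have w: "w = Sup S" unfolding w_def
    by (rule Greatest_equality) (use Sup bd in \<open>auto simp: S_def intro: cSup_upper\<close>)
  show "f w = 0" "w < b" using Sup lt w by (auto simp: S_def)
  have up: "f x > 0" if x: "x > w" for x
  proof (rule ccontr)
    assume "\<not> f x > 0"
    then obtain y where "y \<ge> x" "y \<in> S" using ivt[of x] by auto
    then show False using cSup_upper[OF _ bd, of y] w x by simp
  qed
  then show "\<And>x. x > w \<Longrightarrow> f x > 0" .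
  have "w \<noteq> a" using a \<open>f w = 0\<close> by auto
  moreover have "\<not> w < a" using up[of a] a by auto
  ultimately show "a < w" by simp
qed

lemma DERIV_chebD: "(chebD n k has_real_derivative chebD n (Suc k) x) (at x)"
  unfolding chebD_def by (simp add: poly_DERIV)

lemma continuous_chebD: "continuous_on A (chebD n k)"
  using DERIV_chebD by (intro continuous_at_imp_continuous_on ballI DERIV_isCont) blast

text \<open>The classical differentiation formula for two neighbouring degrees, each expressed by
  the same pair of polynomials; in this form the two-step recurrence carries it through a simple
  induction and the index \<open>n - 1\<close> is avoided.\<close>

lemma cheb_pderiv:
  defines "X \<equiv> [:0, 1:] :: real poly"
  shows "(1 - X\<^sup>2) * pderiv (cheb n) = of_nat n * (X * cheb n - cheb (Suc n)) \<and>
    (1 - X\<^sup>2) * pderiv (cheb (Suc n)) = of_nat (Suc n) * (cheb n - X * cheb (Suc n))"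
proof (induction n)
  case 0
  have "pderiv X = 1" by (simp add: X_def pderiv_pCons)
  then show ?case by (simp add: X_def[symmetric] power2_eq_square pderiv_1)
next
  case (Suc n)
  have X2: "[:0, 2:] = 2 * X" by (simp add: X_def numeral_poly)
  have pX: "pderiv X = 1" by (simp add: X_def pderiv_pCons)
  have rec: "cheb (Suc (Suc n)) = 2 * X * cheb (Suc n) - cheb n" by (simp add: X2)
  have p2: "pderiv (2 * X * p) = 2 * p + 2 * X * pderiv p" for p
  proof -
    have "2 * X * p = (X * p) + (X * p)" by simp
    then have "pderiv (2 * X * p) = pderiv (X * p) + pderiv (X * p)" by (simp only: pderiv_add)
    then show ?thesis by (simp add: pderiv_mult pX algebra_simps)
  qed
  have d: "pderiv (cheb (Suc (Suc n))) = 2 * cheb (Suc n) + 2 * X * pderiv (cheb (Suc n)) - pderiv (cheb n)"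
    unfolding rec pderiv_diff p2 ..
  have "(1 - X\<^sup>2) * pderiv (cheb (Suc (Suc n))) =
     2 * (1 - X\<^sup>2) * cheb (Suc n) + 2 * X * ((1 - X\<^sup>2) * pderiv (cheb (Suc n))) - (1 - X\<^sup>2) * pderiv (cheb n)"
    unfolding d by (simp add: algebra_simps)
  also have "\<dots> = 2 * (1 - X\<^sup>2) * cheb (Suc n) + 2 * X * (of_nat (Suc n) * (cheb n - X * cheb (Suc n))) - of_nat n * (X * cheb n - cheb (Suc n))"
    using Suc.IH by simp
  also have "\<dots> = of_nat (Suc (Suc n)) * (cheb (Suc n) - X * cheb (Suc (Suc n)))"
    unfolding rec by (simp add: power2_eq_square algebra_simps)
  finally have 2: "(1 - X\<^sup>2) * pderiv (cheb (Suc (Suc n))) = of_nat (Suc (Suc n)) * (cheb (Suc n) - X * cheb (Suc (Suc n)))" .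
  have "X * cheb (Suc n) - cheb (Suc (Suc n)) = cheb n - X * cheb (Suc n)"
    unfolding rec by (simp add: algebra_simps)
  then show ?case using Suc.IH 2 by metis
qed

text \<open>Differentiating the first relation of \<open>cheb_pderiv\<close> and eliminating
  \<open>cheb (Suc n)\<close> gives \<open>1 - X\<^sup>2\<close> times the equation; the factor
  cancels because polynomials form an integral domain.\<close>

lemma cheb_ode_poly:
  defines "X \<equiv> [:0, 1:] :: real poly"
  shows "(1 - X\<^sup>2) * pderiv (pderiv (cheb n)) - X * pderiv (cheb n) + of_nat n ^ 2 * cheb n = 0"
proof -
  define T where "T = cheb n"
  define T1 where "T1 = pderiv T"
  define T2 where "T2 = pderiv T1"
  define U where "U = cheb (Suc n)"
  define N where "N = (of_nat n :: real poly)"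
  have pX: "pderiv X = 1" by (simp add: X_def pderiv_pCons)
  have pN: "pderiv N = 0" unfolding N_def of_nat_poly by (simp add: pderiv_pCons)
  have a: "(1 - X\<^sup>2) * T1 = N * (X * T - U)" and b: "(1 - X\<^sup>2) * pderiv U = (N + 1) * (T - X * U)"
    using cheb_pderiv[of n] unfolding X_def[symmetric] T_def T1_def U_def N_def by (simp_all add: add.commute)
  have pw: "pderiv (1 - X\<^sup>2) = - 2 * X" unfolding power2_eq_square by (simp add: pderiv_diff pderiv_mult pX pderiv_1)
  have "pderiv ((1 - X\<^sup>2) * T1) = pderiv (N * (X * T - U))" unfolding a ..
  then have c: "(1 - X\<^sup>2) * T2 - 2 * X * T1 = N * (T + X * T1 - pderiv U)"
    unfolding pderiv_mult pderiv_diff[of "X * T"] pw pX pN T1_def[symmetric] T2_def[symmetric] by (simp add: algebra_simps)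
  have "(1 - X\<^sup>2) * ((1 - X\<^sup>2) * T2 - X * T1 + N ^ 2 * T)
     = (1 - X\<^sup>2) * ((1 - X\<^sup>2) * T2 - 2 * X * T1) + X * ((1 - X\<^sup>2) * T1) + (1 - X\<^sup>2) * N ^ 2 * T"
    by (simp add: algebra_simps)
  also have "\<dots> = N * ((1 - X\<^sup>2) * T + X * ((1 - X\<^sup>2) * T1) - (1 - X\<^sup>2) * pderiv U) + X * ((1 - X\<^sup>2) * T1) + (1 - X\<^sup>2) * N ^ 2 * T"
    unfolding c by (simp add: algebra_simps)
  also have "\<dots> = 0" unfolding a b by (simp add: power2_eq_square algebra_simps)
  finally have "(1 - X\<^sup>2) * ((1 - X\<^sup>2) * T2 - X * T1 + N ^ 2 * T) = 0" .
  moreover have "1 - X\<^sup>2 \<noteq> 0"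
  proof
    assume "1 - X\<^sup>2 = 0"
    then have "poly (1 - X\<^sup>2) 0 = 0" by simp
    then show False by (simp add: X_def)
  qed
  ultimately show ?thesis unfolding T_def T1_def T2_def N_def by simp
qed

lemma chebD_ode:
  "(1 - x\<^sup>2) * chebD n (Suc (Suc k)) x - (2 * real k + 1) * x * chebD n (Suc k) x + ((real n)\<^sup>2 - (real k)\<^sup>2) * chebD n k x = 0"
proof (induction k arbitrary: x)
  case 0
  have "poly ((1 - [:0, 1:]\<^sup>2) * pderiv (pderiv (cheb n)) - [:0, 1:] * pderiv (cheb n) + of_nat n ^ 2 * cheb n) x = 0"
    unfolding cheb_ode_poly by simp
  then show ?case by (simp add: chebD_def of_nat_poly)
next
  case (Suc k)
  let ?f = "\<lambda>x. (1 - x\<^sup>2) * chebD n (Suc (Suc k)) x - (2 * real k + 1) * x * chebD n (Suc k) x + ((real n)\<^sup>2 - (real k)\<^sup>2) * chebD n k x"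
  have d: "(?f has_real_derivative ((1 - x\<^sup>2) * chebD n (Suc (Suc (Suc k))) x - 2 * x * chebD n (Suc (Suc k)) x)
     - ((2 * real k + 1) * chebD n (Suc k) x + (2 * real k + 1) * x * chebD n (Suc (Suc k)) x) + ((real n)\<^sup>2 - (real k)\<^sup>2) * chebD n (Suc k) x) (at x)"
    by (auto intro!: derivative_eq_intros DERIV_chebD simp: algebra_simps)
  have "?f = (\<lambda>x. 0)" using Suc.IH by auto
  from DERIV_unique[OF d[unfolded this] DERIV_const] have "((1 - x\<^sup>2) * chebD n (Suc (Suc (Suc k))) x - 2 * x * chebD n (Suc (Suc k)) x)
     - ((2 * real k + 1) * chebD n (Suc k) x + (2 * real k + 1) * x * chebD n (Suc (Suc k)) x) + ((real n)\<^sup>2 - (real k)\<^sup>2) * chebD n (Suc k) x = 0"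
    .
  then show ?case by (simp add: power2_eq_square algebra_simps)
qed

lemma chebD_0_1: "chebD n 0 1 = 1"
proof -
  have "poly (cheb n) 1 = 1 \<and> poly (cheb (Suc n)) 1 = 1" by (induction n) auto
  then show ?thesis by (simp add: chebD_def)
qed

text \<open>At \<open>x = 1\<close> the leading coefficient of the differential equation vanishes,
  which leaves a first-order recursion in \<open>k\<close>.\<close>

lemma chebD_Suc_1: "chebD n (Suc k) 1 = ((real n)\<^sup>2 - (real k)\<^sup>2) / (2 * real k + 1) * chebD n k 1"
  using chebD_ode[of 1 n k] by (simp add: field_simps)

lemma chebD_1_pos: "k \<le> n \<Longrightarrow> chebD n k 1 > 0"
proof (induction k)
  case (Suc k)
  then have "(real k)\<^sup>2 < (real n)\<^sup>2" by (intro power_strict_mono) auto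
  then show ?case unfolding chebD_Suc_1 using Suc by simp
qed (simp add: chebD_0_1)

text \<open>Takes the place of a degree computation: the factor \<open>n\<^sup>2 - k\<^sup>2\<close>
  of the recursion vanishes at \<open>k = n\<close>, so the Taylor expansion at 1 stops
  there.\<close>

lemma chebD_1_eq_0: "chebD n (Suc (n + i)) 1 = 0"
proof (induction i)
  case 0
  show ?case unfolding chebD_Suc_1 by simp
next
  case (Suc i)
  then show ?case using chebD_Suc_1[of n "Suc (n + i)"] by simp
qed

lemma chebD_1_shift: "chebD n (k + j) 1 = chebD n k 1 * (\<Prod>i<j. ((real n)\<^sup>2 - (real (k + i))\<^sup>2) / (2 * real (k + i) + 1))"
  by (induction j) (auto simp: chebD_Suc_1)

section \<open>Taylor expansion of the derivatives of Chebyshev polynomials\<close>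

lemma poly_Taylor:
  fixes p :: "real poly"
  shows "poly p x = (\<Sum>j\<le>degree p. poly ((pderiv ^^ j) p) a / fact j * (x - a) ^ j)"
proof (induction "degree p" arbitrary: p x)
  case 0
  then obtain c where "p = [:c:]" by (metis degree_eq_zeroE)
  then show ?case by simp
next
  case (Suc d)
  let ?S = "\<lambda>x. \<Sum>j\<le>degree p. poly ((pderiv ^^ j) p) a / fact j * (x - a) ^ j"
  have dp: "degree (pderiv p) = d" using Suc(2) by (simp add: degree_pderiv)
  have "((\<lambda>x. poly p x - ?S x) has_real_derivative 0) (at y)" for y
  proof -
    have "(?S has_real_derivative (\<Sum>j\<le>degree p. poly ((pderiv ^^ j) p) a / fact j * (real j * (y - a) ^ (j - 1)))) (at y)"
      by (auto intro!: derivative_eq_intros sum.cong simp: mult_ac)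
    also have "(\<Sum>j\<le>degree p. poly ((pderiv ^^ j) p) a / fact j * (real j * (y - a) ^ (j - 1)))
       = (\<Sum>j\<le>d. poly ((pderiv ^^ Suc j) p) a / fact (Suc j) * (real (Suc j) * (y - a) ^ j))"
      unfolding Suc(2)[symmetric] by (subst sum.atMost_Suc_shift) simp
    also have "\<dots> = (\<Sum>j\<le>degree (pderiv p). poly ((pderiv ^^ j) (pderiv p)) a / fact j * (y - a) ^ j)"
      unfolding dp by (intro sum.cong refl) (simp add: funpow_swap1 del: of_nat_Suc)
    also have "\<dots> = poly (pderiv p) y" using Suc(1)[of "pderiv p" y] dp by simp
    finally have "(?S has_real_derivative poly (pderiv p) y) (at y)" .
    from DERIV_diff[OF poly_DERIV[of p y] this] show ?thesis by (simp only: diff_self)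
  qed
  then have "poly p x - ?S x = poly p a - ?S a" using DERIV_isconst_all by blast
  moreover have "?S a = poly p a"
  proof -
    have "?S a = (\<Sum>j\<in>{0}. poly ((pderiv ^^ j) p) a / fact j * (a - a) ^ j)"
      by (rule sum.mono_neutral_right) auto
    then show ?thesis by simp
  qed
  ultimately show ?case by simp
qed

lemma higher_pderiv_eq_0: "degree p < j \<Longrightarrow> (pderiv ^^ j) (p::real poly) = 0"
proof (induction j arbitrary: p)
  case (Suc j)
  show ?case
  proof (cases "degree p = 0")
    case True
    then have "pderiv p = 0" by (simp add: pderiv_eq_0_iff)
    moreover have "(pderiv ^^ j) (0::real poly) = 0" by (induction j) auto
    ultimately show ?thesis by (simp add: funpow_Suc_right del: funpow.simps)
  next
    case False
    then have "degree (pderiv p) < j" using Suc.prems by (simp add: degree_pderiv)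
    then show ?thesis using Suc.IH by (simp add: funpow_Suc_right del: funpow.simps)
  qed
qed simp

lemma chebD_Taylor_1:
  assumes "k \<le> n"
  shows "chebD n k x = (\<Sum>j\<le>n - k. chebD n (k + j) 1 / fact j * (x - 1) ^ j)"
proof -
  let ?p = "(pderiv ^^ k) (cheb n)"
  let ?t = "\<lambda>j. chebD n (k + j) 1 / fact j * (x - 1) ^ j"
  have e: "poly ((pderiv ^^ j) ?p) a = chebD n (k + j) a" for j a
    by (simp add: chebD_def funpow_add add.commute)
  have "chebD n k x = (\<Sum>j\<le>degree ?p. ?t j)"
    using poly_Taylor[of ?p x 1] unfolding e by (simp add: chebD_def)
  also have "\<dots> = (\<Sum>j\<le>max (degree ?p) (n - k). ?t j)"
    by (rule sum.mono_neutral_left) (auto simp: e[symmetric] higher_pderiv_eq_0)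
  also have "\<dots> = (\<Sum>j\<le>n - k. ?t j)"
  proof (rule sum.mono_neutral_right)
    show "\<forall>j\<in>{..max (degree ?p) (n - k)} - {..n - k}. ?t j = 0"
    proof
      fix j assume "j \<in> {..max (degree ?p) (n - k)} - {..n - k}"
      then have "j > n - k" by auto
      then have e: "k + j = Suc (n + (k + j - Suc n))" using assms by auto
      show "?t j = 0" using chebD_1_eq_0[of n "k + j - Suc n", folded e] by simp
    qed
  qed auto
  finally show ?thesis .
qed

lemma chebD_const: "chebD n n x = chebD n n 1"
  using chebD_Taylor_1[of n n x] by simp

lemma chebD_eq_0: "chebD n (Suc n) x = 0"
proof -
  have "chebD n n = (\<lambda>x. chebD n n 1)" using chebD_const by blast
  then have "(chebD n n has_real_derivative 0) (at x)" by (metis DERIV_const)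
  then show ?thesis using DERIV_chebD DERIV_unique by blast
qed

lemma chebD_Taylor:
  assumes "k \<le> n"
  shows "chebD n k x = (\<Sum>j\<le>n - k. chebD n (k + j) a / fact j * (x - a) ^ j)"
proof -
  let ?p = "(pderiv ^^ k) (cheb n)"
  let ?t = "\<lambda>j. chebD n (k + j) a / fact j * (x - a) ^ j"
  have e: "poly ((pderiv ^^ j) ?p) a = chebD n (k + j) a" for j a
    by (simp add: chebD_def funpow_add add.commute)
  have z: "(pderiv ^^ Suc (n + i)) (cheb n) = 0" for i
  proof -
    have "(pderiv ^^ Suc n) (cheb n) = 0"
      using chebD_eq_0[of n] by (simp add: chebD_def poly_eq_poly_eq_iff[symmetric] fun_eq_iff)
    moreover have "(pderiv ^^ i) (0::real poly) = 0" by (induction i) auto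
    moreover have "Suc (n + i) = i + Suc n" by simp
    ultimately show ?thesis by (simp only: funpow_add o_apply)
  qed
  have "chebD n k x = (\<Sum>j\<le>degree ?p. ?t j)"
    using poly_Taylor[of ?p x a] unfolding e by (simp add: chebD_def)
  also have "\<dots> = (\<Sum>j\<le>max (degree ?p) (n - k). ?t j)"
    by (rule sum.mono_neutral_left) (auto simp: e[symmetric] higher_pderiv_eq_0)
  also have "\<dots> = (\<Sum>j\<le>n - k. ?t j)"
  proof (rule sum.mono_neutral_right)
    show "\<forall>j\<in>{..max (degree ?p) (n - k)} - {..n - k}. ?t j = 0"
    proof
      fix j assume "j \<in> {..max (degree ?p) (n - k)} - {..n - k}"
      then have e': "k + j = Suc (n + (k + j - Suc n))" using assms by auto
      show "?t j = 0" using z[of "k + j - Suc n", folded e'] by (simp add: chebD_def)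
    qed
  qed auto
  finally show ?thesis .
qed

section \<open>The limit at the origin: Hermite polynomials\<close>

lemma DERIV_herm: "(herm N has_real_derivative real N * herm (N - 1) x) (at x)"
proof (induction N rule: less_induct)
  case (less N)
  consider "N = 0" | "N = 1" | m where "N = Suc (Suc m)" by (metis One_nat_def not0_implies_Suc)
  then show ?case
  proof cases
    case 1
    have "herm 0 = (\<lambda>x. 1)" by auto
    then show ?thesis using 1 by simp
  next
    case 2
    have "herm (Suc 0) = (\<lambda>x. x)" by auto
    then show ?thesis using 2 by simp
  next
    case 3
    have h: "herm (Suc (Suc m)) = (\<lambda>x. x * herm (Suc m) x - real (Suc m) / 2 * herm m x)" by auto
    have d0: "(herm m has_real_derivative real m * herm (m - 1) x) (at x)"
      and d1: "(herm (Suc m) has_real_derivative real (Suc m) * herm m x) (at x)"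
      using less[of m] less[of "Suc m"] 3 by auto
    have r: "real m * (x * herm m x - herm (Suc m) x) = real m * (real m / 2 * herm (m - 1) x)"
      by (cases m) auto
    have "(herm (Suc (Suc m)) has_real_derivative
       (herm (Suc m) x + x * (real (Suc m) * herm m x)) - real (Suc m) / 2 * (real m * herm (m - 1) x)) (at x)"
      unfolding h by (auto intro!: derivative_eq_intros d0 d1)
    also have "(herm (Suc m) x + x * (real (Suc m) * herm m x)) - real (Suc m) / 2 * (real m * herm (m - 1) x)
       = real (Suc (Suc m)) * herm (Suc m) x"
    proof (cases m)
      case (Suc l)
      have "real (Suc m) / 2 * (real m * herm (m - 1) x) = real (Suc m) * (x * herm m x - herm (Suc m) x)"
        using r Suc by simp
      then show ?thesis by (simp add: algebra_simps)
    qed simp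
    finally show ?thesis unfolding 3 by simp
  qed
qed

text \<open>Interlacing: at the largest zero of \<open>herm N\<close> the recurrence leaves
  \<open>herm (Suc N) = - N / 2 * herm (N - 1) < 0\<close>, so the largest zero of the next degree
  lies further right, where all lower degrees are positive.\<close>

lemma herm_top_exists:
  assumes "N \<ge> 1"
  shows "\<exists>h. herm N h = 0 \<and> (\<forall>x>h. herm N x > 0) \<and> (\<forall>j<N. \<forall>x\<ge>h. herm j x > 0)"
  using assms
proof (induction N rule: nat_induct_at_least)
  case base
  show ?case by (intro exI[of _ 0]) auto
next
  case (Suc N)
  then obtain h where h: "herm N h = 0" "\<And>x. x > h \<Longrightarrow> herm N x > 0" "\<And>j x. j < N \<Longrightarrow> x \<ge> h \<Longrightarrow> herm j x > 0" by blast
  obtain M where M: "N = Suc M" using Suc.hyps by (cases N) auto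
  have neg: "herm (Suc N) h < 0" using h(1) h(3)[of M h] unfolding M by simp
  define b where "b = sqrt (2 * real (Suc N))"
  have b: "herm (Suc N) x > 0" if "x \<ge> b" for x
  proof (rule herm_pos)
    have b0: "b > 0" by (simp add: b_def)
    show "x > 0" using b0 that by simp
    have "b\<^sup>2 \<le> x\<^sup>2" using b0 that by (intro power_mono) auto
    then show "2 * real (Suc N) \<le> x\<^sup>2" by (simp add: b_def)
  qed
  note G = Greatest_zero[where b = b, OF continuous_herm neg b]
  let ?w = "GREATEST x. herm (Suc N) x = 0"
  have "herm j x > 0" if "j < Suc N" "x \<ge> ?w" for j x
    using h(2)[of x] h(3)[of j x] G(2) that by (cases "j = N") auto
  then show ?case using G(1,4) by blast
qed

definition herm_top :: "nat \<Rightarrow> real" where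
  "herm_top N = (SOME h. herm N h = 0 \<and> (\<forall>x>h. herm N x > 0) \<and> (\<forall>j<N. \<forall>x\<ge>h. herm j x > 0))"

lemma herm_top:
  assumes "N \<ge> 1"
  shows "herm N (herm_top N) = 0" "\<And>x. x > herm_top N \<Longrightarrow> herm N x > 0" "\<And>j x. j < N \<Longrightarrow> x \<ge> herm_top N \<Longrightarrow> herm j x > 0"
  using someI_ex[OF herm_top_exists[OF assms]] unfolding herm_top_def[symmetric] by blast+

text \<open>Near the origin \<open>T\<^sub>n\<^bsup>(n-m)\<^esup>\<close> lives on the scale \<open>1 / sqrt n\<close>, where its three-term recurrence tends to the Hermite one.\<close>
definition cheb_scaled :: "nat \<Rightarrow> nat \<Rightarrow> real \<Rightarrow> real" where
  "cheb_scaled n m y = sqrt (real n) ^ m * fact m * chebD n (n - m) (y / sqrt (real n)) / chebD n n 1"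

lemma cheb_scaled_0: "cheb_scaled n 0 y = 1"
  using chebD_1_pos[of n n] chebD_const[of n "y / sqrt (real n)"] by (simp add: cheb_scaled_def)

lemma cheb_scaled_1: "n \<ge> 1 \<Longrightarrow> cheb_scaled n (Suc 0) y = y"
proof -
  assume n: "n \<ge> 1"
  then obtain k where k: "n = Suc k" by (cases n) auto
  define x where "x = y / sqrt (real n)"
  have "- (2 * real k + 1) * x * chebD n n 1 + ((real n)\<^sup>2 - (real k)\<^sup>2) * chebD n k x = 0"
    using chebD_ode[of x n k, folded k] chebD_eq_0[of n x] chebD_const[of n x] by (simp add: algebra_simps)
  moreover have "(real n)\<^sup>2 - (real k)\<^sup>2 = 2 * real k + 1" unfolding k by (simp add: power2_eq_square algebra_simps)
  ultimately have "(2 * real k + 1) * (chebD n k x - x * chebD n n 1) = 0" by (simp add: algebra_simps)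
  moreover have "2 * real k + 1 \<noteq> 0" by linarith
  ultimately have e: "chebD n k x = x * chebD n n 1" by (simp only: mult_eq_0_iff) simp
  have nk: "n - Suc 0 = k" using k by simp
  have "chebD n n 1 > 0" by (rule chebD_1_pos) simp
  then show ?thesis unfolding cheb_scaled_def nk x_def[symmetric] e using n by (simp add: x_def)
qed

text \<open>The differential equation links three consecutive derivatives, hence is a three-term
  recurrence in \<open>m\<close>; for \<open>k = n - m - 2\<close> its coefficient
  \<open>n\<^sup>2 - k\<^sup>2\<close> is \<open>(m + 2) * (2 * n - m - 2)\<close>.\<close>

lemma cheb_scaled_rec:
  assumes n: "n \<ge> Suc (Suc m)"
  shows "cheb_scaled n (Suc (Suc m)) y =
    ((2 * (real n - real m - 2) + 1) * y * cheb_scaled n (Suc m) y - (real m + 1) * (real n - y\<^sup>2) * cheb_scaled n m y) / (2 * real n - real m - 2)"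
proof -
  define s where "s = sqrt (real n)"
  define x where "x = y / s"
  define k where "k = n - Suc (Suc m)"
  define L where "L = chebD n n 1"
  have s: "s > 0" "s * s = real n" using n by (simp_all add: s_def)
  have L: "L > 0" unfolding L_def by (rule chebD_1_pos) simp
  have k: "n - Suc (Suc m) = k" "n - Suc m = Suc k" "n - m = Suc (Suc k)" "real k = real n - real m - 2"
    using n by (auto simp: k_def of_nat_diff)
  have dpos: "2 * real n - real m - 2 > 0" using n by simp
  have nk: "(real n)\<^sup>2 - (real k)\<^sup>2 = (real m + 2) * (2 * real n - real m - 2)"
    unfolding k(4) by (simp add: power2_eq_square algebra_simps)
  define A where "A = chebD n k x"
  define B where "B = chebD n (Suc k) x"
  define C where "C = chebD n (Suc (Suc k)) x"
  define f where "f = s ^ m * fact m / L"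
  have q: "cheb_scaled n (Suc (Suc m)) y = s * s * (real m + 2) * (real m + 1) * f * A"
    "cheb_scaled n (Suc m) y = s * (real m + 1) * f * B" "cheb_scaled n m y = f * C"
    unfolding cheb_scaled_def k A_def B_def C_def f_def x_def s_def[symmetric] L_def by (simp_all add: algebra_simps add_divide_distrib)
  have ode: "(1 - x\<^sup>2) * C - (2 * real k + 1) * x * B + (real m + 2) * (2 * real n - real m - 2) * A = 0"
    using chebD_ode[of x n k] unfolding nk A_def B_def C_def .
  have y: "y = s * x" using s by (simp add: x_def)
  have "(2 * real n - real m - 2) * cheb_scaled n (Suc (Suc m)) y
     = s * s * (real m + 1) * f * ((real m + 2) * (2 * real n - real m - 2) * A)" unfolding q by (simp add: algebra_simps)
  also have "(real m + 2) * (2 * real n - real m - 2) * A = (2 * real k + 1) * x * B - (1 - x\<^sup>2) * C" using ode by simp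
  also have "s * s * (real m + 1) * f * ((2 * real k + 1) * x * B - (1 - x\<^sup>2) * C)
     = (2 * real k + 1) * y * (s * (real m + 1) * f * B) - (real m + 1) * (s * s - y\<^sup>2) * (f * C)"
    unfolding y by (simp add: power2_eq_square algebra_simps)
  finally have "(2 * real n - real m - 2) * cheb_scaled n (Suc (Suc m)) y
     = (2 * (real n - real m - 2) + 1) * y * cheb_scaled n (Suc m) y - (real m + 1) * (real n - y\<^sup>2) * cheb_scaled n m y"
    unfolding q s(2) k(4) .
  then show ?thesis using dpos by (simp add: field_simps)
qed

lemma cheb_scaled_tendsto: "(\<lambda>n. cheb_scaled n m y) \<longlonglongrightarrow> herm m y"
proof (induction m rule: less_induct)
  case (less m)
  consider "m = 0" | "m = 1" | l where "m = Suc (Suc l)" by (metis One_nat_def not0_implies_Suc)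
  then show ?case
  proof cases
    case 1
    then show ?thesis by (simp add: cheb_scaled_0)
  next
    case 2
    have "eventually (\<lambda>n. y = cheb_scaled n m y) sequentially"
      using eventually_ge_at_top[of 1] by eventually_elim (simp add: 2 cheb_scaled_1)
    then show ?thesis using 2 by (simp add: Lim_transform_eventually[OF tendsto_const])
  next
    case 3
    have a: "(\<lambda>n. (2 * (real n - real l - 2) + 1) / (2 * real n - real l - 2)) \<longlonglongrightarrow> 1" by real_asymp
    have b: "(\<lambda>n. (real n - y\<^sup>2) / (2 * real n - real l - 2)) \<longlonglongrightarrow> 1 / 2" by real_asymp
    have "(\<lambda>n. (2 * (real n - real l - 2) + 1) / (2 * real n - real l - 2) * y * cheb_scaled n (Suc l) y
       - (real l + 1) * ((real n - y\<^sup>2) / (2 * real n - real l - 2)) * cheb_scaled n l y) \<longlonglongrightarrow> 1 * y * herm (Suc l) y - (real l + 1) * (1 / 2) * herm l y"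
      by (intro tendsto_intros a b less) (use 3 in auto)
    moreover have "eventually (\<lambda>n. (2 * (real n - real l - 2) + 1) / (2 * real n - real l - 2) * y * cheb_scaled n (Suc l) y
       - (real l + 1) * ((real n - y\<^sup>2) / (2 * real n - real l - 2)) * cheb_scaled n l y = cheb_scaled n m y) sequentially"
      using eventually_ge_at_top[of m]
    proof eventually_elim
      case (elim n)
      have "(A * y * Q1 - B * C * Q2) / D = A / D * y * Q1 - B * (C / D) * Q2" for A B C D Q1 Q2 :: real
        by (simp add: diff_divide_distrib)
      then show ?case using elim unfolding 3 by (simp only: cheb_scaled_rec)
    qed
    ultimately have "(\<lambda>n. cheb_scaled n m y) \<longlonglongrightarrow> 1 * y * herm (Suc l) y - (real l + 1) * (1 / 2) * herm l y"
      by (rule Lim_transform_eventually)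
    then show ?thesis by (simp add: 3 add.commute)
  qed
qed

text \<open>A finite expansion with two uses: it upgrades convergence at one point to convergence
  along moving arguments, and positivity of all orders at one point to positivity on a
  half-line.\<close>

lemma cheb_scaled_Taylor:
  assumes n: "n \<ge> m" "n \<ge> 1"
  shows "cheb_scaled n m y = (\<Sum>j\<le>m. fact m / (fact j * fact (m - j)) * cheb_scaled n (m - j) a * (y - a) ^ j)"
proof -
  let ?s = "sqrt (real n)"
  have s: "?s > 0" using n by simp
  have nm: "n - (n - m) = m" using n by simp
  have "chebD n (n - m) (y / ?s) = (\<Sum>j\<le>m. chebD n (n - m + j) (a / ?s) / fact j * (y / ?s - a / ?s) ^ j)"
    using chebD_Taylor[of "n - m" n "y / ?s" "a / ?s"] unfolding nm by simp
  then have "cheb_scaled n m y = (\<Sum>j\<le>m. ?s ^ m * fact m * (chebD n (n - m + j) (a / ?s) / fact j * (y / ?s - a / ?s) ^ j) / chebD n n 1)"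
    by (simp add: cheb_scaled_def sum_distrib_left sum_divide_distrib)
  also have "\<dots> = (\<Sum>j\<le>m. fact m / (fact j * fact (m - j)) * cheb_scaled n (m - j) a * (y - a) ^ j)"
  proof (intro sum.cong refl)
    fix j assume "j \<in> {..m}"
    then have j: "j \<le> m" by simp
    have e1: "n - (m - j) = n - m + j" using j n by simp
    have e2: "?s ^ m = ?s ^ (m - j) * ?s ^ j" using j by (simp flip: power_add)
    have e3: "(y / ?s - a / ?s) ^ j = (y - a) ^ j / ?s ^ j" by (simp add: diff_divide_distrib[symmetric] power_divide)
    show "?s ^ m * fact m * (chebD n (n - m + j) (a / ?s) / fact j * (y / ?s - a / ?s) ^ j) / chebD n n 1
       = fact m / (fact j * fact (m - j)) * cheb_scaled n (m - j) a * (y - a) ^ j"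
      unfolding cheb_scaled_def e1 e2 e3 using s by simp
  qed
  finally show ?thesis .
qed

lemma cheb_scaled_tendsto_at:
  assumes Y: "Y \<longlonglongrightarrow> h"
  shows "(\<lambda>n. cheb_scaled n m (Y n)) \<longlonglongrightarrow> herm m h"
proof -
  have "(\<lambda>n. \<Sum>j\<le>m. fact m / (fact j * fact (m - j)) * cheb_scaled n (m - j) h * (Y n - h) ^ j) \<longlonglongrightarrow>
     (\<Sum>j\<le>m. fact m / (fact j * fact (m - j)) * herm (m - j) h * (h - h) ^ j)"
    by (intro tendsto_intros cheb_scaled_tendsto Y)
  also have "(\<Sum>j\<le>m. fact m / (fact j * fact (m - j)) * herm (m - j) h * (h - h) ^ j)
     = (\<Sum>j\<in>{0}. fact m / (fact j * fact (m - j)) * herm (m - j) h * (h - h) ^ j)"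
    by (rule sum.mono_neutral_right) auto
  also have "\<dots> = herm m h" by simp
  finally show ?thesis
    by (rule Lim_transform_eventually)
       (use eventually_ge_at_top[of "max m 1"] in \<open>eventually_elim, simp add: cheb_scaled_Taylor[of m _ _ h]\<close>)
qed

text \<open>Controls the denominator of \<open>tau\<close> by stepping down from order
  \<open>n\<close>; each step changes the normalised value by a ratio that tends to 1.\<close>

lemma chebD_at_1_tendsto: "(\<lambda>n. fact m * chebD n (n - m) 1 / chebD n n 1) \<longlonglongrightarrow> 1"
proof (induction m)
  case 0
  have "chebD n n 1 \<noteq> 0" for n using chebD_1_pos[of n n] by simp
  then show ?case by simp
next
  case (Suc m)
  have "(\<lambda>n. (2 * (real n - real m - 1) + 1) / (2 * real n - real m - 1)) \<longlonglongrightarrow> 1" by real_asymp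
  from tendsto_mult[OF this Suc.IH]
  have "(\<lambda>n. (2 * (real n - real m - 1) + 1) / (2 * real n - real m - 1) * (fact m * chebD n (n - m) 1 / chebD n n 1)) \<longlonglongrightarrow> 1" by simp
  then show ?case
  proof (rule Lim_transform_eventually)
    show "eventually (\<lambda>n. (2 * (real n - real m - 1) + 1) / (2 * real n - real m - 1) * (fact m * chebD n (n - m) 1 / chebD n n 1)
       = fact (Suc m) * chebD n (n - Suc m) 1 / chebD n n 1) sequentially"
      using eventually_ge_at_top[of "Suc m"]
    proof eventually_elim
      case (elim n)
      define k where "k = n - Suc m"
      have k: "n - m = Suc k" "real k = real n - real m - 1" using elim by (auto simp: k_def of_nat_diff)
      have d: "2 * real n - real m - 1 > 0" using elim by simp
      have nk: "(real n)\<^sup>2 - (real k)\<^sup>2 = (real m + 1) * (2 * real n - real m - 1)"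
        unfolding k(2) by (simp add: power2_eq_square algebra_simps)
      have p: "2 * (real n - real m - 1) + 1 > 0" using elim by simp
      have "chebD n (n - m) 1 = (real m + 1) * (2 * real n - real m - 1) / (2 * (real n - real m - 1) + 1) * chebD n k 1"
        unfolding k(1) chebD_Suc_1 nk unfolding k(2) ..
      then have e: "(2 * (real n - real m - 1) + 1) / (2 * real n - real m - 1) * (fact m * chebD n (n - m) 1)
        = fact m * (real m + 1) * chebD n k 1" using d p by simp
      show ?case unfolding k_def[symmetric] times_divide_eq_right[of _ "fact m * chebD n (n - m) 1"] e
        by (simp add: algebra_simps)
    qed
  qed
qed

text \<open>The zero belongs to the derivative of order \<open>n - m + 1 = n - (m - 1)\<close>,
  hence the Hermite index \<open>m - 1\<close>. The rescaled largest zero is trapped near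
  \<open>herm_top\<close>; the value there then converges because the scaled polynomials converge
  along moving arguments.\<close>

lemma tau_hermite_limit:
  assumes m: "m \<ge> 2"
  shows "(\<lambda>n. real n powr (real m / 2) * tau n (n - m)) \<longlonglongrightarrow> \<bar>herm m (herm_top (m - 1))\<bar>"
proof -
  define N where "N = m - 1"
  have N: "N \<ge> 1" "m = Suc N" using m by (auto simp: N_def)
  define h where "h = herm_top N"
  note ht = herm_top[OF N(1), folded h_def]
  define Y where "Y n = sqrt (real n) * omega n (n - m)" for n
  have key: "eventually (\<lambda>n. \<bar>Y n - h\<bar> < \<eta>) sequentially" if \<eta>: "\<eta> > 0" for \<eta>
  proof -
    have dpos: "real N * herm (N - 1) h > 0" using ht(3)[of "N - 1" h] N by simp
    obtain d where d: "d > 0" "\<And>e. 0 < e \<Longrightarrow> e < d \<Longrightarrow> herm N (h - e) < herm N h"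
      using DERIV_pos_inc_left[OF DERIV_herm dpos] by blast
    define e where "e = min (\<eta> / 2) (d / 2)"
    have e: "0 < e" "e < d" "e < \<eta>" using d \<eta> by (auto simp: e_def)
    have "herm N (h - e) < 0" using d(2)[OF e(1,2)] ht(1) by simp
    then have ev1: "eventually (\<lambda>n. cheb_scaled n N (h - e) < 0) sequentially"
      by (rule order_tendstoD(2)[OF cheb_scaled_tendsto])
    \<comment> \<open>Pointwise convergence cannot exclude zeros far to the right. With all orders
      positive at \<open>h + e\<close>, the Taylor expansion there has positive coefficients and
      excludes them on the whole half-line.\<close>
    have "eventually (\<lambda>n. cheb_scaled n (N - j) (h + e) > 0) sequentially" for j
    proof (rule order_tendstoD(1)[OF cheb_scaled_tendsto])
      have "N - j < N \<or> N - j = N" by auto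
      then show "herm (N - j) (h + e) > 0" using ht(2)[of "h + e"] ht(3)[of "N - j" "h + e"] e by auto
    qed
    then have ev2: "eventually (\<lambda>n. \<forall>j\<in>{..N}. cheb_scaled n (N - j) (h + e) > 0) sequentially"
      by (intro eventually_ball_finite) auto
    show ?thesis
      using ev1 ev2 eventually_ge_at_top[of m]
    proof eventually_elim
      case (elim n)
      let ?s = "sqrt (real n)"
      have n: "n \<ge> 1" "n \<ge> N" using elim m N by auto
      have s: "?s > 0" using n by simp
      define f where "f = chebD n (Suc (n - m))"
      have idx: "Suc (n - m) = n - N" using elim N by simp
      have L: "chebD n n 1 > 0" by (rule chebD_1_pos) simp
      have fq: "cheb_scaled n N y = ?s ^ N * fact N / chebD n n 1 * f (y / ?s)" for y
        by (simp add: cheb_scaled_def f_def idx)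
      have c: "?s ^ N * fact N / chebD n n 1 > 0" using s L by simp
      have fneg: "f ((h - e) / ?s) < 0" using elim(1) c unfolding fq by (simp only: mult_less_0_iff) auto
      have qpos: "cheb_scaled n N y > 0" if y: "y \<ge> h + e" for y
      proof -
        have "cheb_scaled n N y = (\<Sum>j\<le>N. fact N / (fact j * fact (N - j)) * cheb_scaled n (N - j) (h + e) * (y - (h + e)) ^ j)"
          by (rule cheb_scaled_Taylor[OF n(2,1)])
        also have "\<dots> \<ge> (\<Sum>j\<in>{0}. fact N / (fact j * fact (N - j)) * cheb_scaled n (N - j) (h + e) * (y - (h + e)) ^ j)"
        proof (rule sum_mono2)
          fix j assume "j \<in> {..N} - {0}"
          then have "cheb_scaled n (N - j) (h + e) > 0" using elim(2) by auto
          then show "0 \<le> fact N / (fact j * fact (N - j)) * cheb_scaled n (N - j) (h + e) * (y - (h + e)) ^ j"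
            using y by (intro mult_nonneg_nonneg) auto
        qed auto
        moreover have "(\<Sum>j\<in>{0::nat}. fact N / (fact j * fact (N - j)) * cheb_scaled n (N - j) (h + e) * (y - (h + e)) ^ j) > 0"
          using bspec[OF elim(2), of 0] by simp
        ultimately show ?thesis by linarith
      qed
      have fpos: "f x > 0" if x: "x \<ge> (h + e) / ?s" for x
      proof -
        have "h + e \<le> x * ?s" using x s by (simp add: pos_divide_le_eq)
        then have "cheb_scaled n N (x * ?s) > 0" by (rule qpos)
        then have "?s ^ N * fact N / chebD n n 1 * f x > 0"
          unfolding fq nonzero_mult_div_cancel_right[OF less_imp_neq[OF s, symmetric]] .
        then show ?thesis using c by (rule zero_less_mult_pos)
      qed
      have om: "omega n (n - m) = (GREATEST x. f x = 0)" unfolding omega_def f_def ..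
      note G = Greatest_zero[where b = "(h + e) / ?s", OF continuous_chebD[of UNIV n "Suc (n - m)", folded f_def] fneg fpos, folded om]
      have "h - e < Y n" using G(2) s by (simp add: Y_def pos_divide_less_eq mult.commute)
      moreover have "Y n < h + e" using G(3) s by (simp add: Y_def pos_less_divide_eq mult.commute)
      ultimately show "\<bar>Y n - h\<bar> < \<eta>" using e by (simp add: abs_less_iff)
    qed
  qed
  have "Y \<longlonglongrightarrow> h"
    unfolding tendsto_iff dist_real_def using key by blast
  then have "(\<lambda>n. \<bar>cheb_scaled n m (Y n)\<bar> / (fact m * chebD n (n - m) 1 / chebD n n 1)) \<longlonglongrightarrow> \<bar>herm m h\<bar> / 1"
    by (intro tendsto_intros cheb_scaled_tendsto_at chebD_at_1_tendsto) auto
  moreover have "eventually (\<lambda>n. \<bar>cheb_scaled n m (Y n)\<bar> / (fact m * chebD n (n - m) 1 / chebD n n 1) = real n powr (real m / 2) * tau n (n - m)) sequentially"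
    using eventually_ge_at_top[of 1]
  proof eventually_elim
    case (elim n)
    let ?s = "sqrt (real n)"
    have s: "?s > 0" using elim by simp
    have L: "chebD n n 1 > 0" "chebD n (n - m) 1 > 0" by (rule chebD_1_pos; simp)+
    have "real n powr (real m / 2) = (real n powr (1/2)) powr real m" by (simp add: powr_powr)
    also have "\<dots> = ?s ^ m" using elim by (simp add: powr_half_sqrt powr_realpow)
    finally have p: "real n powr (real m / 2) = ?s ^ m" .
    have "Y n / ?s = omega n (n - m)" using s by (simp add: Y_def)
    then show ?case unfolding p tau_def cheb_scaled_def using s L by (simp add: abs_mult abs_divide)
  qed
  ultimately show ?thesis unfolding h_def N_def by (simp add: Lim_transform_eventually)
qed

section \<open>The limit at the endpoint 1: spherical Bessel functions\<close>

lemma bess_no_common_zero: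
  assumes u: "u > 0" "bess k u = 0" "bess (Suc k) u = 0"
  shows False
  using u(2,3)
proof (induction k)
  case 0
  define \<theta> where "\<theta> = sqrt (2 * u)"
  have \<theta>: "\<theta> \<noteq> 0" "\<theta>\<^sup>2 / 2 = u" using u by (simp_all add: \<theta>_def)
  \<comment> \<open>The recurrence carries a common zero down to index 0, where it would be shared
    by cosine and sine.\<close>
  have "cos \<theta> = 0" "sin \<theta> = 0" using bess_base[of \<theta>] \<theta> 0 by auto
  then show ?case using sin_cos_squared_add[of \<theta>] by simp
next
  case (Suc k)
  then show ?case using bess_rec[of k u] by simp
qed

text \<open>Index 1 is \<open>sin \<theta> / \<theta>\<close>; Rolle's theorem carries zeros to the
  next index, because the derivative of \<open>bess\<close> is a multiple of its successor.\<close>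

lemma bess_zeros_unbounded: "\<exists>u>M. bess (Suc k) u = 0"
proof (induction k arbitrary: M)
  case 0
  obtain i :: nat where i: "real i > \<bar>M\<bar>" using reals_Archimedean2 by blast
  define \<theta> where "\<theta> = real (Suc i) * pi"
  have "real (Suc i) * 1 \<le> \<theta>" unfolding \<theta>_def using pi_gt3 by (intro mult_left_mono) auto
  then have \<theta>: "\<theta> > \<bar>M\<bar> + 1" using i by simp
  have "1 * pi \<le> \<theta>" unfolding \<theta>_def by (intro mult_right_mono) auto
  then have "\<theta> > 2" using pi_gt3 by linarith
  then have "\<theta> * 2 \<le> \<theta> * \<theta>" by (intro mult_left_mono) auto
  then have "\<theta>\<^sup>2 / 2 > M" using \<theta> by (simp add: power2_eq_square)
  moreover have "sin \<theta> = 0" unfolding \<theta>_def by (rule sin_npi)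
  then have "bess (Suc 0) (\<theta>\<^sup>2 / 2) = 0" using bess_base(2)[of \<theta>] \<open>\<theta> > 2\<close> by simp
  ultimately show ?case by blast
next
  case (Suc k)
  obtain a where a: "a > M" "bess (Suc k) a = 0" using Suc.IH by blast
  obtain b where b: "b > a" "bess (Suc k) b = 0" using Suc.IH by blast
  have "\<exists>z>a. z < b \<and> (bess (Suc k) has_real_derivative 0) (at z)"
    using Rolle[OF b(1), of "bess (Suc k)"] a b continuous_bess DERIV_bess real_differentiable_def by metis
  then obtain z where z: "z > a" "(bess (Suc k) has_real_derivative 0) (at z)" by blast
  have "- bess (Suc (Suc k)) z / real (2 * Suc k + 1) = 0" using DERIV_unique[OF DERIV_bess z(2)] .
  then have "bess (Suc (Suc k)) z = 0" by simp
  then show ?case using z a by (intro exI[of _ z]) auto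
qed

text \<open>The variable \<open>u\<close> measures distance to the left of 1, so the rightmost zero
  of the derivative corresponds to the smallest \<open>u\<close>.\<close>

definition bess_zero :: "nat \<Rightarrow> real" where
  "bess_zero k = Inf {u. u \<ge> 0 \<and> bess (Suc k) u = 0}"

lemma bess_zero: "bess (Suc k) (bess_zero k) = 0" "bess_zero k > 0" "\<And>u. 0 \<le> u \<Longrightarrow> u < bess_zero k \<Longrightarrow> bess (Suc k) u > 0"
proof -
  define S where "S = {u. u \<ge> 0 \<and> bess (Suc k) u = 0}"
  obtain u where "u > 0" "bess (Suc k) u = 0" using bess_zeros_unbounded by blast
  then have ne: "S \<noteq> {}" by (force simp: S_def)
  have bd: "bdd_below S" by (rule bdd_belowI[of _ 0]) (auto simp: S_def)
  have "closed {u::real. 0 \<le> u}" by (simp add: closed_Collect_le)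
  then have "closed S" unfolding S_def
    by (intro closed_Collect_conj closed_Collect_eq continuous_bess continuous_on_const)
  then have Inf: "Inf S \<in> S" using closed_contains_Inf[OF ne bd] by blast
  have w: "bess_zero k = Inf S" by (simp add: bess_zero_def S_def)
  show z: "bess (Suc k) (bess_zero k) = 0" using Inf unfolding w S_def by blast
  have "bess_zero k \<ge> 0" using Inf unfolding w S_def by blast
  moreover have "bess_zero k \<noteq> 0" using z bess_0[of "Suc k"] by auto
  ultimately show "bess_zero k > 0" by simp
  fix u assume u: "0 \<le> u" "u < bess_zero k"
  show "bess (Suc k) u > 0"
  proof (rule ccontr)
    assume n: "\<not> bess (Suc k) u > 0"
    obtain y where y: "0 \<le> y" "y \<le> u" "bess (Suc k) y = 0"
      using IVT2'[of "bess (Suc k)" u 0 0] n u bess_0 continuous_bess[of "{0..u}"] by auto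
    then have "y \<in> S" by (simp add: S_def)
    then have "Inf S \<le> y" using bd by (rule cInf_lower)
    then show False using y u w by simp
  qed
qed

text \<open>The zero is simple, since the derivative is a multiple of the next function and
  consecutive ones have no common zero; a positive derivative would contradict positivity before the
  zero.\<close>

lemma bess_after_zero: "\<exists>d>0. \<forall>e. 0 < e \<longrightarrow> e < d \<longrightarrow> bess (Suc k) (bess_zero k + e) < 0"
proof -
  let ?u = "bess_zero k"
  have ne: "bess (Suc (Suc k)) ?u \<noteq> 0"
    using bess_no_common_zero[OF bess_zero(2)[of k], of "Suc k"] bess_zero(1)[of k] by blast
  have D: "(bess (Suc k) has_real_derivative - bess (Suc (Suc k)) ?u / real (2 * Suc k + 1)) (at ?u)" by (rule DERIV_bess)
  show ?thesis
  proof (cases "bess (Suc (Suc k)) ?u > 0")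
    case True
    then have "- bess (Suc (Suc k)) ?u / real (2 * Suc k + 1) < 0" by (simp add: divide_neg_pos)
    from DERIV_neg_dec_right[OF D this] show ?thesis using bess_zero(1)[of k] by auto
  next
    case False
    then have "- bess (Suc (Suc k)) ?u / real (2 * Suc k + 1) > 0" using ne by (intro divide_pos_pos) auto
    from DERIV_pos_inc_left[OF D this] obtain d where d: "d > 0" "\<And>h. 0 < h \<Longrightarrow> h < d \<Longrightarrow> bess (Suc k) (?u - h) < bess (Suc k) ?u" by blast
    define h where "h = min (d / 2) (?u / 2)"
    have h: "0 < h" "h < d" "h < ?u" using d(1) bess_zero(2)[of k] by (auto simp: h_def)
    have "bess (Suc k) (?u - h) < 0" using d(2)[OF h(1,2)] bess_zero(1)[of k] by simp
    moreover have "bess (Suc k) (?u - h) > 0" using h by (intro bess_zero(3)) auto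
    ultimately show ?thesis by simp
  qed
qed

text \<open>The finite-\<open>n\<close> correction, from \<open>n\<^sup>2 - (k + i)\<^sup>2 =
  n\<^sup>2 * (1 - ((k + i) / n)\<^sup>2)\<close>. For \<open>k \<le> n\<close> it vanishes once
  \<open>j > n - k\<close>, so the series built with it terminates.\<close>

definition bess_fin :: "nat \<Rightarrow> nat \<Rightarrow> nat \<Rightarrow> real" where
  "bess_fin n k j = (\<Prod>i<j. 1 - (real (k + i) / real n)\<^sup>2)"

lemma bess_fin_bounds:
  assumes "k \<le> n" "n > 0"
  shows "0 \<le> bess_fin n k j" "bess_fin n k j \<le> 1" "j > n - k \<Longrightarrow> bess_fin n k j = 0"
proof -
  show z: "bess_fin n k j = 0" if "j > n - k" for j
  proof -
    have "1 - (real (k + (n - k)) / real n)\<^sup>2 = 0" using assms by simp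
    then show ?thesis unfolding bess_fin_def using that by (intro prod_zero) auto
  qed
  have t: "0 \<le> 1 - (real (k + i) / real n)\<^sup>2 \<and> 1 - (real (k + i) / real n)\<^sup>2 \<le> 1" if "i < j" "j \<le> n - k" for i
  proof -
    have "real (k + i) / real n \<le> 1" using that assms by simp
    then have "(real (k + i) / real n)\<^sup>2 \<le> 1" by (intro power_le_one) auto
    then show ?thesis by simp
  qed
  show "0 \<le> bess_fin n k j"
  proof (cases "j \<le> n - k")
    case True
    then show ?thesis unfolding bess_fin_def using t by (intro prod_nonneg) auto
  qed (use z[of j] in simp)
  show "bess_fin n k j \<le> 1"
  proof (cases "j \<le> n - k")
    case True
    then show ?thesis unfolding bess_fin_def using t by (intro prod_le_1) auto
  qed (use z[of j] in simp)
qed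

lemma bess_fin_tendsto: "(\<lambda>n. bess_fin n k j) \<longlonglongrightarrow> 1"
proof -
  have "(\<lambda>n. 1 - (real (k + i) / real n)\<^sup>2) \<longlonglongrightarrow> 1" for i
  proof -
    have "(\<lambda>n. 1 - (real (k + i) / real n)\<^sup>2) \<longlonglongrightarrow> 1 - 0\<^sup>2" by (intro tendsto_intros lim_const_over_n)
    then show ?thesis by simp
  qed
  then have "(\<lambda>n. \<Prod>i<j. 1 - (real (k + i) / real n)\<^sup>2) \<longlonglongrightarrow> (\<Prod>i<j. 1)" by (intro tendsto_prod)
  then show ?thesis by (simp add: bess_fin_def)
qed

text \<open>Taylor expansion of \<open>T\<^sub>n\<^bsup>(k)\<^esup>\<close> at \<open>1\<close>, on the scale \<open>1 / n\<^sup>2\<close>.\<close>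
definition cheb_edge :: "nat \<Rightarrow> nat \<Rightarrow> real \<Rightarrow> real" where
  "cheb_edge n k u = (\<Sum>j. bess_coeff k j * bess_fin n k j * u ^ j)"

lemma chebD_eq_edge:
  assumes k: "k \<le> n" and n: "n > 0"
  shows "chebD n k (1 - u / (real n)\<^sup>2) = chebD n k 1 * cheb_edge n k u"
proof -
  have "cheb_edge n k u = (\<Sum>j\<le>n - k. bess_coeff k j * bess_fin n k j * u ^ j)"
    unfolding cheb_edge_def by (rule suminf_finite) (use bess_fin_bounds(3)[OF k n] in auto)
  then have "chebD n k 1 * cheb_edge n k u = (\<Sum>j\<le>n - k. chebD n k 1 * (bess_coeff k j * bess_fin n k j * u ^ j))"
    by (simp add: sum_distrib_left)
  also have "\<dots> = (\<Sum>j\<le>n - k. chebD n (k + j) 1 / fact j * ((1 - u / (real n)\<^sup>2) - 1) ^ j)"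
  proof (intro sum.cong refl)
    fix j
    have "(\<Prod>i<j. ((real n)\<^sup>2 - (real (k + i))\<^sup>2) / (2 * real (k + i) + 1))
      = (\<Prod>i<j. (real n)\<^sup>2 * (1 - (real (k + i) / real n)\<^sup>2) / real (2 * (k + i) + 1))"
    proof (intro prod.cong refl)
      fix i
      have "(real n)\<^sup>2 - (real (k + i))\<^sup>2 = (real n)\<^sup>2 * (1 - (real (k + i) / real n)\<^sup>2)"
        using n by (simp add: power_divide right_diff_distrib)
      then show "((real n)\<^sup>2 - (real (k + i))\<^sup>2) / (2 * real (k + i) + 1)
        = (real n)\<^sup>2 * (1 - (real (k + i) / real n)\<^sup>2) / real (2 * (k + i) + 1)" by simp
    qed
    also have "\<dots> = ((real n)\<^sup>2) ^ j * bess_fin n k j / (\<Prod>i<j. real (2 * (k + i) + 1))"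
      by (simp only: prod_dividef prod.distrib bess_fin_def prod_constant card_lessThan)
    finally have p: "(\<Prod>i<j. ((real n)\<^sup>2 - (real (k + i))\<^sup>2) / (2 * real (k + i) + 1))
      = ((real n)\<^sup>2) ^ j * bess_fin n k j / (\<Prod>i<j. real (2 * (k + i) + 1))" .
    have q: "((1 - u / (real n)\<^sup>2) - 1) ^ j = (-1) ^ j * u ^ j / ((real n)\<^sup>2) ^ j"
    proof -
      have "(1 - u / (real n)\<^sup>2) - 1 = (-1) * (u / (real n)\<^sup>2)" by simp
      then show ?thesis by (simp only: power_mult_distrib power_divide) simp
    qed
    show "chebD n k 1 * (bess_coeff k j * bess_fin n k j * u ^ j) = chebD n (k + j) 1 / fact j * ((1 - u / (real n)\<^sup>2) - 1) ^ j"
      unfolding chebD_1_shift p q bess_coeff_def using n by (simp add: mult_ac)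
  qed
  also have "\<dots> = chebD n k (1 - u / (real n)\<^sup>2)"
    by (rule chebD_Taylor[OF k, symmetric])
  finally show ?thesis ..
qed

text \<open>Tannery's theorem is applied to the sum of
  \<open>M j * \<bar>bess_fin n k j - 1\<bar>\<close>, which dominates the difference for all
  \<open>\<bar>u\<bar> \<le> U\<close> at once.\<close>

lemma cheb_edge_uniform:
  assumes \<eta>: "\<eta> > 0"
  shows "eventually (\<lambda>n. \<forall>u. \<bar>u\<bar> \<le> U \<longrightarrow> \<bar>cheb_edge n k u - bess k u\<bar> < \<eta>) sequentially"
proof -
  define V where "V = \<bar>U\<bar>"
  define M where "M j = \<bar>bess_coeff k j\<bar> * V ^ j" for j
  have sM: "summable M"
  proof (rule summable_comparison_test'[where N = 0])
    show "summable (\<lambda>j. (V / real (2 * k + 1)) ^ j / fact j)" using exp_sums_divide sums_summable by blast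
    fix j :: nat
    have "norm (M j) = \<bar>bess_coeff k j\<bar> * V ^ j" by (simp add: M_def V_def)
    also have "\<dots> \<le> ((1 / real (2 * k + 1)) ^ j / fact j) * V ^ j" by (intro mult_right_mono bess_coeff_bound) (auto simp: V_def)
    finally show "norm (M j) \<le> (V / real (2 * k + 1)) ^ j / fact j" by (simp add: power_divide)
  qed
  define a where "a j n = M j * \<bar>bess_fin n k j - 1\<bar>" for j n
  have M0: "M j \<ge> 0" for j by (simp add: M_def V_def)
  have ab: "norm (a j n) \<le> M j" if "k \<le> n" "n > 0" for j n
  proof -
    have "\<bar>bess_fin n k j - 1\<bar> \<le> 1" using bess_fin_bounds(1,2)[OF that, of j] by simp
    then show ?thesis using mult_left_mono[of "\<bar>bess_fin n k j - 1\<bar>" 1 "M j"] M0 by (simp add: a_def abs_mult)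
  qed
  have "eventually (\<lambda>n. summable (\<lambda>j. norm (a j n))) sequentially \<and> summable (\<lambda>j::nat. norm (0::real)) \<and>
     ((\<lambda>n. \<Sum>j. a j n) \<longlonglongrightarrow> (\<Sum>j. 0))"
  proof (rule tannerys_theorem[where M = M])
    show "(\<lambda>n. a j n) \<longlonglongrightarrow> 0" for j
    proof -
      have "(\<lambda>n. M j * \<bar>bess_fin n k j - 1\<bar>) \<longlonglongrightarrow> M j * \<bar>1 - 1\<bar>" by (intro tendsto_intros bess_fin_tendsto)
      then show ?thesis by (simp add: a_def)
    qed
    have "eventually (\<lambda>n. \<forall>j. norm (a j n) \<le> M j) sequentially"
      using eventually_ge_at_top[of "Suc k"] by eventually_elim (use ab in auto)
    then show "eventually (\<lambda>(j, n). norm (a j n) \<le> M j) (at_top \<times>\<^sub>F sequentially)"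
      unfolding eventually_prod_filter by (intro exI[of _ "\<lambda>_. True"] exI[of _ "\<lambda>n. \<forall>j. norm (a j n) \<le> M j"]) auto
  qed (use sM in auto)
  then have "(\<lambda>n. \<Sum>j. a j n) \<longlonglongrightarrow> 0" by simp
  then have "eventually (\<lambda>n. (\<Sum>j. a j n) < \<eta>) sequentially" using \<eta> by (rule order_tendstoD(2))
  then show ?thesis using eventually_ge_at_top[of "Suc k"]
  proof eventually_elim
    case (elim n)
    then have n: "k \<le> n" "n > 0" by auto
    have sa: "summable (\<lambda>j. a j n)"
      by (rule summable_comparison_test'[OF sM, where N = 0]) (use ab n in auto)
    show ?case
    proof (intro allI impI)
      fix u assume u: "\<bar>u\<bar> \<le> U"
      have t: "norm (bess_coeff k j * bess_fin n k j * u ^ j - bess_coeff k j * u ^ j) \<le> a j n" for j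
      proof -
        have "bess_coeff k j * bess_fin n k j * u ^ j - bess_coeff k j * u ^ j = bess_coeff k j * u ^ j * (bess_fin n k j - 1)"
          by (simp add: algebra_simps)
        then have "norm (bess_coeff k j * bess_fin n k j * u ^ j - bess_coeff k j * u ^ j) = \<bar>bess_coeff k j\<bar> * \<bar>u\<bar> ^ j * \<bar>bess_fin n k j - 1\<bar>"
          by (simp add: abs_mult power_abs)
        also have "\<dots> \<le> a j n" unfolding a_def M_def using u by (intro mult_right_mono mult_left_mono power_mono) (auto simp: V_def)
        finally show ?thesis .
      qed
      have "summable (\<lambda>j. bess_coeff k j * bess_fin n k j * u ^ j)"
        by (rule summable_finite[of "{..n - k}"]) (use bess_fin_bounds(3)[OF n] in auto)
      then have "(\<lambda>j. bess_coeff k j * bess_fin n k j * u ^ j - bess_coeff k j * u ^ j) sums (cheb_edge n k u - bess k u)"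
        unfolding cheb_edge_def by (intro sums_diff summable_sums bess_sums)
      from sums_unique[OF this] have "norm (cheb_edge n k u - bess k u) \<le> (\<Sum>j. a j n)"
        using norm_suminf_le[OF t sa] by simp
      then show "\<bar>cheb_edge n k u - bess k u\<bar> < \<eta>" using elim by simp
    qed
  qed
qed

text \<open>The rescaled zero is confined to a neighbourhood of \<open>bess_zero k\<close>: just
  beyond it the limit is negative, and on the compact interval before it bounded below by a positive
  number, so uniform convergence decides both signs.\<close>

lemma tau_bessel_limit:
  shows "(\<lambda>n. tau n k) \<longlonglongrightarrow> \<bar>bess k (bess_zero k)\<bar>"
proof -
  let ?u0 = "bess_zero k"
  have u0: "?u0 > 0" by (rule bess_zero)
  define Y where "Y n = (real n)\<^sup>2 * (1 - omega n k)" for n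
  have key: "eventually (\<lambda>n. \<bar>Y n - ?u0\<bar> < \<eta>) sequentially" if \<eta>: "\<eta> > 0" for \<eta>
  proof -
    obtain d where d: "d > 0" "\<And>e. 0 < e \<Longrightarrow> e < d \<Longrightarrow> bess (Suc k) (?u0 + e) < 0" using bess_after_zero by blast
    define e where "e = min (min (\<eta> / 2) (d / 2)) (?u0 / 2)"
    have e: "0 < e" "e < d" "e < \<eta>" "e < ?u0" using d \<eta> u0 by (auto simp: e_def)
    have neg: "bess (Suc k) (?u0 + e) < 0" using d(2)[OF e(1,2)] .
    have ne: "{0..?u0 - e} \<noteq> {}" using e by simp
    obtain y where y: "y \<in> {0..?u0 - e}" "\<And>x. x \<in> {0..?u0 - e} \<Longrightarrow> bess (Suc k) y \<le> bess (Suc k) x"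
      using continuous_attains_inf[OF compact_Icc ne continuous_bess] by blast
    define \<mu> where "\<mu> = bess (Suc k) y"
    have \<mu>: "\<mu> > 0" unfolding \<mu>_def using y e by (intro bess_zero(3)) auto
    define \<nu> where "\<nu> = min \<mu> (- bess (Suc k) (?u0 + e))"
    have \<nu>: "\<nu> > 0" using \<mu> neg by (simp add: \<nu>_def)
    show ?thesis
      using cheb_edge_uniform[OF \<nu>, of "?u0 + e" "Suc k"] eventually_ge_at_top[of "Suc k"]
    proof eventually_elim
      case (elim n)
      have n: "Suc k \<le> n" "n > 0" using elim by auto
      define f where "f = chebD n (Suc k)"
      have L: "chebD n (Suc k) 1 > 0" by (rule chebD_1_pos[OF n(1)])
      have fe: "f (1 - u / (real n)\<^sup>2) = chebD n (Suc k) 1 * cheb_edge n (Suc k) u" for u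
        unfolding f_def by (rule chebD_eq_edge[OF n])
      have "\<bar>cheb_edge n (Suc k) (?u0 + e) - bess (Suc k) (?u0 + e)\<bar> < \<nu>" using elim(1) u0 e by simp
      then have "cheb_edge n (Suc k) (?u0 + e) < 0" using neg by (simp add: \<nu>_def abs_less_iff)
      then have fneg: "f (1 - (?u0 + e) / (real n)\<^sup>2) < 0" unfolding fe using L by (simp add: mult_pos_neg)
      have fpos: "f x > 0" if x: "x \<ge> 1 - (?u0 - e) / (real n)\<^sup>2" for x
      proof -
        define u where "u = (real n)\<^sup>2 * (1 - x)"
        have xu: "x = 1 - u / (real n)\<^sup>2" using n by (simp add: u_def)
        have ule: "u \<le> ?u0 - e"
        proof -
          have "1 - x \<le> (?u0 - e) / (real n)\<^sup>2" using x by simp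
          then have "(1 - x) * (real n)\<^sup>2 \<le> ?u0 - e" using n by (subst (asm) pos_le_divide_eq) auto
          then show ?thesis by (simp add: u_def mult.commute)
        qed
        have "cheb_edge n (Suc k) u > 0"
        proof (cases "u \<ge> 0")
          case True
          then have "\<mu> \<le> bess (Suc k) u" unfolding \<mu>_def using y(2) ule by simp
          moreover have "\<bar>cheb_edge n (Suc k) u - bess (Suc k) u\<bar> < \<nu>" using elim(1) True ule e by simp
          ultimately show ?thesis by (simp add: \<nu>_def abs_less_iff)
        next
          case False
          \<comment> \<open>Points \<open>x > 1\<close> correspond to negative \<open>u\<close>;
            there the alternating signs cancel, every term is nonnegative, and the constant term is
            1.\<close>
          have "cheb_edge n (Suc k) u = (\<Sum>j\<le>n - Suc k. bess_coeff (Suc k) j * bess_fin n (Suc k) j * u ^ j)"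
            unfolding cheb_edge_def by (rule suminf_finite) (use bess_fin_bounds(3)[OF n] in auto)
          also have "\<dots> \<ge> (\<Sum>j\<in>{0}. bess_coeff (Suc k) j * bess_fin n (Suc k) j * u ^ j)"
          proof (rule sum_mono2)
            fix j
            have "bess_coeff (Suc k) j * u ^ j = (- u) ^ j / (fact j * (\<Prod>i<j. real (2 * (Suc k + i) + 1)))"
              unfolding bess_coeff_def by (simp add: power_minus[of u])
            also have "\<dots> \<ge> 0" using False bess_prod_pos[where k = "Suc k" and j = j] by (intro divide_nonneg_nonneg mult_nonneg_nonneg) auto
            finally have "0 \<le> (bess_coeff (Suc k) j * u ^ j) * bess_fin n (Suc k) j"
              by (rule mult_nonneg_nonneg[OF _ bess_fin_bounds(1)[OF n]])
            then show "0 \<le> bess_coeff (Suc k) j * bess_fin n (Suc k) j * u ^ j" by (simp add: mult_ac)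
          qed auto
          also have "(\<Sum>j\<in>{0::nat}. bess_coeff (Suc k) j * bess_fin n (Suc k) j * u ^ j) = 1"
            by (simp add: bess_coeff_def bess_fin_def)
          finally show ?thesis by linarith
        qed
        then show ?thesis unfolding xu fe using L by simp
      qed
      have om: "omega n k = (GREATEST x. f x = 0)" unfolding omega_def f_def ..
      note G = Greatest_zero[where b = "1 - (?u0 - e) / (real n)\<^sup>2", OF continuous_chebD[of UNIV n "Suc k", folded f_def] fneg fpos, folded om]
      have n2: "(real n)\<^sup>2 > 0" using n by simp
      have "1 - omega n k < (?u0 + e) / (real n)\<^sup>2" using G(2) by simp
      then have "Y n < ?u0 + e" using n2 by (simp add: Y_def pos_less_divide_eq mult.commute)
      moreover have "(?u0 - e) / (real n)\<^sup>2 < 1 - omega n k" using G(3) by simp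
      then have "?u0 - e < Y n" using n2 by (simp add: Y_def pos_divide_less_eq mult.commute)
      ultimately show "\<bar>Y n - ?u0\<bar> < \<eta>" using e by (simp add: abs_less_iff)
    qed
  qed
  have Y: "Y \<longlonglongrightarrow> ?u0" unfolding tendsto_iff dist_real_def using key by blast
  have bY: "(\<lambda>n. bess k (Y n)) \<longlonglongrightarrow> bess k ?u0"
    by (rule isCont_tendsto_compose[OF DERIV_isCont[OF DERIV_bess] Y])
  have "(\<lambda>n. cheb_edge n k (Y n) - bess k (Y n)) \<longlonglongrightarrow> 0"
    unfolding tendsto_iff dist_real_def
  proof (intro allI impI)
    fix r :: real assume r: "r > 0"
    have "eventually (\<lambda>n. \<bar>Y n - ?u0\<bar> < 1) sequentially" by (rule key) simp
    then show "eventually (\<lambda>n. \<bar>cheb_edge n k (Y n) - bess k (Y n) - 0\<bar> < r) sequentially"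
      using cheb_edge_uniform[OF r, of "?u0 + 1" k] by eventually_elim (use u0 in auto)
  qed
  from tendsto_add[OF this bY] have "(\<lambda>n. \<bar>cheb_edge n k (Y n)\<bar>) \<longlonglongrightarrow> \<bar>bess k ?u0\<bar>"
    by (intro tendsto_rabs) simp
  moreover have "eventually (\<lambda>n. \<bar>cheb_edge n k (Y n)\<bar> = tau n k) sequentially"
    using eventually_ge_at_top[of "Suc k"]
  proof eventually_elim
    case (elim n)
    then have n: "k \<le> n" "n > 0" by auto
    have "1 - Y n / (real n)\<^sup>2 = omega n k" using n by (simp add: Y_def)
    then have "chebD n k (omega n k) = chebD n k 1 * cheb_edge n k (Y n)" using chebD_eq_edge[OF n, of "Y n"] by simp
    then show ?case using chebD_1_pos[OF n(1)] by (simp add: tau_def abs_mult)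
  qed
  ultimately show ?thesis by (rule Lim_transform_eventually)
qed

section \<open>Asymptotics at the extreme zeros\<close>

lemma bigo_one_mult:
  fixes f g h :: "nat \<Rightarrow> real"
  assumes f: "(\<lambda>n. f n - 1) \<in> O(h)" and g: "(\<lambda>n. g n - 1) \<in> O(h)" and h: "h \<in> O(\<lambda>_. 1)"
  shows "(\<lambda>n. f n * g n - 1) \<in> O(h)"
proof -
  have "(\<lambda>n. f n - 1) \<in> O(\<lambda>_. 1)" using f h by (rule landau_o.big_trans)
  from landau_o.big.mult[OF this g] have "(\<lambda>n. (f n - 1) * (g n - 1)) \<in> O(h)" by simp
  from sum_in_bigo(1)[OF sum_in_bigo(1)[OF this f] g]
  have "(\<lambda>n. (f n - 1) * (g n - 1) + (f n - 1) + (g n - 1)) \<in> O(h)" .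
  then show ?thesis by (simp add: algebra_simps)
qed

lemma bigo_exp:
  fixes f h :: "nat \<Rightarrow> real"
  assumes f: "f \<in> O(h)" and h: "h \<longlonglongrightarrow> 0"
  shows "(\<lambda>n. exp (f n) - 1) \<in> O(h)"
proof -
  obtain c where c: "c > 0" "eventually (\<lambda>n. norm (f n) \<le> c * norm (h n)) sequentially"
    using f by (rule landau_o.bigE)
  have "(\<lambda>n. c * norm (h n)) \<longlonglongrightarrow> c * 0" by (intro tendsto_intros tendsto_norm_zero h)
  then have "eventually (\<lambda>n. c * norm (h n) < 1) sequentially" by (intro order_tendstoD(2)) auto
  with c(2) have "eventually (\<lambda>n. norm (exp (f n) - 1) \<le> (2 * c) * norm (h n)) sequentially"
  proof eventually_elim
    case (elim n)
    have "\<bar>exp (f n) - 1\<bar> \<le> 2 * \<bar>f n\<bar>"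
    proof (cases "f n \<ge> 0")
      case True
      have "exp (f n) \<le> 1 + f n + (f n)\<^sup>2" using True elim by (intro exp_bound) auto
      moreover have "(f n)\<^sup>2 \<le> f n" using True elim by (simp add: power2_eq_square mult_left_le)
      ultimately show ?thesis using True by simp
    next
      case False
      have "1 + f n \<le> exp (f n)" by (rule exp_ge_add_one_self)
      moreover have "exp (f n) \<le> 1" using False by simp
      ultimately show ?thesis using False by linarith
    qed
    then show ?case using elim by simp
  qed
  then show ?thesis by (rule bigoI)
qed

text \<open>The location of a zero is needed to second order in \<open>\<epsilon>\<close>, because it enters the asymptotics through
  \<open>exp (z / \<epsilon>)\<close>; the factor multiplying this exponential is only needed to first order.\<close>
lemma airyD_1_root_bound:
  assumes "\<bar>\<sigma>\<bar> = 1" "K > 0" "C > 0"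
  shows "\<exists>K'>0. \<forall>\<epsilon> z J. 0 < \<epsilon> \<longrightarrow> \<epsilon> \<le> 1 \<longrightarrow> airy_i1 - 1 \<le> z \<longrightarrow> z \<le> 0 \<longrightarrow>
     \<bar>z + \<sigma> * \<epsilon> / 2 - airy_i1\<bar> \<le> K * \<epsilon>\<^sup>2 \<longrightarrow> \<bar>J - airyD 1 z\<bar> \<le> C * \<epsilon> \<longrightarrow> \<bar>\<bar>J\<bar> / airyD 1 airy_i1 - 1\<bar> \<le> K' * \<epsilon>"
proof -
  obtain B where B: "B > 0" "\<And>x. x \<in> {airy_i1 - 1..0} \<Longrightarrow> \<bar>airyD 2 x\<bar> \<le> B" using airyD_bounded by blast
  define A where "A = airyD 1 airy_i1"
  have A: "A > 0" unfolding A_def by (rule airy_i1_deriv)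
  define K' where "K' = (C + B * (K + 1)) / A"
  show ?thesis
  proof (intro exI[of _ K'] conjI allI impI)
    show "K' > 0" using A B assms by (simp add: K'_def add_pos_pos)
    fix \<epsilon> z J assume \<epsilon>: "0 < \<epsilon>" "\<epsilon> \<le> 1" and z: "airy_i1 - 1 \<le> z" "z \<le> 0"
      and r: "\<bar>z + \<sigma> * \<epsilon> / 2 - airy_i1\<bar> \<le> K * \<epsilon>\<^sup>2" and J: "\<bar>J - airyD 1 z\<bar> \<le> C * \<epsilon>"
    have s: "\<bar>\<sigma> * \<epsilon> / 2\<bar> = \<epsilon> / 2" using assms \<epsilon> by (simp add: abs_mult)
    have e2: "\<epsilon>\<^sup>2 \<le> \<epsilon>" using \<epsilon> by (simp add: power2_eq_square mult_left_le)
    have "K * \<epsilon>\<^sup>2 \<le> K * \<epsilon>" using e2 assms by (intro mult_left_mono) auto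
    then have "\<bar>z - airy_i1\<bar> \<le> K * \<epsilon> + \<epsilon>" using r s \<epsilon> by linarith
    then have zi: "\<bar>z - airy_i1\<bar> \<le> (K + 1) * \<epsilon>" by (simp add: algebra_simps)
    have "norm (airyD 1 z - airyD 1 airy_i1) \<le> B * norm (z - airy_i1)"
    proof (rule field_differentiable_bound[where S = "{airy_i1 - 1..0}"])
      show "(airyD 1 has_field_derivative airyD 2 x) (at x within {airy_i1 - 1..0})" for x
        using has_field_derivative_airyD[of 1 x] by (simp add: numeral_2_eq_2 has_field_derivative_at_within)
    qed (use B z airy_i1(2) in auto)
    also have "\<dots> \<le> B * ((K + 1) * \<epsilon>)" using zi B by (intro mult_left_mono) auto
    finally have "\<bar>airyD 1 z - A\<bar> \<le> B * (K + 1) * \<epsilon>" by (simp add: A_def)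
    then have "\<bar>J - A\<bar> \<le> (C + B * (K + 1)) * \<epsilon>" using J by (simp add: algebra_simps)
    moreover have "\<bar>\<bar>J\<bar> - A\<bar> \<le> \<bar>J - A\<bar>" using A by linarith
    ultimately have "\<bar>\<bar>J\<bar> - A\<bar> / A \<le> (C + B * (K + 1)) * \<epsilon> / A" using A by (intro divide_right_mono) auto
    moreover have "\<bar>\<bar>J\<bar> / A - 1\<bar> = \<bar>\<bar>J\<bar> - A\<bar> / A" using A by (simp add: abs_divide diff_divide_distrib[symmetric] field_simps)
    ultimately show "\<bar>\<bar>J\<bar> / airyD 1 airy_i1 - 1\<bar> \<le> K' * \<epsilon>"
      unfolding A_def[symmetric] K'_def by simp
  qed
qed

text \<open>The extreme zero, written as \<open>X z\<close>, has \<open>z \<le> 0\<close> because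
  \<open>herm N\<close> has no zero beyond \<open>sqrt (2 * N)\<close>, and
  \<open>z \<ge> z0\<close> because \<open>G z0 < 0\<close> is impossible to the right of it. At the
  zero \<open>G z = 0\<close>, so only the \<open>J\<close> term of \<open>herm (Suc N)\<close>
  survives, which brings the second factor \<open>\<epsilon>\<close>.\<close>

lemma hermite_root:
  obtains K where "K > 0" "eventually (\<lambda>N. \<exists>z J. herm_top N = 2 * sqrt (real N / 2) + z / (2 * sqrt (real N / 2) * cbrt_inv N)
      \<and> \<bar>herm (Suc N) (herm_top N)\<bar> = 2 * sqrt pi * sqrt (real N / 2) ^ (N + 2) * (cbrt_inv N)\<^sup>2
           * exp ((herm_top N)\<^sup>2 - 3 * (real N / 2) - z / cbrt_inv N) * \<bar>J\<bar>
      \<and> \<bar>z - cbrt_inv N / 2 - airy_i1\<bar> \<le> K * (cbrt_inv N)\<^sup>2 \<and> \<bar>z\<bar> \<le> K \<and> \<bar>\<bar>J\<bar> / airyD 1 airy_i1 - 1\<bar> \<le> K * cbrt_inv N) sequentially"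
proof -
  define Z where "Z = 1 - airy_i1"
  define M where "M = 10 ^ 10 * exp ((2 * Z + 5)\<^sup>2)"
  have M: "M > 0" by (simp add: M_def)
  have one: "\<bar>-1 :: real\<bar> = 1" by simp
  obtain z0 K \<epsilon>0 where root: "airy_i1 - 1 \<le> z0" "z0 < 0" "K > 0" "\<epsilon>0 > 0"
    "\<forall>\<epsilon> G. 0 < \<epsilon> \<longrightarrow> \<epsilon> < \<epsilon>0 \<longrightarrow> (\<forall>z. z0 \<le> z \<longrightarrow> z \<le> 0 \<longrightarrow> \<bar>G z - airyD 0 z - (-1) * \<epsilon> / 4 * airyD 4 z\<bar> \<le> M * \<epsilon>\<^sup>2)
       \<longrightarrow> G z0 < 0 \<and> (\<forall>z. z0 \<le> z \<longrightarrow> z \<le> 0 \<longrightarrow> G z = 0 \<longrightarrow> \<bar>z + (-1) * \<epsilon> / 2 - airy_i1\<bar> \<le> K * \<epsilon>\<^sup>2)"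
    using airy_root[OF one M] by blast
  obtain K' where K': "K' > 0" "\<forall>\<epsilon> z J. 0 < \<epsilon> \<longrightarrow> \<epsilon> \<le> 1 \<longrightarrow> airy_i1 - 1 \<le> z \<longrightarrow> z \<le> 0 \<longrightarrow>
     \<bar>z + (-1) * \<epsilon> / 2 - airy_i1\<bar> \<le> K * \<epsilon>\<^sup>2 \<longrightarrow> \<bar>J - airyD 1 z\<bar> \<le> M * \<epsilon> \<longrightarrow> \<bar>\<bar>J\<bar> / airyD 1 airy_i1 - 1\<bar> \<le> K' * \<epsilon>"
    using airyD_1_root_bound[OF one root(3) M] by blast
  define K2 where "K2 = max (max K K') Z"
  have ev: "eventually (\<lambda>N. cbrt_inv N < min \<epsilon>0 1) sequentially"
    using cbrt_inv_tendsto root(4) by (intro order_tendstoD(2)) auto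
  show ?thesis
  proof (rule that[of K2])
    show "K2 > 0" using root(3) by (simp add: K2_def)
    show "eventually (\<lambda>N. \<exists>z J. herm_top N = 2 * sqrt (real N / 2) + z / (2 * sqrt (real N / 2) * cbrt_inv N)
      \<and> \<bar>herm (Suc N) (herm_top N)\<bar> = 2 * sqrt pi * sqrt (real N / 2) ^ (N + 2) * (cbrt_inv N)\<^sup>2
           * exp ((herm_top N)\<^sup>2 - 3 * (real N / 2) - z / cbrt_inv N) * \<bar>J\<bar>
      \<and> \<bar>z - cbrt_inv N / 2 - airy_i1\<bar> \<le> K2 * (cbrt_inv N)\<^sup>2 \<and> \<bar>z\<bar> \<le> K2 \<and> \<bar>\<bar>J\<bar> / airyD 1 airy_i1 - 1\<bar> \<le> K2 * cbrt_inv N) sequentially"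
      using ev eventually_gt_at_top[of 0]
    proof eventually_elim
      case (elim N)
      then have N: "N > 0" by simp
      define \<epsilon> where "\<epsilon> = cbrt_inv N"
      have e: "\<epsilon> > 0" "real N * \<epsilon> ^ 3 = 1" "\<epsilon> < \<epsilon>0" "\<epsilon> \<le> 1" using cbrt_inv[OF N] elim by (simp_all add: \<epsilon>_def)
      define c where "c = sqrt (real N / 2)"
      have c: "c > 0" "c\<^sup>2 = real N / 2" using N by (simp_all add: c_def)
      define X where "X z = 2 * c + z / (2 * c * \<epsilon>)" for z
      define G where "G z = airy_ray d60 (herm_kernel N \<epsilon>) 0 z" for z
      define J where "J z = airy_ray d60 (herm_kernel N \<epsilon>) 1 z" for z
      have kern: "airy_kernel (-1) d60 \<epsilon> (herm_kernel N \<epsilon>)" by (rule herm_kernel_airy[OF N e(1,2)])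
      have zZ: "\<bar>z\<bar> \<le> Z" if "airy_i1 - 1 \<le> z" "z \<le> 0" for z using that by (simp add: Z_def)
      have GA: "\<bar>G z - airyD 0 z - (-1) * \<epsilon> / 4 * airyD 4 z\<bar> \<le> M * \<epsilon>\<^sup>2" if "z0 \<le> z" "z \<le> 0" for z
        unfolding G_def M_def by (rule airy_kernel_asymp(1)[OF kern _ e(1) zZ]) (use that root in auto)
      note R = root(5)[rule_format, OF e(1,3) GA]
      define h where "h = herm_top N"
      have N1: "N \<ge> 1" using N by simp
      note ht = herm_top[OF N1, folded h_def]
      define P where "P z = 2 * sqrt pi * c ^ (N + 1) * \<epsilon> * exp ((X z)\<^sup>2 - 3 * c\<^sup>2 - z / \<epsilon>)" for z
      have P: "P z > 0" for z using c e by (simp add: P_def)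
      have H: "herm N (X z) = P z * G z" "herm (Suc N) (X z) = P z * c * (G z - \<epsilon> * J z)" for z
        unfolding P_def G_def J_def using herm_airy_ray[OF N e(1,2) c X_def] by auto
      define z where "z = (h - 2 * c) * (2 * c * \<epsilon>)"
      have hz: "h = X z" using c e by (simp add: X_def z_def)
      have G0: "G z = 0" using H(1)[of z] ht(1) P[of z] by (simp add: hz)
      have mono: "X a \<le> X b \<longleftrightarrow> a \<le> b" for a b
        using mult_pos_pos[OF e(1) c(1)] by (auto simp: X_def divide_le_cancel)
      have "z \<le> 0"
      proof (rule ccontr)
        assume "\<not> z \<le> 0"
        then have X2: "X z \<ge> 2 * c" using c e by (simp add: X_def)
        then have "(2 * c)\<^sup>2 \<le> (X z)\<^sup>2" using c by (intro power_mono) auto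
        then have "herm N (X z) > 0" using X2 c by (intro herm_pos) (auto simp: power_mult_distrib)
        then show False using ht(1) hz by simp
      qed
      have "z0 \<le> z"
      proof (rule ccontr)
        assume n: "\<not> z0 \<le> z"
        then have "X z0 > h" unfolding hz using mono[of z0 z] by simp
        then have "herm N (X z0) > 0" by (rule ht(2))
        then have "G z0 > 0" unfolding H using P[of z0] by (simp add: zero_less_mult_iff)
        then show False using R by simp
      qed
      have r: "\<bar>z + (-1) * \<epsilon> / 2 - airy_i1\<bar> \<le> K * \<epsilon>\<^sup>2" using R \<open>z0 \<le> z\<close> \<open>z \<le> 0\<close> G0 by blast
      have z1: "airy_i1 - 1 \<le> z" using root(1) \<open>z0 \<le> z\<close> by simp
      have JA: "\<bar>J z - airyD 1 z\<bar> \<le> M * \<epsilon>"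
        unfolding J_def M_def by (rule airy_kernel_asymp(2)[OF kern _ e(1) zZ]) (use z1 \<open>z \<le> 0\<close> in auto)
      have J1: "\<bar>\<bar>J z\<bar> / airyD 1 airy_i1 - 1\<bar> \<le> K' * \<epsilon>" by (rule K'(2)[rule_format, OF e(1,4) z1 \<open>z \<le> 0\<close> r JA])
      have kk: "K \<le> K2" "K' \<le> K2" "Z \<le> K2" by (auto simp: K2_def)
      have "\<bar>herm (Suc N) h\<bar> = 2 * sqrt pi * c ^ (N + 2) * \<epsilon>\<^sup>2 * exp (h\<^sup>2 - 3 * (real N / 2) - z / \<epsilon>) * \<bar>J z\<bar>"
      proof -
        have "herm (Suc N) h = - (P z * c * \<epsilon> * J z)" unfolding hz H G0 by simp
        also have "P z * c * \<epsilon> * J z = 2 * sqrt pi * c ^ (N + 2) * \<epsilon>\<^sup>2 * exp (h\<^sup>2 - 3 * (real N / 2) - z / \<epsilon>) * J z"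
          unfolding P_def hz c(2) by (simp add: power2_eq_square mult_ac)
        finally show ?thesis using c e by (simp add: abs_mult)
      qed
      moreover have "\<bar>z - \<epsilon> / 2 - airy_i1\<bar> \<le> K2 * \<epsilon>\<^sup>2"
      proof -
        have "K * \<epsilon>\<^sup>2 \<le> K2 * \<epsilon>\<^sup>2" using kk by (intro mult_right_mono) auto
        then show ?thesis using r by simp
      qed
      moreover have "\<bar>\<bar>J z\<bar> / airyD 1 airy_i1 - 1\<bar> \<le> K2 * \<epsilon>"
      proof -
        have "K' * \<epsilon> \<le> K2 * \<epsilon>" using kk e by (intro mult_right_mono) auto
        then show ?thesis using J1 by simp
      qed
      moreover have "\<bar>z\<bar> \<le> K2" using zZ[OF z1 \<open>z \<le> 0\<close>] kk by simp
      ultimately show ?case using hz unfolding X_def h_def[symmetric] c_def[symmetric] \<epsilon>_def[symmetric] by blast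
    qed
  qed
qed

definition cbrt_two_div :: "nat \<Rightarrow> real" where "cbrt_two_div k = (2 / real k) powr (1/3)"

lemma cbrt_two_div: "k > 0 \<Longrightarrow> cbrt_two_div k > 0" "k > 0 \<Longrightarrow> real k * cbrt_two_div k ^ 3 = 2"
proof -
  assume k: "k > 0"
  then show "cbrt_two_div k > 0" by (simp add: cbrt_two_div_def)
  have "cbrt_two_div k ^ 3 = cbrt_two_div k powr 3" using k by (simp add: cbrt_two_div_def)
  also have "\<dots> = 2 / real k" using k by (simp add: cbrt_two_div_def powr_powr)
  finally show "real k * cbrt_two_div k ^ 3 = 2" using k by simp
qed

lemma cbrt_two_div_tendsto: "cbrt_two_div \<longlonglongrightarrow> 0"
  unfolding cbrt_two_div_def[abs_def] by real_asymp

text \<open>As in the Hermite case, but \<open>\<theta>\<close> decreases in \<open>z\<close>, so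
  the smallest zero has the largest \<open>z\<close>. There \<open>bessK k\<close> vanishes;
  \<open>bessK_rec\<close> then expresses \<open>bessK (k - 1)\<close> by \<open>bessL k\<close>,
  which equals \<open>bessL k + bessK k\<close> and hence the \<open>J\<close> term.\<close>

lemma bessel_root:
  obtains K where "K > 0" "eventually (\<lambda>k. \<exists>z J. 
      \<bar>bess k (bess_zero k)\<bar> = bess_const (k - 1) * ((real k - z / cbrt_two_div k) / real k) * (cbrt_two_div k)\<^sup>2 * exp (- (real k - z / cbrt_two_div k)) * pi * \<bar>J\<bar>
      \<and> \<bar>z + cbrt_two_div k / 2 - airy_i1\<bar> \<le> K * (cbrt_two_div k)\<^sup>2 \<and> \<bar>z\<bar> \<le> K \<and> z \<le> 0 \<and> \<bar>\<bar>J\<bar> / airyD 1 airy_i1 - 1\<bar> \<le> K * cbrt_two_div k) sequentially"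
proof -
  define Z where "Z = 1 - airy_i1"
  define M where "M = 10 ^ 10 * exp ((2 * Z + 5)\<^sup>2)"
  have M: "M > 0" by (simp add: M_def)
  have one: "\<bar>1 :: real\<bar> = 1" by simp
  obtain z0 K \<epsilon>0 where root: "airy_i1 - 1 \<le> z0" "z0 < 0" "K > 0" "\<epsilon>0 > 0"
    "\<forall>\<epsilon> G. 0 < \<epsilon> \<longrightarrow> \<epsilon> < \<epsilon>0 \<longrightarrow> (\<forall>z. z0 \<le> z \<longrightarrow> z \<le> 0 \<longrightarrow> \<bar>G z - airyD 0 z - 1 * \<epsilon> / 4 * airyD 4 z\<bar> \<le> M * \<epsilon>\<^sup>2)
       \<longrightarrow> G z0 < 0 \<and> (\<forall>z. z0 \<le> z \<longrightarrow> z \<le> 0 \<longrightarrow> G z = 0 \<longrightarrow> \<bar>z + 1 * \<epsilon> / 2 - airy_i1\<bar> \<le> K * \<epsilon>\<^sup>2)"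
    using airy_root[OF one M] by blast
  obtain K' where K': "K' > 0" "\<forall>\<epsilon> z J. 0 < \<epsilon> \<longrightarrow> \<epsilon> \<le> 1 \<longrightarrow> airy_i1 - 1 \<le> z \<longrightarrow> z \<le> 0 \<longrightarrow>
     \<bar>z + 1 * \<epsilon> / 2 - airy_i1\<bar> \<le> K * \<epsilon>\<^sup>2 \<longrightarrow> \<bar>J - airyD 1 z\<bar> \<le> M * \<epsilon> \<longrightarrow> \<bar>\<bar>J\<bar> / airyD 1 airy_i1 - 1\<bar> \<le> K' * \<epsilon>"
    using airyD_1_root_bound[OF one root(3) M] by blast
  define K2 where "K2 = max (max K K') Z"
  have ev: "eventually (\<lambda>k. cbrt_two_div k < min \<epsilon>0 1) sequentially"
    using cbrt_two_div_tendsto root(4) by (intro order_tendstoD(2)) auto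
  show ?thesis
  proof (rule that[of K2])
    show "K2 > 0" using root(3) by (simp add: K2_def)
    show "eventually (\<lambda>k. \<exists>z J. 
      \<bar>bess k (bess_zero k)\<bar> = bess_const (k - 1) * ((real k - z / cbrt_two_div k) / real k) * (cbrt_two_div k)\<^sup>2 * exp (- (real k - z / cbrt_two_div k)) * pi * \<bar>J\<bar>
      \<and> \<bar>z + cbrt_two_div k / 2 - airy_i1\<bar> \<le> K2 * (cbrt_two_div k)\<^sup>2 \<and> \<bar>z\<bar> \<le> K2 \<and> z \<le> 0 \<and> \<bar>\<bar>J\<bar> / airyD 1 airy_i1 - 1\<bar> \<le> K2 * cbrt_two_div k) sequentially"
      using ev eventually_gt_at_top[of 0]
    proof eventually_elim
      case (elim k)
      then have k: "k > 0" by simp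
      then obtain l where l: "k = Suc l" by (cases k) auto
      define \<epsilon> where "\<epsilon> = cbrt_two_div k"
      have e: "\<epsilon> > 0" "real k * \<epsilon> ^ 3 = 2" "\<epsilon> < \<epsilon>0" "\<epsilon> \<le> 1" using cbrt_two_div[OF k] elim by (simp_all add: \<epsilon>_def)
      define T where "T z = real k - z / \<epsilon>" for z
      define G where "G z = airy_ray d45 (bess_kernel k \<epsilon>) 0 z" for z
      define J where "J z = airy_ray d45 (bess_kernel k \<epsilon>) 1 z" for z
      have kern: "airy_kernel 1 d45 \<epsilon> (bess_kernel k \<epsilon>)" by (rule bess_kernel_airy[OF k e(1,2)])
      have zZ: "\<bar>z\<bar> \<le> Z" if "airy_i1 - 1 \<le> z" "z \<le> 0" for z using that by (simp add: Z_def)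
      have GA: "\<bar>G z - airyD 0 z - 1 * \<epsilon> / 4 * airyD 4 z\<bar> \<le> M * \<epsilon>\<^sup>2" if "z0 \<le> z" "z \<le> 0" for z
        unfolding G_def M_def by (rule airy_kernel_asymp(1)[OF kern _ e(1) zZ]) (use that root in auto)
      note R = root(5)[rule_format, OF e(1,3) GA]
      have KG: "bessK k (T z) = \<epsilon> * exp (- T z) * pi * G z" "bessL k (T z) + bessK k (T z) = - (\<epsilon>\<^sup>2 * exp (- T z) * pi * J z)" for z
        unfolding G_def J_def by (rule bess_airy_ray[OF e(1) T_def])+
      have bG: "bess (Suc k) ((T z)\<^sup>2 / 2) = bess_const k * (\<epsilon> * exp (- T z) * pi) * G z" if "T z > 0" for z
        unfolding bess_eq_bessK[OF that] KG by simp
      have cp: "bess_const k * (\<epsilon> * exp (- T z) * pi) > 0" for z using bess_const_pos[of k] e by simp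
      define \<theta> where "\<theta> = sqrt (2 * bess_zero k)"
      have \<theta>: "\<theta> > 0" "\<theta>\<^sup>2 / 2 = bess_zero k" using bess_zero(2)[of k] by (simp_all add: \<theta>_def)
      define z where "z = (real k - \<theta>) * \<epsilon>"
      have Tz: "T z = \<theta>" using e by (simp add: T_def z_def)
      have G0: "G z = 0"
        using bG[of z] bess_const_pos[of k] e \<theta> bess_zero(1)[of k] unfolding Tz by simp
      have "z \<le> 0"
      proof (rule ccontr)
        assume "\<not> z \<le> 0"
        then have "\<theta> < real k" using e by (simp add: z_def mult_le_0_iff)
        then have "bess (Suc k) (\<theta>\<^sup>2 / 2) > 0" using \<theta> by (intro bess_pos) auto
        then show False using \<theta> bess_zero(1)[of k] by simp
      qed
      have "z0 \<le> z"
      proof (rule ccontr)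
        assume n: "\<not> z0 \<le> z"
        have "- z0 / \<epsilon> < - z / \<epsilon>" using n e by (intro divide_strict_right_mono) auto
        then have "T z0 < \<theta>" unfolding Tz[symmetric] T_def by simp
        moreover have T0: "T z0 > 0" using root(2) e k unfolding T_def
          by (smt (verit) divide_neg_pos of_nat_0_less_iff)
        ultimately have "(T z0)\<^sup>2 < \<theta>\<^sup>2" by (intro power_strict_mono) auto
        then have "bess (Suc k) ((T z0)\<^sup>2 / 2) > 0" using \<theta> by (intro bess_zero(3)) auto
        then have "G z0 > 0" using bG[OF T0] cp[of z0] by (metis zero_less_mult_pos)
        then show False using R by simp
      qed
      have r: "\<bar>z + 1 * \<epsilon> / 2 - airy_i1\<bar> \<le> K * \<epsilon>\<^sup>2" using R \<open>z0 \<le> z\<close> \<open>z \<le> 0\<close> G0 by blast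
      have z1: "airy_i1 - 1 \<le> z" using root(1) \<open>z0 \<le> z\<close> by simp
      have JA: "\<bar>J z - airyD 1 z\<bar> \<le> M * \<epsilon>"
        unfolding J_def M_def by (rule airy_kernel_asymp(2)[OF kern _ e(1) zZ]) (use z1 \<open>z \<le> 0\<close> in auto)
      have J1: "\<bar>\<bar>J z\<bar> / airyD 1 airy_i1 - 1\<bar> \<le> K' * \<epsilon>" by (rule K'(2)[rule_format, OF e(1,4) z1 \<open>z \<le> 0\<close> r JA])
      have kk: "K \<le> K2" "K' \<le> K2" "Z \<le> K2" by (auto simp: K2_def)
      have "\<bar>bess k (bess_zero k)\<bar> = bess_const (k - 1) * (\<theta> / real k) * \<epsilon>\<^sup>2 * exp (- \<theta>) * pi * \<bar>J z\<bar>"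
      proof -
        have K0: "bessK k \<theta> = 0" using KG(1)[of z] G0 unfolding Tz by simp
        have "real k * bessK l \<theta> = \<theta> * bessL k \<theta>" using bessK_rec[of l \<theta>] K0 unfolding l by simp
        then have "bessK l \<theta> = \<theta> / real k * bessL k \<theta>" using k by (simp add: field_simps)
        also have "bessL k \<theta> = - (\<epsilon>\<^sup>2 * exp (- \<theta>) * pi * J z)" using KG(2)[of z] K0 unfolding Tz by simp
        finally have KL: "bessK l \<theta> = \<theta> / real k * - (\<epsilon>\<^sup>2 * exp (- \<theta>) * pi * J z)" .
        have "bess k (bess_zero k) = bess_const l * bessK l \<theta>" using bess_eq_bessK[OF \<theta>(1), of l] \<theta>(2) l by simp
        then show ?thesis unfolding KL using bess_const_pos[of l] e \<theta>(1) by (simp add: l abs_mult)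
      qed
      moreover have "\<bar>z + \<epsilon> / 2 - airy_i1\<bar> \<le> K2 * \<epsilon>\<^sup>2"
      proof -
        have "K * \<epsilon>\<^sup>2 \<le> K2 * \<epsilon>\<^sup>2" using kk by (intro mult_right_mono) auto
        then show ?thesis using r by simp
      qed
      moreover have "\<bar>\<bar>J z\<bar> / airyD 1 airy_i1 - 1\<bar> \<le> K2 * \<epsilon>"
      proof -
        have "K' * \<epsilon> \<le> K2 * \<epsilon>" using kk e by (intro mult_right_mono) auto
        then show ?thesis using J1 by simp
      qed
      moreover have "\<bar>z\<bar> \<le> K2" using zZ[OF z1 \<open>z \<le> 0\<close>] kk by simp
      ultimately show ?case using \<open>z \<le> 0\<close> unfolding Tz[symmetric] T_def \<epsilon>_def[symmetric] by blast
    qed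
  qed
qed

section \<open>The normalising constant and Wallis' product\<close>

lemma bess_const_wallis:
  "(bess_const m)\<^sup>2 * real (2 * m + 3) * (\<Prod>k=1..Suc m. 4 * real k ^ 2 / (4 * real k ^ 2 - 1)) = (real (Suc m))\<^sup>2 * 4 ^ Suc m"
proof (induction m)
  case (Suc m)
  define x where "x = real m"
  have x: "x \<ge> 0" by (simp add: x_def)
  define W where "W = (\<Prod>k=1..Suc m. 4 * real k ^ 2 / (4 * real k ^ 2 - 1))"
  have P: "(\<Prod>k=1..Suc (Suc m). 4 * real k ^ 2 / (4 * real k ^ 2 - 1)) = W * (4 * (x + 2)\<^sup>2 / ((2 * x + 3) * (2 * x + 5)))"
    unfolding W_def by (simp add: x_def power2_eq_square algebra_simps)
  have C: "bess_const (Suc m) = bess_const m * (2 * x + 3) / (x + 1)"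
    by (simp add: x_def algebra_simps)
  have IH: "(bess_const m)\<^sup>2 * (2 * x + 3) * W = (x + 1)\<^sup>2 * 4 ^ Suc m"
    using Suc by (simp add: W_def x_def algebra_simps)
  have "(bess_const m * (2 * x + 3) / (x + 1))\<^sup>2 * (2 * x + 5) * (W * (4 * (x + 2)\<^sup>2 / ((2 * x + 3) * (2 * x + 5))))
      = ((bess_const m)\<^sup>2 * (2 * x + 3) * W) * (4 * (x + 2)\<^sup>2 / (x + 1)\<^sup>2)"
    using x by (simp add: divide_simps power2_eq_square)
  also have "\<dots> = (x + 2)\<^sup>2 * 4 ^ Suc (Suc m)" unfolding IH using x by (simp add: divide_simps)
  finally show ?case unfolding P C by (simp add: x_def algebra_simps)
qed simp

text \<open>\<open>r\<close> increases and \<open>r m * (m + 2) / (m + 1)\<close> decreases, both to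
  \<open>1 / pi\<close> by Wallis' product. The two monotone bounds give the limit together with an
  explicit relative error \<open>1 / (m + 1)\<close>.\<close>

lemma bess_const_bounds:
  defines "r \<equiv> \<lambda>m. (bess_const m)\<^sup>2 / (4 ^ Suc m * real (Suc m))"
  shows "r m \<le> 1 / pi" "1 / pi \<le> r m * (real m + 2) / (real m + 1)"
proof -
  have r: "r (Suc m) = r m * ((2 * real m + 3)\<^sup>2 / (4 * (real m + 1) * (real m + 2)))" for m
    by (simp add: r_def divide_simps power2_eq_square) (simp add: algebra_simps)
  have r0: "r m > 0" for m using bess_const_pos[of m] by (simp add: r_def)
  have "incseq r"
  proof (rule incseq_SucI)
    fix m
    have "1 \<le> (2 * real m + 3)\<^sup>2 / (4 * (real m + 1) * (real m + 2))"
      by (subst le_divide_eq_1_pos) (auto simp: power2_eq_square algebra_simps intro!: add_pos_nonneg)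
    then have "r m * 1 \<le> r m * ((2 * real m + 3)\<^sup>2 / (4 * (real m + 1) * (real m + 2)))"
      using r0[of m] by (intro mult_left_mono) (simp_all only: less_imp_le)
    then show "r m \<le> r (Suc m)" unfolding r mult_1_right .
  qed
  have dec: "decseq (\<lambda>m. r m * (real m + 2) / (real m + 1))"
  proof (rule decseq_SucI)
    fix m
    define x where "x = real m"
    have x: "x \<ge> 0" by (simp add: x_def)
    have "(2 * x + 3)\<^sup>2 / (4 * (x + 1) * (x + 2)) * (x + 3) / (x + 2) \<le> (x + 2) / (x + 1)"
      using x by (simp add: divide_simps power2_eq_square) (simp add: algebra_simps)
    then have "r m * ((2 * x + 3)\<^sup>2 / (4 * (x + 1) * (x + 2)) * (x + 3) / (x + 2)) \<le> r m * ((x + 2) / (x + 1))"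
      using r0[of m] by (intro mult_left_mono) auto
    then show "r (Suc m) * (real (Suc m) + 2) / (real (Suc m) + 1) \<le> r m * (real m + 2) / (real m + 1)"
      unfolding r x_def by (simp add: add.commute add.left_commute)
  qed
  have W: "(\<lambda>m. \<Prod>k=1..Suc m. 4 * real k ^ 2 / (4 * real k ^ 2 - 1)) \<longlonglongrightarrow> pi / 2"
    using LIMSEQ_Suc[OF wallis] by simp
  have req: "r m = ((real m + 1) / (2 * real m + 3)) / (\<Prod>k=1..Suc m. 4 * real k ^ 2 / (4 * real k ^ 2 - 1))" for m
  proof -
    define Q where "Q = (\<Prod>k=1..Suc m. 4 * real k ^ 2 / (4 * real k ^ 2 - 1))"
    have e: "(bess_const m)\<^sup>2 * (2 * real m + 3) * Q = (real m + 1)\<^sup>2 * 4 ^ Suc m"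
      using bess_const_wallis[of m] unfolding Q_def by (simp add: algebra_simps)
    have "Q \<noteq> 0" using e by (auto simp: add_eq_0_iff)
    moreover have "2 * real m + 3 \<noteq> 0" using of_nat_0_le_iff[of m] by linarith
    ultimately have "(2 * real m + 3) * Q \<noteq> 0" by simp
    then have "(bess_const m)\<^sup>2 = (real m + 1)\<^sup>2 * 4 ^ Suc m / ((2 * real m + 3) * Q)"
      using e by (simp only: eq_divide_eq mult.assoc if_False if_True simp_thms)
    then have "r m = (real m + 1)\<^sup>2 * 4 ^ Suc m / ((2 * real m + 3) * Q) / (4 ^ Suc m * (real m + 1))"
      unfolding r_def by (simp add: add.commute)
    also have "\<dots> = ((real m + 1) / (2 * real m + 3)) / Q" by (simp add: power2_eq_square)
    finally show ?thesis unfolding Q_def .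
  qed
  have "(\<lambda>m. (real m + 1) / (2 * real m + 3)) \<longlonglongrightarrow> 1 / 2" by real_asymp
  from tendsto_divide[OF this W] have lim: "r \<longlonglongrightarrow> 1 / pi" unfolding req[symmetric] by simp
  show "r m \<le> 1 / pi" by (rule incseq_le[OF \<open>incseq r\<close> lim])
  have "(\<lambda>m. (real m + 2) / (real m + 1)) \<longlonglongrightarrow> 1" by real_asymp
  from tendsto_mult[OF lim this] have "(\<lambda>m. r m * (real m + 2) / (real m + 1)) \<longlonglongrightarrow> 1 / pi" by simp
  from decseq_ge[OF dec this] show "1 / pi \<le> r m * (real m + 2) / (real m + 1)" .
qed

lemma bess_const_asymp:
  assumes k: "k > 0"
  shows "\<bar>bess_const (k - 1) * sqrt pi / (sqrt (real k) * 2 ^ k) - 1\<bar> \<le> 1 / real k"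
proof -
  obtain m where m: "k = Suc m" using k by (cases k) auto
  define a where "a = bess_const m * sqrt pi / (sqrt (real k) * 2 ^ k)"
  have a: "a \<ge> 0" using bess_const_pos[of m] by (simp add: a_def)
  have "(2 ^ k)\<^sup>2 = (4 :: real) ^ k" by (simp add: power_even_eq[symmetric] power_mult)
  then have a2: "a\<^sup>2 = pi * ((bess_const m)\<^sup>2 / (4 ^ Suc m * real (Suc m)))"
    by (simp add: a_def power_divide power_mult_distrib m mult_ac)
  have "a\<^sup>2 \<le> pi * (1 / pi)" unfolding a2 by (intro mult_left_mono bess_const_bounds) auto
  then have "a\<^sup>2 \<le> 1" by simp
  then have a1: "a \<le> 1" using a by (simp add: power_le_one_iff)
  have "pi * (1 / pi) \<le> pi * ((bess_const m)\<^sup>2 / (4 ^ Suc m * real (Suc m)) * (real m + 2) / (real m + 1))"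
    by (intro mult_left_mono bess_const_bounds) auto
  then have "1 \<le> a\<^sup>2 * (1 + 1 / real k)" unfolding a2 by (simp add: m field_simps)
  also have "\<dots> \<le> a\<^sup>2 + 1 / real k" using \<open>a\<^sup>2 \<le> 1\<close> by (simp add: algebra_simps mult_left_le divide_right_mono)
  \<comment> \<open>As \<open>a \<le> 1\<close>, the lower bound for the square passes to
    \<open>a\<close> itself.\<close>
  also have "a\<^sup>2 \<le> a" using a a1 by (simp add: power2_eq_square mult_left_le)
  finally have "1 - 1 / real k \<le> a" by simp
  then have "\<bar>a - 1\<bar> \<le> 1 / real k" using a1 by simp
  then show ?thesis by (simp add: a_def m)
qed

section \<open>Assembling the two expansions\<close>

lemma eventually_choice2:
  assumes "eventually (\<lambda>k. \<exists>z J. Q k z J) F"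
  obtains z J where "eventually (\<lambda>k. Q k (z k) (J k)) F"
proof -
  define p where "p k = (SOME p. Q k (fst p) (snd p))" for k
  have "eventually (\<lambda>k. Q k (fst (p k)) (snd (p k))) F"
    using assms
  proof eventually_elim
    case (elim k)
    then have "\<exists>p. Q k (fst p) (snd p)" by auto
    then show ?case unfolding p_def by (rule someI_ex)
  qed
  then show ?thesis by (rule that)
qed

text \<open>The quotient splits into four factors \<open>1 + O(\<epsilon>)\<close>: the Wallis
  constant, \<open>\<theta> / k\<close>, the exponential of the root error, and the normalised
  \<open>Ai'\<close>. In \<open>f\<close>, the summand 1/2 compensates the root shift
  \<open>- \<epsilon> / 2\<close> divided by \<open>\<epsilon>\<close>.\<close>

theorem bessel_asymp:
  "(\<lambda>k. \<bar>bess k (bess_zero k)\<bar> / (4 powr (1/3) * sqrt (pi / exp 1) * airyD 1 airy_i1 * (2 / exp 1) ^ k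
      * exp (- (- airy_i1 / 2 powr (1/3)) * real k powr (1/3)) * real k powr (-1/6)) - 1) \<in> O(\<lambda>k. real k powr (-1/3))"
proof -
  obtain K where K: "K > 0" and ev0: "eventually (\<lambda>k. \<exists>z J. 
      \<bar>bess k (bess_zero k)\<bar> = bess_const (k - 1) * ((real k - z / cbrt_two_div k) / real k) * (cbrt_two_div k)\<^sup>2 * exp (- (real k - z / cbrt_two_div k)) * pi * \<bar>J\<bar>
      \<and> \<bar>z + cbrt_two_div k / 2 - airy_i1\<bar> \<le> K * (cbrt_two_div k)\<^sup>2 \<and> \<bar>z\<bar> \<le> K \<and> z \<le> 0 \<and> \<bar>\<bar>J\<bar> / airyD 1 airy_i1 - 1\<bar> \<le> K * cbrt_two_div k) sequentially"
    by (rule bessel_root)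
  obtain z J where ev: "eventually (\<lambda>k.
      \<bar>bess k (bess_zero k)\<bar> = bess_const (k - 1) * ((real k - z k / cbrt_two_div k) / real k) * (cbrt_two_div k)\<^sup>2 * exp (- (real k - z k / cbrt_two_div k)) * pi * \<bar>J k\<bar>
      \<and> \<bar>z k + cbrt_two_div k / 2 - airy_i1\<bar> \<le> K * (cbrt_two_div k)\<^sup>2 \<and> \<bar>z k\<bar> \<le> K \<and> z k \<le> 0 \<and> \<bar>\<bar>J k\<bar> / airyD 1 airy_i1 - 1\<bar> \<le> K * cbrt_two_div k) sequentially"
    by (rule eventually_choice2[OF ev0])
  define A where "A = airyD 1 airy_i1"
  have A: "A > 0" unfolding A_def by (rule airy_i1_deriv)
  define R1 where "R1 k = bess_const (k - 1) * sqrt pi / (sqrt (real k) * 2 ^ k)" for k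
  define R2 where "R2 k = (real k - z k / cbrt_two_div k) / real k" for k
  define f where "f k = (z k - airy_i1) / cbrt_two_div k + 1 / 2" for k
  define R4 where "R4 k = \<bar>J k\<bar> / A" for k
  have small: "eventually (\<lambda>k. cbrt_two_div k < 1) sequentially"
    using cbrt_two_div_tendsto by (intro order_tendstoD(2)) auto
  note evs = ev small eventually_gt_at_top[of "0::nat"]
  \<comment> \<open>As \<open>k \<epsilon> ^ 3 = 2\<close>, each of these quantities is a multiple
    of a higher power of \<open>\<epsilon>\<close>.\<close>
  have e2: "(cbrt_two_div k)\<^sup>2 \<le> cbrt_two_div k" "1 / real k \<le> cbrt_two_div k" "1 / (cbrt_two_div k * real k) \<le> cbrt_two_div k"
    if "cbrt_two_div k < 1" "0 < k" for k
  proof -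
    note c = cbrt_two_div[OF \<open>0 < k\<close>]
    show s: "(cbrt_two_div k)\<^sup>2 \<le> cbrt_two_div k" using that c by (simp add: power2_eq_square mult_left_le)
    have i: "1 / real k = cbrt_two_div k ^ 3 / 2" using c that by (simp add: field_simps)
    have "cbrt_two_div k ^ 3 \<le> cbrt_two_div k" using power_decreasing[of 1 3 "cbrt_two_div k"] that c by simp
    then show "1 / real k \<le> cbrt_two_div k" unfolding i using c by simp
    have "1 / (cbrt_two_div k * real k) = (1 / real k) / cbrt_two_div k" by simp
    also have "\<dots> = (cbrt_two_div k)\<^sup>2 / 2" unfolding i using c by (simp add: power2_eq_square power3_eq_cube)
    finally show "1 / (cbrt_two_div k * real k) \<le> cbrt_two_div k" using s c by simp
  qed
  have "(\<lambda>k. R1 k - 1) \<in> O(cbrt_two_div)"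
  proof (rule bigoI[where c = 1])
    show "eventually (\<lambda>k. norm (R1 k - 1) \<le> 1 * norm (cbrt_two_div k)) sequentially" using evs
    proof eventually_elim
      case (elim k)
      have "\<bar>R1 k - 1\<bar> \<le> cbrt_two_div k"
        using bess_const_asymp[of k] e2(2)[of k] elim unfolding R1_def by linarith
      then show ?case using cbrt_two_div(1)[of k] elim by simp
    qed
  qed
  moreover have "(\<lambda>k. R2 k - 1) \<in> O(cbrt_two_div)"
  proof (rule bigoI[where c = K])
    show "eventually (\<lambda>k. norm (R2 k - 1) \<le> K * norm (cbrt_two_div k)) sequentially" using evs
    proof eventually_elim
      case (elim k)
      have "\<bar>R2 k - 1\<bar> = \<bar>z k\<bar> * (1 / (cbrt_two_div k * real k))"
        using elim cbrt_two_div(1)[of k] by (simp add: R2_def diff_divide_distrib abs_divide abs_mult)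
      also have "\<dots> \<le> K * cbrt_two_div k"
        using elim e2(3)[of k] cbrt_two_div(1)[of k] K by (intro mult_mono) auto
      finally show ?case using cbrt_two_div(1)[of k] elim by simp
    qed
  qed
  moreover have "(\<lambda>k. exp (f k) - 1) \<in> O(cbrt_two_div)"
  proof (rule bigo_exp[OF bigoI[where c = K] cbrt_two_div_tendsto])
    show "eventually (\<lambda>k. norm (f k) \<le> K * norm (cbrt_two_div k)) sequentially" using evs
    proof eventually_elim
      case (elim k)
      define e where "e = cbrt_two_div k"
      have e: "e > 0" using elim cbrt_two_div(1) by (simp add: e_def)
      have "f k = (z k + e / 2 - airy_i1) / e" using e unfolding f_def e_def[symmetric] by (simp add: field_simps)
      then have "\<bar>f k\<bar> = \<bar>z k + e / 2 - airy_i1\<bar> / e" using e by simp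
      also have "\<dots> \<le> K * e\<^sup>2 / e" using elim e unfolding e_def[symmetric] by (intro divide_right_mono) auto
      also have "\<dots> = K * e" using e by (simp add: power2_eq_square)
      finally show ?case using e by (simp add: e_def)
    qed
  qed
  moreover have "(\<lambda>k. R4 k - 1) \<in> O(cbrt_two_div)"
  proof (rule bigoI[where c = K])
    show "eventually (\<lambda>k. norm (R4 k - 1) \<le> K * norm (cbrt_two_div k)) sequentially" using evs
    proof eventually_elim
      case (elim k)
      then show ?case using cbrt_two_div(1)[of k] unfolding R4_def A_def real_norm_def by simp
    qed
  qed
  moreover have "cbrt_two_div \<in> O(\<lambda>_. 1)" unfolding cbrt_two_div_def[abs_def] by real_asymp
  ultimately have "(\<lambda>k. R1 k * (R2 k * (exp (f k) * R4 k)) - 1) \<in> O(cbrt_two_div)"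
    by (intro bigo_one_mult)
  also have "cbrt_two_div \<in> O(\<lambda>k. real k powr (-1/3))" unfolding cbrt_two_div_def[abs_def] by real_asymp
  finally have main: "(\<lambda>k. R1 k * (R2 k * (exp (f k) * R4 k)) - 1) \<in> O(\<lambda>k. real k powr (-1/3))" .
  have "eventually (\<lambda>k. \<bar>bess k (bess_zero k)\<bar> / (4 powr (1/3) * sqrt (pi / exp 1) * A * (2 / exp 1) ^ k
      * exp (- (- airy_i1 / 2 powr (1/3)) * real k powr (1/3)) * real k powr (-1/6)) - 1 = R1 k * (R2 k * (exp (f k) * R4 k)) - 1) sequentially"
    using evs
  proof eventually_elim
    case (elim k)
    define e where "e = cbrt_two_div k"
    have e: "e > 0" using elim cbrt_two_div(1) by (simp add: e_def)
    define E where "E = exp (airy_i1 / e)"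
    define s where "s = sqrt pi"
    define q where "q = sqrt (real k)"
    define t where "t = real k powr (-1/6)"
    define u :: real where "u = 4 powr (1/3)"
    define v where "v = exp (- real k)"
    define w :: real where "w = exp (- 1 / 2)"
    have pos: "E > 0" "s > 0" "q > 0" "t > 0" "u > 0" "v > 0" "w > 0" "s * s = pi"
      using elim by (simp_all add: E_def s_def q_def t_def u_def v_def w_def)
    have h1: "- (- airy_i1 / 2 powr (1/3)) * real k powr (1/3) = airy_i1 / e"
      using elim by (simp add: e_def cbrt_two_div_def powr_divide)
    have h2: "(2 / exp 1 :: real) ^ k = 2 ^ k * v"
      using exp_of_nat_mult[of k "1 :: real"] by (simp add: v_def power_divide exp_minus divide_inverse power_inverse)
    have h3: "sqrt (pi / exp 1) = s * w"
    proof -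
      have "w * w = inverse (exp 1)" by (simp add: w_def exp_add[symmetric] exp_minus[symmetric])
      then have "pi / exp 1 = (s * s) * (w * w)" using pos by (simp add: divide_inverse)
      then have "pi / exp 1 = (s * w)\<^sup>2" by (simp only: power2_eq_square mult_ac)
      then show ?thesis using pos by simp
    qed
    \<comment> \<open>The factor \<open>\<epsilon>\<^sup>2\<close> of the root formula and
      \<open>sqrt k\<close> of \<open>bess_const\<close> combine to
      \<open>4 powr (1/3) * k powr (-1/6)\<close>.\<close>
    have h4: "e\<^sup>2 * q = u * t"
    proof -
      define l where "l = ln (real k)"
      have "e = exp ((ln 2 - l) / 3)" using elim by (simp add: e_def cbrt_two_div_def powr_def ln_div l_def)
      moreover have "q = exp (l / 2)" using elim by (simp add: q_def l_def powr_half_sqrt[symmetric] powr_def)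
      moreover have "ln 4 = 2 * ln (2 :: real)" using ln_realpow[of 2 2] by simp
      then have "u = exp (2 / 3 * ln 2)" by (simp add: u_def powr_def)
      moreover have "t = exp (- l / 6)" using elim by (simp add: t_def l_def powr_def)
      ultimately show ?thesis by (simp add: power2_eq_square exp_add[symmetric]) (simp add: field_simps)
    qed
    have h5: "exp (- (real k - z k / e)) = v * E * exp (f k) * w"
      unfolding v_def E_def w_def f_def e_def[symmetric] exp_add[symmetric]
      using e by (simp add: diff_divide_distrib)
    have h6: "e\<^sup>2 = u * t / q" using h4 pos by (simp add: field_simps)
    have h7: "pi * \<bar>J k\<bar> = s * s * (R4 k * A)" using pos A by (simp add: R4_def)
    have "\<bar>bess k (bess_zero k)\<bar> = bess_const (k - 1) * R2 k * (u * t / q) * (v * E * exp (f k) * w) * (s * s * (R4 k * A))"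
      using elim unfolding R2_def e_def[symmetric] h5 h6 h7[symmetric] by simp
    also have "\<dots> / (u * (s * w) * A * (2 ^ k * v) * E * t) = bess_const (k - 1) * s / (q * 2 ^ k) * (R2 k * (exp (f k) * R4 k))"
      using pos A by (simp add: field_simps)
    finally show ?case unfolding h1 h2 h3 R1_def s_def[symmetric] q_def[symmetric] E_def[symmetric] u_def[symmetric] t_def[symmetric] by simp
  qed
  from landau_o.big.in_cong[OF this] main show ?thesis unfolding A_def by blast
qed

text \<open>The expansion arises in the index \<open>N = m - 1\<close> of the zero and is rewritten
  in \<open>m\<close>: \<open>f\<close> contains the errors of the root, \<open>g\<close> the cost
  of this change of variable.\<close>

theorem hermite_asymp:
  "(\<lambda>m. \<bar>herm m (herm_top (m - 1))\<bar> / (sqrt (2 * pi / exp 1) * airyD 1 airy_i1 * (exp 1 * real m / 2) powr (real m / 2)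
      * exp (airy_i1 * real m powr (1/3)) * real m powr (-1/6)) - 1) \<in> O(\<lambda>m. real m powr (-1/3))"
  (is "?F \<in> _")
proof -
  obtain K where K: "K > 0" and ev0: "eventually (\<lambda>N. \<exists>z J. herm_top N = 2 * sqrt (real N / 2) + z / (2 * sqrt (real N / 2) * cbrt_inv N)
      \<and> \<bar>herm (Suc N) (herm_top N)\<bar> = 2 * sqrt pi * sqrt (real N / 2) ^ (N + 2) * (cbrt_inv N)\<^sup>2
           * exp ((herm_top N)\<^sup>2 - 3 * (real N / 2) - z / cbrt_inv N) * \<bar>J\<bar>
      \<and> \<bar>z - cbrt_inv N / 2 - airy_i1\<bar> \<le> K * (cbrt_inv N)\<^sup>2 \<and> \<bar>z\<bar> \<le> K \<and> \<bar>\<bar>J\<bar> / airyD 1 airy_i1 - 1\<bar> \<le> K * cbrt_inv N) sequentially"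
    by (rule hermite_root)
  obtain z J where ev: "eventually (\<lambda>N. herm_top N = 2 * sqrt (real N / 2) + z N / (2 * sqrt (real N / 2) * cbrt_inv N)
      \<and> \<bar>herm (Suc N) (herm_top N)\<bar> = 2 * sqrt pi * sqrt (real N / 2) ^ (N + 2) * (cbrt_inv N)\<^sup>2
           * exp ((herm_top N)\<^sup>2 - 3 * (real N / 2) - z N / cbrt_inv N) * \<bar>J N\<bar>
      \<and> \<bar>z N - cbrt_inv N / 2 - airy_i1\<bar> \<le> K * (cbrt_inv N)\<^sup>2 \<and> \<bar>z N\<bar> \<le> K \<and> \<bar>\<bar>J N\<bar> / airyD 1 airy_i1 - 1\<bar> \<le> K * cbrt_inv N) sequentially"
    by (rule eventually_choice2[OF ev0])
  define A where "A = airyD 1 airy_i1"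
  have A: "A > 0" unfolding A_def by (rule airy_i1_deriv)
  define f where "f N = (z N - airy_i1) / cbrt_inv N - 1 / 2 + (z N)\<^sup>2 * cbrt_inv N / 2" for N
  \<comment> \<open>The initial 1/2 cancels the limit \<open>- 1 / 2\<close> of
    \<open>(N + 1) / 2 * ln (N / (N + 1))\<close>, so \<open>g\<close> tends to 0.\<close>
  define g where "g N = 1 / 2 + (real N + 1) / 2 * (ln (real N) - ln (real N + 1)) + (ln (real N + 1) - ln (real N)) / 6
     + airy_i1 * (real N powr (1/3) - (real N + 1) powr (1/3))" for N
  define R4 where "R4 N = \<bar>J N\<bar> / A" for N
  note evs = ev eventually_gt_at_top[of "0::nat"]
  have "f \<in> O(cbrt_inv)"
  proof (rule bigoI[where c = "K + K\<^sup>2 / 2"])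
    show "eventually (\<lambda>N. norm (f N) \<le> (K + K\<^sup>2 / 2) * norm (cbrt_inv N)) sequentially" using evs
    proof eventually_elim
      case (elim N)
      define e where "e = cbrt_inv N"
      have e: "e > 0" using elim cbrt_inv(1) by (simp add: e_def)
      have "\<bar>z N - e / 2 - airy_i1\<bar> / e \<le> K * e\<^sup>2 / e" using elim e unfolding e_def[symmetric] by (intro divide_right_mono) auto
      also have "K * e\<^sup>2 / e = K * e" using e by (simp add: power2_eq_square)
      finally have 1: "\<bar>(z N - e / 2 - airy_i1) / e\<bar> \<le> K * e" using e by simp
      have "(z N)\<^sup>2 \<le> K\<^sup>2" using elim K by (simp add: abs_le_square_iff[symmetric])
      then have "(z N)\<^sup>2 * e / 2 \<le> K\<^sup>2 * e / 2" using e by simp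
      moreover have "(z N)\<^sup>2 * e / 2 \<ge> 0" using e by simp
      moreover have "f N = (z N - e / 2 - airy_i1) / e + (z N)\<^sup>2 * e / 2"
        using e unfolding f_def e_def[symmetric] by (simp add: diff_divide_distrib)
      ultimately have "\<bar>f N\<bar> \<le> K * e + K\<^sup>2 * e / 2" using 1 by linarith
      then show ?case using e by (simp add: e_def algebra_simps)
    qed
  qed
  moreover have "g \<in> O(cbrt_inv)"
  proof -
    have "(\<lambda>N. 1 / 2 + (real N + 1) / 2 * (ln (real N) - ln (real N + 1)) + (ln (real N + 1) - ln (real N)) / 6) \<in> O(\<lambda>N. real N powr (-1/3))"
      by real_asymp
    moreover have "(\<lambda>N. real N powr (1/3) - (real N + 1) powr (1/3)) \<in> O(\<lambda>N. real N powr (-1/3))" by real_asymp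
    then have "(\<lambda>N. airy_i1 * (real N powr (1/3) - (real N + 1) powr (1/3))) \<in> O(\<lambda>N. real N powr (-1/3))"
      by (subst cmult_in_bigo_iff) (rule disjI2)
    ultimately show ?thesis unfolding g_def cbrt_inv_def by (rule sum_in_bigo)
  qed
  ultimately have "(\<lambda>N. f N + g N) \<in> O(cbrt_inv)" by (rule sum_in_bigo)
  then have "(\<lambda>N. exp (f N + g N) - 1) \<in> O(cbrt_inv)" by (rule bigo_exp[OF _ cbrt_inv_tendsto])
  moreover have "(\<lambda>N. R4 N - 1) \<in> O(cbrt_inv)"
  proof (rule bigoI[where c = K])
    show "eventually (\<lambda>k. norm (R4 k - 1) \<le> K * norm (cbrt_inv k)) sequentially" using evs
    proof eventually_elim
      case (elim k)
      then show ?case using cbrt_inv(1)[of k] unfolding R4_def A_def real_norm_def by simp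
    qed
  qed
  moreover have "cbrt_inv \<in> O(\<lambda>_. 1)" unfolding cbrt_inv_def[abs_def] by real_asymp
  ultimately have "(\<lambda>N. exp (f N + g N) * R4 N - 1) \<in> O(cbrt_inv)" by (rule bigo_one_mult)
  also have "cbrt_inv \<in> O(\<lambda>N. real (Suc N) powr (-1/3))" unfolding cbrt_inv_def[abs_def] by real_asymp
  finally have main: "(\<lambda>N. exp (f N + g N) * R4 N - 1) \<in> O(\<lambda>N. real (Suc N) powr (-1/3))" .
  have "eventually (\<lambda>N. ?F (Suc N) = exp (f N + g N) * R4 N - 1) sequentially"
    using evs
  proof eventually_elim
    case (elim N)
    define n where "n = real N"
    have n: "n > 0" "real (Suc N) = n + 1" using elim by (simp_all add: n_def)
    define e where "e = cbrt_inv N"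
    have e: "e > 0" "n * e ^ 3 = 1" using elim cbrt_inv by (simp_all add: e_def n_def)
    define c where "c = sqrt (n / 2)"
    have c: "c > 0" "c\<^sup>2 = n / 2" using n by (simp_all add: c_def)
    define x where "x = n powr (1/3)"
    have ex: "1 / e = x" using n by (simp add: e_def cbrt_inv_def x_def n_def powr_minus field_simps)
    \<comment> \<open>Squaring \<open>herm_top N\<close> yields
      \<open>4 c\<^sup>2 + 2 z / \<epsilon>\<close> and a term quadratic in \<open>z\<close>, which
      equals \<open>z\<^sup>2 \<epsilon> / 2\<close> because
      \<open>4 c\<^sup>2 \<epsilon>\<^sup>2 = 2 / \<epsilon>\<close>.\<close>
    have top: "(herm_top N)\<^sup>2 - 3 * (n / 2) - z N / e = n / 2 + z N * x + (z N)\<^sup>2 * e / 2"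
    proof -
      have h: "herm_top N = 2 * c + z N / (2 * c * e)" using elim by (simp add: c_def n_def e_def)
      have "(herm_top N)\<^sup>2 = 4 * c\<^sup>2 + 2 * (z N / e) + (z N)\<^sup>2 / (4 * c\<^sup>2 * e\<^sup>2)"
        unfolding h using c e by (simp add: field_simps power2_eq_square)
      also have "(z N)\<^sup>2 / (4 * c\<^sup>2 * e\<^sup>2) = (z N)\<^sup>2 * e / (2 * (n * e ^ 3))"
      proof -
        have "(z N)\<^sup>2 / (4 * c\<^sup>2 * e\<^sup>2) = (z N)\<^sup>2 / (2 * n * e\<^sup>2)" unfolding c(2) by simp
        also have "\<dots> = (z N)\<^sup>2 * e / (2 * n * e\<^sup>2 * e)" using e(1) by simp
        finally show ?thesis by (simp add: power2_eq_square power3_eq_cube mult.assoc)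
      qed
      finally show ?thesis using c e(2) ex[symmetric] by simp
    qed
    have l1: "2 * sqrt pi = exp (ln 2 + ln pi / 2)"
      by (simp add: exp_add ln_sqrt[symmetric])
    have l2: "c ^ (N + 2) = exp ((n + 2) * ((ln n - ln 2) / 2))"
    proof -
      have "ln c = (ln n - ln 2) / 2" using n by (simp add: c_def ln_sqrt ln_div)
      then have "c = exp ((ln n - ln 2) / 2)" using exp_ln[OF c(1)] by metis
      then have "c ^ (N + 2) = exp (real (N + 2) * ((ln n - ln 2) / 2))" by (simp only: exp_of_nat_mult)
      then show ?thesis by (simp add: n_def)
    qed
    have l3: "e\<^sup>2 = exp (- (2 / 3) * ln n)"
      using n by (simp add: e_def cbrt_inv_def n_def powr_def power2_eq_square exp_add[symmetric])
    have l4: "sqrt (2 * pi / exp 1) = exp ((ln 2 + ln pi - 1) / 2)"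
    proof -
      have "2 * pi / exp 1 = (exp ((ln 2 + ln pi - 1) / 2))\<^sup>2"
        by (simp add: power2_eq_square exp_add[symmetric] exp_diff exp_add)
      then show ?thesis by simp
    qed
    have l5: "(exp 1 * real (Suc N) / 2) powr (real (Suc N) / 2) = exp ((n + 1) / 2 * (1 + ln (n + 1) - ln 2))"
      unfolding n(2) using n(1) by (simp add: powr_def ln_div ln_mult)
    have l6: "real (Suc N) powr (-1/6) = exp (- (1 / 6) * ln (n + 1))" using n by (simp add: powr_def)
    define y where "y = (n + 1) powr (1/3)"
    have "\<bar>herm (Suc N) (herm_top N)\<bar> = 2 * sqrt pi * c ^ (N + 2) * e\<^sup>2 * exp ((herm_top N)\<^sup>2 - 3 * (n / 2) - z N / e) * \<bar>J N\<bar>"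
      unfolding c_def e_def n_def using elim by blast
    also have "\<dots> = exp (ln 2 + ln pi / 2 + (n + 2) * ((ln n - ln 2) / 2) + - (2 / 3) * ln n + (n / 2 + z N * x + (z N)\<^sup>2 * e / 2)) * \<bar>J N\<bar>"
      unfolding top l1 l2 l3 exp_add ..
    also have "ln 2 + ln pi / 2 + (n + 2) * ((ln n - ln 2) / 2) + - (2 / 3) * ln n + (n / 2 + z N * x + (z N)\<^sup>2 * e / 2)
        = ((ln 2 + ln pi - 1) / 2 + (n + 1) / 2 * (1 + ln (n + 1) - ln 2) + airy_i1 * y + - (1 / 6) * ln (n + 1)) + (f N + g N)"
    proof -
      have "f N = (z N - airy_i1) * x - 1 / 2 + (z N)\<^sup>2 * e / 2" unfolding f_def e_def[symmetric] ex[symmetric] by simp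
      then show ?thesis unfolding g_def n_def[symmetric] x_def[symmetric] y_def[symmetric]
        by (simp add: field_simps)
    qed
    finally have "\<bar>herm (Suc N) (herm_top N)\<bar> = exp ((ln 2 + ln pi - 1) / 2) * exp ((n + 1) / 2 * (1 + ln (n + 1) - ln 2)) * exp (airy_i1 * y) * exp (- (1 / 6) * ln (n + 1)) * exp (f N + g N) * \<bar>J N\<bar>"
      unfolding exp_add .
    then have "\<bar>herm (Suc N) (herm_top N)\<bar> / (exp ((ln 2 + ln pi - 1) / 2) * A * exp ((n + 1) / 2 * (1 + ln (n + 1) - ln 2)) * exp (airy_i1 * y) * exp (- (1 / 6) * ln (n + 1)))
        = exp (f N + g N) * R4 N"
      by (simp add: R4_def)
    then show ?case unfolding l4 l5 l6 unfolding n(2) A_def[symmetric] y_def[symmetric] diff_Suc_1 by simp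
  qed
  from landau_o.big.in_cong[OF this] main
  have "(\<lambda>N. ?F (Suc N)) \<in> O(\<lambda>N. real (Suc N) powr (-1/3))" by blast
  then obtain B where "eventually (\<lambda>N. norm (?F (Suc N)) \<le> B * norm (real (Suc N) powr (-1/3))) sequentially"
    by (rule landau_o.bigE)
  then have "eventually (\<lambda>N. norm (?F N) \<le> B * norm (real N powr (-1/3))) sequentially"
    by (rule eventually_sequentially_Suc[THEN iffD1])
  then show ?thesis by (rule bigoI)
qed

theorem theorem1p6:
  fixes a0 C0 a1 C1 :: real
  defines "a0 \<equiv> - airy_i1 / 2 powr (1/3)"
      and "C0 \<equiv> 4 powr (1/3) * sqrt (pi / exp 1) * \<bar>deriv Ai airy_i1\<bar>"
      and "a1 \<equiv> \<bar>airy_i1\<bar>"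
      and "C1 \<equiv> sqrt (2 * pi / exp 1) * \<bar>deriv Ai airy_i1\<bar>"
  shows "\<exists>tau1 tau2 :: nat \<Rightarrow> real.
           (\<forall>k\<ge>1. (\<lambda>n. tau n k) \<longlonglongrightarrow> tau1 k)
         \<and> (\<lambda>k. tau1 k / (C0 * (2 / exp 1) ^ k * exp (- a0 * real k powr (1/3))
                             * real k powr (-1/6)) - 1)
             \<in> O(\<lambda>k. real k powr (-1/3))
         \<and> (\<forall>m\<ge>2. (\<lambda>n. real n powr (real m / 2) * tau n (n - m)) \<longlonglongrightarrow> tau2 m)
         \<and> (\<lambda>m. tau2 m / (C1 * (exp 1 * real m / 2) powr (real m / 2)
                             * exp (- a1 * real m powr (1/3)) * real m powr (-1/6)) - 1)
             \<in> O(\<lambda>m. real m powr (-1/3))"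
proof (intro exI conjI allI impI)
  have d: "\<bar>deriv Ai airy_i1\<bar> = airyD 1 airy_i1" using airy_i1_deriv by simp
  have a1: "- a1 = airy_i1" using airy_i1(2) by (simp add: a1_def)
  show "(\<lambda>n. tau n k) \<longlonglongrightarrow> \<bar>bess k (bess_zero k)\<bar>" for k by (rule tau_bessel_limit)
  show "(\<lambda>n. real n powr (real m / 2) * tau n (n - m)) \<longlonglongrightarrow> \<bar>herm m (herm_top (m - 1))\<bar>" if "m \<ge> 2" for m
    using that by (rule tau_hermite_limit)
  show "(\<lambda>k. \<bar>bess k (bess_zero k)\<bar> / (C0 * (2 / exp 1) ^ k * exp (- a0 * real k powr (1/3)) * real k powr (-1/6)) - 1)
      \<in> O(\<lambda>k. real k powr (-1/3))" unfolding C0_def a0_def d by (rule bessel_asymp)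
  show "(\<lambda>m. \<bar>herm m (herm_top (m - 1))\<bar> / (C1 * (exp 1 * real m / 2) powr (real m / 2) * exp (- a1 * real m powr (1/3)) * real m powr (-1/6)) - 1)
      \<in> O(\<lambda>m. real m powr (-1/3))" unfolding C1_def a1 d by (rule hermite_asymp)
qed

end
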